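(* For every nonzero $X\in\mathrm{Ten}(n_0;n_1,\dots,n_d)$, the set $\Delta^B(X)$ is a (convex) polytope with rational vertices.
   Context: $V=\mathrm{Ten}(n_0;n_1,\dots,n_d)=\mathbb C^{n_0}\otimes\cdots\otimes\mathbb C^{n_d}$. $B=B(n_1)\times\cdots\times B(n_d)$, $B(n)$ the invertible upper triangular $n\times n$ complex matrices, acting by $R\cdot X=(I_{n_0}\otimes R^{(1)}\otimes\cdots\otimes R^{(d)})X$. For $Y\in V$, $\rho_Y^{(i)}$ is the partial trace of $YY^\dagger$ over all tensor factors except the $i$-th ($1\le i\le d$). $P_+(n)=\{s\in\mathbb R^n:s_1\ge\cdots\ge s_n\ge0,\sum s_j=1\}$, $P_+(n_1,\dots,n_d)=\prod_iP_+(n_i)$; for $\vec p$ in it, $\vec p^{(i)}_\uparrow=(p^{(i)}_{n_i},\dots,p^{(i)}_1)$. The Borel polytope $\Delta^B(X)$ is the set of $\vec p\in P_+(n_1,\dots,n_d)$ for which there exists a unit vector $Y$ with $[Y]$ in the closure of $\{[R\cdot X]:R\in B\}$ in $\mathbb P(V)$ such that $\rho_Y^{(i)}=\mathrm{diag}(\vec p^{(i)}_\uparrow)$ for all $i=1,\dots,d$. *)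

theory Defs
  imports "HOL-Analysis.Analysis" "HOL-Analysis.Finite_Function_Topology" "Jordan_Normal_Form.Matrix"
begin

unbundle no vec_syntax

text \<open>Tensors of format \<open>(n 0; n 1, \<dots>, n d)\<close> are given by their coordinates in the standard
  basis, which is indexed by multi-indices \<open>\<alpha>\<close> with \<open>\<alpha> i < n i\<close> (counted from 0) for
  \<open>i = 0, \<dots>, d\<close>.  Values of \<open>n\<close> beyond \<open>d\<close> are irrelevant.\<close>

definition multi_indices :: "nat \<Rightarrow> (nat \<Rightarrow> nat) \<Rightarrow> (nat \<Rightarrow> nat) set" where
  "multi_indices d n = (\<Pi>\<^sub>E i\<in>{0..d}. {0..<n i})"

type_synonym tensor = "(nat \<Rightarrow> nat) \<Rightarrow> complex"

definition Ten :: "nat \<Rightarrow> (nat \<Rightarrow> nat) \<Rightarrow> tensor set" where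
  "Ten d n = {X. \<forall>\<alpha>. \<alpha> \<notin> multi_indices d n \<longrightarrow> X \<alpha> = 0}"

definition tensor_norm :: "nat \<Rightarrow> (nat \<Rightarrow> nat) \<Rightarrow> tensor \<Rightarrow> real" where
  "tensor_norm d n X = L2_set (\<lambda>\<alpha>. cmod (X \<alpha>)) (multi_indices d n)"

definition upper_triangular_group :: "nat \<Rightarrow> complex mat set" where
  "upper_triangular_group m = {A \<in> carrier_mat m m. upper_triangular A \<and> invertible_mat A}"

definition Borel_group :: "nat \<Rightarrow> (nat \<Rightarrow> nat) \<Rightarrow> (nat \<Rightarrow> complex mat) set" where
  "Borel_group d n = (\<Pi>\<^sub>E i\<in>{1..d}. upper_triangular_group (n i))"

text \<open>Matrix-vector product of the Kronecker product \<open>A 0 \<otimes> \<dots> \<otimes> A d\<close>, whose \<open>(\<alpha>, \<beta>)\<close> entry is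
  \<open>\<Prod>i\<le>d. A i $$ (\<alpha> i, \<beta> i)\<close>, with a tensor.\<close>

definition kronecker_apply :: "nat \<Rightarrow> (nat \<Rightarrow> nat) \<Rightarrow> (nat \<Rightarrow> complex mat) \<Rightarrow> tensor \<Rightarrow> tensor" where
  "kronecker_apply d n A X = (\<lambda>\<alpha>. if \<alpha> \<in> multi_indices d n
     then \<Sum>\<beta>\<in>multi_indices d n. (\<Prod>i\<in>{0..d}. A i $$ (\<alpha> i, \<beta> i)) * X \<beta> else 0)"

definition Borel_action :: "nat \<Rightarrow> (nat \<Rightarrow> nat) \<Rightarrow> (nat \<Rightarrow> complex mat) \<Rightarrow> tensor \<Rightarrow> tensor" where
  "Borel_action d n R X = kronecker_apply d n (R(0 := 1\<^sub>m (n 0))) X"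

text \<open>A point \<open>[X]\<close> of projective space is the set of nonzero multiples of a nonzero \<open>X\<close>.  The
  function topology restricted to \<^term>\<open>Ten d n\<close> is the usual topology of this finite-dimensional
  space, and projective space carries the corresponding quotient topology.\<close>

definition proj_point :: "tensor \<Rightarrow> tensor set" where
  "proj_point X = {\<lambda>\<alpha>. c * X \<alpha> | c. c \<noteq> 0}"

definition projective_space :: "nat \<Rightarrow> (nat \<Rightarrow> nat) \<Rightarrow> tensor set topology" where
  "projective_space d n = topology (\<lambda>U. U \<subseteq> proj_point ` (Ten d n - {\<lambda>_. 0}) \<and>
     openin (top_of_set (Ten d n - {\<lambda>_. 0})) {X \<in> Ten d n - {\<lambda>_. 0}. proj_point X \<in> U})"

lemma openin_projective_space:
  "openin (projective_space d n) U \<longleftrightarrow> U \<subseteq> proj_point ` (Ten d n - {\<lambda>_. 0}) \<and>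
     openin (top_of_set (Ten d n - {\<lambda>_. 0})) {X \<in> Ten d n - {\<lambda>_. 0}. proj_point X \<in> U}"
proof -
  let ?V = "Ten d n - {\<lambda>_. 0}"
  let ?pre = "\<lambda>U. {X \<in> ?V. proj_point X \<in> U}"
  have "istopology (\<lambda>U. U \<subseteq> proj_point ` ?V \<and> openin (top_of_set ?V) (?pre U))"
    unfolding istopology_def
  proof (intro conjI allI impI)
    fix S T assume S: "S \<subseteq> proj_point ` ?V \<and> openin (top_of_set ?V) (?pre S)"
      and T: "T \<subseteq> proj_point ` ?V \<and> openin (top_of_set ?V) (?pre T)"
    show "S \<inter> T \<subseteq> proj_point ` ?V" using S by blast
    have "?pre (S \<inter> T) = ?pre S \<inter> ?pre T" by blast
    moreover have "openin (top_of_set ?V) (?pre S \<inter> ?pre T)"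
      using S T by (intro openin_Int) simp_all
    ultimately show "openin (top_of_set ?V) (?pre (S \<inter> T))" by (simp only:)
  next
    fix \<K> assume K: "\<forall>K\<in>\<K>. K \<subseteq> proj_point ` ?V \<and> openin (top_of_set ?V) (?pre K)"
    then show "\<Union>\<K> \<subseteq> proj_point ` ?V" by blast
    have "?pre (\<Union>\<K>) = \<Union> (?pre ` \<K>)" by blast
    moreover have "openin (top_of_set ?V) (\<Union> (?pre ` \<K>))"
    proof (rule openin_Union)
      fix W assume "W \<in> ?pre ` \<K>"
      then obtain K where "K \<in> \<K>" "W = ?pre K" by blast
      then show "openin (top_of_set ?V) W" using K by simp
    qed
    ultimately show "openin (top_of_set ?V) (?pre (\<Union>\<K>))" by (simp only:)
  qed
  then show ?thesis unfolding projective_space_def by (simp add: topology_inverse')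
qed

lemma topspace_projective_space: "topspace (projective_space d n) = proj_point ` (Ten d n - {\<lambda>_. 0})"
proof (rule antisym)
  show "topspace (projective_space d n) \<subseteq> proj_point ` (Ten d n - {\<lambda>_. 0})"
    using openin_topspace[of "projective_space d n"] unfolding openin_projective_space by blast
  have "{X \<in> Ten d n - {\<lambda>_. 0}. proj_point X \<in> proj_point ` (Ten d n - {\<lambda>_. 0})}
      = Ten d n - {\<lambda>_. 0}" by blast
  then have "openin (projective_space d n) (proj_point ` (Ten d n - {\<lambda>_. 0}))"
    unfolding openin_projective_space by (simp only: openin_subtopology_self subset_refl simp_thms)
  then show "proj_point ` (Ten d n - {\<lambda>_. 0}) \<subseteq> topspace (projective_space d n)"
    by (rule openin_subset)
qed

lemma quotient_map_proj_point:
  "quotient_map (top_of_set (Ten d n - {\<lambda>_. 0})) (projective_space d n) proj_point"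
  unfolding quotient_map_def topspace_projective_space openin_projective_space by auto

text \<open>An operator on the tensor space is given by its matrix entries \<open>M \<alpha> \<beta>\<close>.\<close>

definition partial_trace ::
    "nat \<Rightarrow> (nat \<Rightarrow> nat) \<Rightarrow> nat \<Rightarrow> ((nat \<Rightarrow> nat) \<Rightarrow> (nat \<Rightarrow> nat) \<Rightarrow> complex) \<Rightarrow> complex mat" where
  "partial_trace d n i M = Matrix.mat (n i) (n i)
     (\<lambda>(a, b). \<Sum>\<alpha> | \<alpha> \<in> multi_indices d n \<and> \<alpha> i = a. M \<alpha> (\<alpha>(i := b)))"

definition marginal :: "nat \<Rightarrow> (nat \<Rightarrow> nat) \<Rightarrow> tensor \<Rightarrow> nat \<Rightarrow> complex mat" where
  "marginal d n Y i = partial_trace d n i (\<lambda>\<alpha> \<beta>. Y \<alpha> * cnj (Y \<beta>))"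

text \<open>Tuples of real vectors, i.e. points of the direct sum of the spaces of dimension
  \<open>n 1, \<dots>, n d\<close>, are encoded in one real vector space that does not depend on \<open>n\<close>: the entry
  \<open>j < n i\<close> (counted from 0) of the \<open>i\<close>-th vector is the value at \<open>(i, j)\<close>, and all other values
  are 0.\<close>

type_synonym spectra = "(nat \<times> nat) \<Rightarrow>\<^sub>0 real"

definition P_plus :: "nat \<Rightarrow> real vec set" where
  "P_plus m = {s \<in> carrier_vec m. (\<forall>j k. j \<le> k \<and> k < m \<longrightarrow> s $ k \<le> s $ j) \<and>
     (\<forall>j<m. 0 \<le> s $ j) \<and> (\<Sum>j<m. s $ j) = 1}"

definition component :: "(nat \<Rightarrow> nat) \<Rightarrow> spectra \<Rightarrow> nat \<Rightarrow> real vec" where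
  "component n p i = Matrix.vec (n i) (\<lambda>j. Poly_Mapping.lookup p (i, j))"

definition P_plus_tuple :: "nat \<Rightarrow> (nat \<Rightarrow> nat) \<Rightarrow> spectra set" where
  "P_plus_tuple d n = {p. Poly_Mapping.keys p \<subseteq> (SIGMA i:{1..d}. {0..<n i}) \<and>
     (\<forall>i\<in>{1..d}. component n p i \<in> P_plus (n i))}"

definition reversed_diag :: "real vec \<Rightarrow> complex mat" where
  "reversed_diag s = mat_diag (dim_vec s) (\<lambda>j. complex_of_real (s $ (dim_vec s - 1 - j)))"

definition Borel_polytope :: "nat \<Rightarrow> (nat \<Rightarrow> nat) \<Rightarrow> tensor \<Rightarrow> spectra set" where
  "Borel_polytope d n X = {p \<in> P_plus_tuple d n. \<exists>Y \<in> Ten d n. tensor_norm d n Y = 1 \<and>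
     proj_point Y \<in> projective_space d n closure_of
       {proj_point (Borel_action d n R X) | R. R \<in> Borel_group d n} \<and>
     (\<forall>i\<in>{1..d}. marginal d n Y i = reversed_diag (component n p i))}"

end

theory Submission
  imports Defs "Jordan_Normal_Form.Determinant"
begin

text \<open>
  The polytope consists of all \<open>p \<in> P\<^sub>+\<close> such that, for every \<open>U\<close> in the Borel group, the
  reversed tuple of \<open>p\<close> is a convex combination of the weights in the support of \<open>U X\<close>.  Since
  there are only finitely many supports, this is a bounded rational polyhedron.

  If a functional \<open>h\<close> on the weights separates \<open>p\<close> from the support of \<open>U X\<close>, then every point
  of the orbit is a unitary image of a tensor in a filtration subspace determined by \<open>h\<close>.  The
  unitary matrices in question come from triangular ones and therefore satisfy a trace inequality,
  which excludes the marginals \<open>p\<close> in the limit because the reversed spectra are increasing.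

  The converse is the Hilbert-Mumford argument.  If the squared norm of \<open>U X\<close>, divided by the
  squared modulus of the character \<open>p\<close> at \<open>U\<close>, came arbitrarily close to 0 on the Borel group,
  a pivoted QR decomposition followed by a row reduction would produce in the limit a triangular
  \<open>E\<close> such that \<open>p\<close> is not in the hull of the support of \<open>E X\<close>.  So the infimum of the quotient is
  positive, a limit of a normalised minimising sequence minimises the quotient on its own orbit, and
  first-order optimality says that its marginals are diagonal with entries \<open>p\<close>.
\<close>

section \<open>Bounded rational polyhedra\<close>

text \<open>Both inclusions therefore work with left factors outside the group and control what
  these cost. The cost is bearable because the reversed spectra increase: summation by parts turns a
  count of coordinates in one direction, and bounds on leading minors in the other, into bounds on
  pairings with \<open>p\<close>. The triangular limit \<open>E\<close> of a bad sequence lies in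
  the group again but depends on the sequence; this is why the hull condition is stated for all
  \<open>U\<close> rather than for one generic element. Rationality is obtained without eliminating
  variables. A hull condition is existential in its convex coefficients; keeping these coefficients
  as coordinates gives linear inequalities with coefficients 0, 1 and -1, and the polytope is an
  affine image of their solution set.\<close>

text \<open>The coordinate along 1 in a basis of the reals over the rationals that contains 1.
  Applied to every coordinate of a solution of a rational linear system it yields another solution,
  so a unique solution is fixed by it and hence rational; this takes the place of Cramer's
  rule.\<close>

lemma ex_rational_linear_functional:
  obtains \<phi> :: "real \<Rightarrow> real"
  where "\<And>x y. \<phi> (x + y) = \<phi> x + \<phi> y" and "\<And>r x. r \<in> \<rat> \<Longrightarrow> \<phi> (r * x) = r * \<phi> x"
    and "\<phi> 1 = 1" and "\<And>x. \<phi> x \<in> \<rat>"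
proof -
  interpret V: vector_space "\<lambda>(r::rat) (x::real). of_rat r * x"
    by unfold_locales (simp_all add: algebra_simps of_rat_add of_rat_mult)
  define B where "B = V.extend_basis {1}"
  have ind1: "\<not> V.dependent {1::real}"
    by (simp add: V.dependent_single)
  have ind: "\<not> V.dependent B"
    unfolding B_def by (rule V.independent_extend_basis[OF ind1])
  have span: "V.span B = UNIV"
    unfolding B_def by (rule V.span_extend_basis[OF ind1])
  have "1 \<in> B"
    using V.extend_basis_superset[OF ind1] unfolding B_def by auto
  define \<phi> where "\<phi> x = (of_rat (V.representation B x 1) :: real)" for x
  show ?thesis
  proof
    show "\<phi> (x + y) = \<phi> x + \<phi> y" for x y
      unfolding \<phi>_def using V.representation_add[OF ind, of y x] span by (simp add: of_rat_add add.commute)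
    show "\<phi> (r * x) = r * \<phi> x" if "r \<in> \<rat>" for r x
    proof -
      obtain q where q: "r = of_rat q" using \<open>r \<in> \<rat>\<close> by (auto elim: Rats_cases)
      show ?thesis
        unfolding \<phi>_def q using V.representation_scale[OF ind, of x q] span by (simp add: of_rat_mult)
    qed
    show "\<phi> 1 = 1"
      unfolding \<phi>_def using V.representation_basis[OF ind \<open>1 \<in> B\<close>] by simp
    show "\<phi> x \<in> \<rat>" for x unfolding \<phi>_def by simp
  qed
qed

text \<open>Points vanish off \<open>J\<close>, so that for finite \<open>J\<close> functions on an
  arbitrary type form a finite-dimensional space and a direction is determined by its values on
  \<open>J\<close>.\<close>

definition polyhedral :: "'v set \<Rightarrow> (('v \<Rightarrow> real) \<times> real) set \<Rightarrow> ('v \<Rightarrow> real) set" where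
  "polyhedral J CS = {x. (\<forall>v. v \<notin> J \<longrightarrow> x v = 0) \<and> (\<forall>k\<in>CS. 0 \<le> (\<Sum>v\<in>J. fst k v * x v) + snd k)}"

definition tight :: "'v set \<Rightarrow> (('v \<Rightarrow> real) \<times> real) set \<Rightarrow> ('v \<Rightarrow> real) \<Rightarrow> (('v \<Rightarrow> real) \<times> real) set" where
  "tight J CS x = {k\<in>CS. (\<Sum>v\<in>J. fst k v * x v) + snd k = 0}"

text \<open>A direction annihilated by the tight constraints keeps them tight. Since the polyhedron
  is bounded, some slack constraint must decrease along the ray, which is followed until one of
  these becomes tight.\<close>

lemma polyhedral_ray_exit:
  assumes fin: "finite CS" and P: "x \<in> polyhedral J CS"
    and "\<forall>y\<in>polyhedral J CS. \<forall>v\<in>J. \<bar>y v\<bar> \<le> B"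
    and "\<forall>v. v \<notin> J \<longrightarrow> d v = 0" and "d \<noteq> (\<lambda>_. 0)"
    and "\<forall>k\<in>tight J CS x. (\<Sum>v\<in>J. fst k v * d v) = 0"
  obtains s where "s > 0" "(\<lambda>v. x v + s * d v) \<in> polyhedral J CS"
    "tight J CS x \<subset> tight J CS (\<lambda>v. x v + s * d v)"
proof -
  note bounded = assms(3)[rule_format] and d0 = assms(4)[rule_format] and dt = assms(6)[rule_format]
  define ev where "ev k y = (\<Sum>v\<in>J. fst k v * y v) + snd k" for k :: "('a \<Rightarrow> real) \<times> real" and y
  define dl where "dl k = (\<Sum>v\<in>J. fst k v * d v)" for k :: "('a \<Rightarrow> real) \<times> real"
  have ev: "ev k (\<lambda>v. x v + s * d v) = ev k x + s * dl k" for k s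
    unfolding ev_def dl_def by (simp add: distrib_left sum.distrib sum_distrib_left mult_ac)
  have x0: "x v = 0" if "v \<notin> J" for v using P that unfolding polyhedral_def by blast
  have evx: "0 \<le> ev k x" if "k \<in> CS" for k using P that unfolding polyhedral_def ev_def by blast
  have mem: "(\<lambda>v. x v + s * d v) \<in> polyhedral J CS" if "\<And>k. k \<in> CS \<Longrightarrow> 0 \<le> ev k x + s * dl k" for s
  proof -
    have "0 \<le> ev k (\<lambda>v. x v + s * d v)" if "k \<in> CS" for k
      unfolding ev using \<open>k \<in> CS\<close> \<open>\<And>k. k \<in> CS \<Longrightarrow> 0 \<le> ev k x + s * dl k\<close> by blast
    then show ?thesis using x0 d0 unfolding polyhedral_def ev_def by auto
  qed
  define N where "N = {k\<in>CS. dl k < 0}"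
  have finN: "finite N" using fin unfolding N_def by simp
  have "N \<noteq> {}"
  proof
    assume "N = {}"
    then have nn: "0 \<le> dl k" if "k \<in> CS" for k using that not_le[of 0 "dl k"] unfolding N_def by blast
    obtain v where v: "d v \<noteq> 0" using \<open>d \<noteq> (\<lambda>_. 0)\<close> by auto
    then have "v \<in> J" using d0 by blast
    \<comment> \<open>This parameter moves the coordinate \<open>v\<close> by |B| + |x v| + 1, which
      is more than the bound \<open>B\<close> allows.\<close>
    define s where "s = (\<bar>B\<bar> + \<bar>x v\<bar> + 1) / \<bar>d v\<bar>"
    have "s \<ge> 0" unfolding s_def by simp
    then have "(\<lambda>v. x v + s * d v) \<in> polyhedral J CS"
      using nn evx by (intro mem) (simp add: add_nonneg_nonneg)
    from bounded[OF this \<open>v \<in> J\<close>] have "\<bar>x v + s * d v\<bar> \<le> B" .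
    moreover have "\<bar>s * d v\<bar> = \<bar>B\<bar> + \<bar>x v\<bar> + 1" unfolding s_def using v by (simp add: abs_mult)
    ultimately show False by linarith
  qed
  \<comment> \<open>Ratio test: the first parameter at which a decreasing constraint reaches
    0.\<close>
  define s where "s = Min ((\<lambda>k. ev k x / - dl k) ` N)"
  have "s \<in> (\<lambda>k. ev k x / - dl k) ` N" unfolding s_def using finN \<open>N \<noteq> {}\<close> by (intro Min_in) auto
  then obtain k0 where k0: "k0 \<in> N" "s = ev k0 x / - dl k0" by blast
  have nt: "k \<notin> tight J CS x" if "k \<in> N" for k using that dt[of k] unfolding N_def dl_def by auto
  have pos: "ev k x > 0" if "k \<in> N" for k
  proof -
    have "k \<in> CS" using that unfolding N_def by blast
    moreover have "ev k x \<noteq> 0" using nt[OF that] \<open>k \<in> CS\<close> unfolding tight_def ev_def by blast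
    ultimately show ?thesis using evx[of k] by linarith
  qed
  have "s > 0" unfolding k0(2) using pos[OF k0(1)] k0(1) unfolding N_def by (auto intro!: divide_pos_neg)
  have ge: "0 \<le> ev k x + s * dl k" if "k \<in> CS" for k
  proof (cases "k \<in> N")
    case True
    then have "s \<le> ev k x / - dl k" unfolding s_def using finN by (intro Min_le) auto
    moreover have "dl k < 0" using True unfolding N_def by simp
    ultimately show ?thesis by (simp add: field_simps)
  next
    case False
    then have "0 \<le> dl k" using that unfolding N_def by simp
    then show ?thesis using evx[OF that] \<open>s > 0\<close> by simp
  qed
  have "ev k0 x + s * dl k0 = 0" unfolding k0(2) using k0(1) unfolding N_def by auto
  then have "k0 \<in> tight J CS (\<lambda>v. x v + s * d v)"
    using k0(1) unfolding tight_def ev_def[symmetric] ev N_def by simp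
  moreover have "tight J CS x \<subseteq> tight J CS (\<lambda>v. x v + s * d v)"
  proof
    fix k assume k: "k \<in> tight J CS x"
    then show "k \<in> tight J CS (\<lambda>v. x v + s * d v)"
      using dt[OF k] unfolding tight_def ev_def[symmetric] ev dl_def[symmetric] by simp
  qed
  ultimately show ?thesis using that \<open>s > 0\<close> mem[OF ge] nt[OF k0(1)] by blast
qed

text \<open>The \<open>rigid\<close> points are the vertices. Any other point lies between the two
  exits of a line through it, and both exits have strictly more tight constraints; this gives an
  induction on the number of slack ones. Only convex combinations of two points occur, so affinity
  of \<open>\<pi>\<close> is required exactly for these.\<close>

theorem bounded_rational_polyhedral_image:
  fixes \<pi> :: "('v \<Rightarrow> real) \<Rightarrow> 'b::real_vector"
  assumes finJ: "finite J" and fin: "finite CS"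
    and rat: "\<And>k. k \<in> CS \<Longrightarrow> snd k \<in> \<rat>" "\<And>k v. k \<in> CS \<Longrightarrow> v \<in> J \<Longrightarrow> fst k v \<in> \<rat>"
    and bounded: "\<forall>y\<in>polyhedral J CS. \<forall>v\<in>J. \<bar>y v\<bar> \<le> B"
    and affine: "\<And>x y s. 0 \<le> s \<Longrightarrow> s \<le> 1 \<Longrightarrow>
      \<pi> (\<lambda>v. (1 - s) * x v + s * y v) = (1 - s) *\<^sub>R \<pi> x + s *\<^sub>R \<pi> y"
  obtains V where "finite V" "V \<subseteq> polyhedral J CS" "\<forall>x\<in>V. \<forall>v. x v \<in> \<rat>"
    "\<pi> ` polyhedral J CS = convex hull (\<pi> ` V)"
proof -
  let ?P = "polyhedral J CS" and ?T = "tight J CS"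
  define rigid where "rigid T \<longleftrightarrow> (\<forall>d. (\<forall>v. v \<notin> J \<longrightarrow> d v = 0) \<and>
      (\<forall>k\<in>T. (\<Sum>v\<in>J. fst k v * d v) = 0) \<longrightarrow> d = (\<lambda>_. 0))" for T :: "(('v \<Rightarrow> real) \<times> real) set"
  have rigidD: "d = (\<lambda>_. 0)" if "rigid T" "\<And>v. v \<notin> J \<Longrightarrow> d v = 0"
    "\<And>k. k \<in> T \<Longrightarrow> (\<Sum>v\<in>J. fst k v * d v) = 0" for d T
    using that unfolding rigid_def by simp
  define V where "V = {x \<in> ?P. rigid (?T x)}"
  have x0: "x v = 0" if "x \<in> ?P" "v \<notin> J" for x v using that unfolding polyhedral_def by blast
  \<comment> \<open>The difference of two vertices with the same tight constraints is a direction
    annihilated by all of them, hence 0. So there are at most as many vertices as subsets of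
    \<open>CS\<close>.\<close>
  have inj: "inj_on ?T V"
  proof (rule inj_onI)
    fix x y assume x: "x \<in> V" and y: "y \<in> V" and eq: "?T x = ?T y"
    have "(\<lambda>v. x v - y v) = (\<lambda>_. 0)"
    proof (rule rigidD[of "?T x"])
      show "(\<Sum>v\<in>J. fst k v * (x v - y v)) = 0" if "k \<in> ?T x" for k
      proof -
        have "k \<in> ?T x" "k \<in> ?T y" using that eq by auto
        then show ?thesis unfolding tight_def by (simp add: right_diff_distrib sum_subtractf)
      qed
      show "x v - y v = 0" if "v \<notin> J" for v
        using x y x0[of x v, OF _ that] x0[of y v, OF _ that] unfolding V_def by simp
      show "rigid (?T x)" using x unfolding V_def by blast
    qed
    then show "x = y" by (auto simp: fun_eq_iff)
  qed
  have "?T ` V \<subseteq> Pow CS" unfolding tight_def by blast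
  then have finV: "finite V" using inj fin by (meson finite_Pow_iff inj_on_finite)
  obtain \<phi> :: "real \<Rightarrow> real" where phi: "\<And>x y. \<phi> (x + y) = \<phi> x + \<phi> y"
      "\<And>r x. r \<in> \<rat> \<Longrightarrow> \<phi> (r * x) = r * \<phi> x" "\<phi> 1 = 1" "\<And>x. \<phi> x \<in> \<rat>"
    using ex_rational_linear_functional by blast
  have phi0: "\<phi> 0 = 0" using phi(1)[of 0 0] by simp
  have phi_sum: "\<phi> (sum f A) = (\<Sum>a\<in>A. \<phi> (f a))" if "finite A" for f and A :: "'v set"
    using that by (induction A rule: finite_induct) (simp_all add: phi phi0)
  have ratV: "x v \<in> \<rat>" if x: "x \<in> V" for x v
  proof -
    \<comment> \<open>\<open>\<phi>\<close> fixes the rational constants and commutes with the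
      rational coefficients, so the image of \<open>x\<close> solves the tight equations too, and
      rigidity identifies the two.\<close>
    have "(\<lambda>v. \<phi> (x v) - x v) = (\<lambda>_. 0)"
    proof (rule rigidD[of "?T x"])
      show "(\<Sum>v\<in>J. fst k v * (\<phi> (x v) - x v)) = 0" if k: "k \<in> ?T x" for k
      proof -
        have "k \<in> CS" using k unfolding tight_def by blast
        have 0: "(\<Sum>v\<in>J. fst k v * x v) + snd k = 0" using k unfolding tight_def by blast
        have "\<phi> ((\<Sum>v\<in>J. fst k v * x v) + snd k) = (\<Sum>v\<in>J. fst k v * \<phi> (x v)) + snd k"
          using phi(2)[OF rat(1)[OF \<open>k \<in> CS\<close>], of 1] rat(2)[OF \<open>k \<in> CS\<close>]
          by (simp add: phi phi_sum finJ)
        then show ?thesis using 0 phi0 by (simp add: right_diff_distrib sum_subtractf)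
      qed
      show "\<phi> (x v) - x v = 0" if "v \<notin> J" for v
        using x x0[of x v, OF _ that] phi0 unfolding V_def by simp
      show "rigid (?T x)" using x unfolding V_def by blast
    qed
    from fun_cong[OF this, of v] show ?thesis using phi(4)[of "x v"] by simp
  qed
  have "\<pi> x \<in> convex hull (\<pi> ` V)" if "x \<in> ?P" for x
    using that
  proof (induction "card (CS - ?T x)" arbitrary: x rule: less_induct)
    case (less x)
    show ?case
    proof (cases "rigid (?T x)")
      case True
      then show ?thesis using less.prems unfolding V_def by (intro hull_inc) blast
    next
      case False
      then obtain d where d: "\<forall>v. v \<notin> J \<longrightarrow> d v = 0" "d \<noteq> (\<lambda>_. 0)"
          "\<forall>k\<in>?T x. (\<Sum>v\<in>J. fst k v * d v) = 0"
        unfolding rigid_def by blast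
      have smaller: "\<pi> y \<in> convex hull (\<pi> ` V)" if "y \<in> ?P" "?T x \<subset> ?T y" for y
      proof (rule less.hyps[OF _ that(1)])
        have "?T y \<subseteq> CS" unfolding tight_def by blast
        then show "card (CS - ?T y) < card (CS - ?T x)"
          using that(2) fin by (intro psubset_card_mono) auto
      qed
      obtain s1 where s1: "s1 > 0" "(\<lambda>v. x v + s1 * d v) \<in> ?P" "?T x \<subset> ?T (\<lambda>v. x v + s1 * d v)"
        by (rule polyhedral_ray_exit[where d = d and x = x and J = J and CS = CS and B = B, OF fin less.prems bounded d])
      have d': "\<forall>v. v \<notin> J \<longrightarrow> - d v = 0" using d(1) by simp
      have d'': "(\<lambda>v. - d v) \<noteq> (\<lambda>_. 0)" using d(2) by (auto simp: fun_eq_iff)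
      have d''': "\<forall>k\<in>?T x. (\<Sum>v\<in>J. fst k v * - d v) = 0"
        using d(3) by (simp add: sum_negf)
      obtain s2 where s2: "s2 > 0" "(\<lambda>v. x v + s2 * - d v) \<in> ?P" "?T x \<subset> ?T (\<lambda>v. x v + s2 * - d v)"
        by (rule polyhedral_ray_exit[where d = "\<lambda>v. - d v" and x = x and J = J and CS = CS and B = B, OF fin less.prems bounded d' d'' d'''])
      \<comment> \<open>The weight for which the displacements \<open>s1 * d v\<close> and
        \<open>s2 * - d v\<close> cancel.\<close>
      define s where "s = s1 / (s1 + s2)"
      have s: "0 \<le> s" "s \<le> 1" unfolding s_def using s1(1) s2(1) by auto
      have "x = (\<lambda>v. (1 - s) * (x v + s1 * d v) + s * (x v + s2 * - d v))"
      proof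
        fix v
        have "(1 - s) * s1 = s * s2" unfolding s_def using s1(1) s2(1) by (simp add: field_simps)
        then have "(1 - s) * s1 * d v = s * s2 * d v" by simp
        moreover have "(1 - s) * (x v + s1 * d v) + s * (x v + s2 * - d v) =
            x v + ((1 - s) * s1 * d v - s * s2 * d v)" by (simp add: algebra_simps)
        ultimately show "x v = (1 - s) * (x v + s1 * d v) + s * (x v + s2 * - d v)" by simp
      qed
      then have "\<pi> x = (1 - s) *\<^sub>R \<pi> (\<lambda>v. x v + s1 * d v) + s *\<^sub>R \<pi> (\<lambda>v. x v + s2 * - d v)"
        using affine[OF s] by metis
      then show ?thesis
        using smaller[OF s1(2,3)] smaller[OF s2(2,3)] s convex_convex_hull[of "\<pi> ` V"]
        unfolding convex_alt by simp
    qed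
  qed
  moreover have "convex (\<pi> ` ?P)"
    unfolding convex_alt
  proof safe
    fix x y and s :: real assume x: "x \<in> ?P" and y: "y \<in> ?P" and s: "0 \<le> s" "s \<le> 1"
    have "(\<lambda>v. (1 - s) * x v + s * y v) \<in> ?P"
    proof -
      have "0 \<le> (\<Sum>v\<in>J. fst k v * ((1 - s) * x v + s * y v)) + snd k" if "k \<in> CS" for k
      proof -
        have "0 \<le> (\<Sum>v\<in>J. fst k v * x v) + snd k" "0 \<le> (\<Sum>v\<in>J. fst k v * y v) + snd k"
          using x y that unfolding polyhedral_def by auto
        moreover have "0 \<le> (1 - s) * a + s * b" if "0 \<le> a" "0 \<le> b" for a b
          using s that by simp
        ultimately have "0 \<le> (1 - s) * ((\<Sum>v\<in>J. fst k v * x v) + snd k) + s * ((\<Sum>v\<in>J. fst k v * y v) + snd k)"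
          by blast
        also have "\<dots> = (\<Sum>v\<in>J. fst k v * ((1 - s) * x v + s * y v)) + snd k"
          by (simp add: algebra_simps sum.distrib sum_distrib_left sum_subtractf)
        finally show ?thesis .
      qed
      then show ?thesis using x y unfolding polyhedral_def by simp
    qed
    then show "(1 - s) *\<^sub>R \<pi> x + s *\<^sub>R \<pi> y \<in> \<pi> ` ?P" unfolding affine[OF s, symmetric] by (rule imageI)
  qed
  then have "convex hull (\<pi> ` V) \<subseteq> \<pi> ` ?P" unfolding V_def by (intro hull_minimal) auto
  ultimately have "\<pi> ` ?P = convex hull (\<pi> ` V)" by auto
  moreover have "V \<subseteq> ?P" unfolding V_def by blast
  ultimately show ?thesis using finV ratV by (intro that[of V]) auto
qed

section \<open>Actions of matrix tuples on tensors\<close>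

text \<open>The action of \<open>kronecker_apply\<close> with matrices as plain functions: products
  and limits of matrices are then free of carrier conditions.\<close>

definition kron :: "nat \<Rightarrow> (nat \<Rightarrow> nat) \<Rightarrow> (nat \<Rightarrow> nat \<Rightarrow> nat \<Rightarrow> complex) \<Rightarrow> tensor \<Rightarrow> tensor" where
  "kron d n U X = (\<lambda>\<alpha>. if \<alpha> \<in> multi_indices d n
     then \<Sum>\<beta>\<in>multi_indices d n. (\<Prod>i\<in>{0..d}. U i (\<alpha> i) (\<beta> i)) * X \<beta> else 0)"

lemma finite_multi_indices [simp]: "finite (multi_indices d n)"
  unfolding multi_indices_def by (intro finite_PiE) auto

lemma multi_indices_less: "\<alpha> \<in> multi_indices d n \<Longrightarrow> i \<le> d \<Longrightarrow> \<alpha> i < n i"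
  unfolding multi_indices_def by (auto simp: PiE_def Pi_def)

lemma multi_indices_eqI:
  assumes "\<alpha> \<in> multi_indices d n" "\<beta> \<in> multi_indices d n" "\<And>i. i \<le> d \<Longrightarrow> \<alpha> i = \<beta> i"
  shows "\<alpha> = \<beta>"
  using assms unfolding multi_indices_def by (intro PiE_ext[of \<alpha> _ _ \<beta>]) auto

lemma multi_indices_upd:
  assumes "\<alpha> \<in> multi_indices d n" "i \<le> d" "b < n i"
  shows "\<alpha>(i := b) \<in> multi_indices d n"
  using assms unfolding multi_indices_def by (auto simp: PiE_def Pi_def extensional_def)

lemma sum_multi_indices_prod:
  fixes f :: "nat \<Rightarrow> nat \<Rightarrow> 'a::comm_semiring_1"
  shows "(\<Sum>\<beta>\<in>multi_indices d n. \<Prod>i\<in>{0..d}. f i (\<beta> i)) = (\<Prod>i\<in>{0..d}. \<Sum>b<n i. f i b)"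
  unfolding multi_indices_def lessThan_atLeast0 by (rule prod_sum_PiE[symmetric]) auto

lemma kron_cong:
  assumes "\<And>i a b. i \<le> d \<Longrightarrow> a < n i \<Longrightarrow> b < n i \<Longrightarrow> U i a b = V i a b"
    and "\<And>\<beta>. \<beta> \<in> multi_indices d n \<Longrightarrow> X \<beta> = Y \<beta>"
  shows "kron d n U X = kron d n V Y"
  unfolding kron_def
  by (intro ext if_cong refl sum.cong arg_cong2[of _ _ _ _ "(*)"] prod.cong)
     (use assms in \<open>auto simp: multi_indices_less\<close>)

lemma kron_in_Ten [simp]: "kron d n U X \<in> Ten d n"
  unfolding Ten_def kron_def by auto

lemma kron_comp:
  "kron d n U (kron d n V X) = kron d n (\<lambda>i a c. \<Sum>b<n i. U i a b * V i b c) X"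
proof
  fix \<alpha>
  show "kron d n U (kron d n V X) \<alpha> = kron d n (\<lambda>i a c. \<Sum>b<n i. U i a b * V i b c) X \<alpha>"
  proof (cases "\<alpha> \<in> multi_indices d n")
    case True
    let ?M = "multi_indices d n"
    have "kron d n U (kron d n V X) \<alpha> = (\<Sum>\<beta>\<in>?M. \<Sum>\<gamma>\<in>?M.
        (\<Prod>i\<in>{0..d}. U i (\<alpha> i) (\<beta> i) * V i (\<beta> i) (\<gamma> i)) * X \<gamma>)"
      using True by (simp add: kron_def sum_distrib_left prod.distrib mult.assoc)
    also have "\<dots> = (\<Sum>\<gamma>\<in>?M. (\<Sum>\<beta>\<in>?M. \<Prod>i\<in>{0..d}. U i (\<alpha> i) (\<beta> i) * V i (\<beta> i) (\<gamma> i)) * X \<gamma>)"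
      by (subst sum.swap) (simp add: sum_distrib_right)
    also have "\<dots> = kron d n (\<lambda>i a c. \<Sum>b<n i. U i a b * V i b c) X \<alpha>"
      using True sum_multi_indices_prod[of "\<lambda>i b. U i (\<alpha> i) b * V i b (_ i)" d n] by (simp add: kron_def)
    finally show ?thesis .
  qed (simp add: kron_def)
qed

lemma prod_of_bool: "finite A \<Longrightarrow> (\<Prod>i\<in>A. of_bool (P i)) = (of_bool (\<forall>i\<in>A. P i) :: 'a::comm_semiring_1)"
  by (induction A rule: finite_induct) auto

lemma kron_id:
  assumes "X \<in> Ten d n"
  shows "kron d n (\<lambda>i a b. of_bool (a = b)) X = X"
proof
  fix \<alpha>
  show "kron d n (\<lambda>i a b. of_bool (a = b)) X \<alpha> = X \<alpha>"
  proof (cases "\<alpha> \<in> multi_indices d n")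
    case True
    have "(\<Prod>i\<in>{0..d}. of_bool (\<alpha> i = \<beta> i)) * X \<beta> = (if \<alpha> = \<beta> then X \<alpha> else 0)"
      if "\<beta> \<in> multi_indices d n" for \<beta>
      using multi_indices_eqI[OF True that] by (auto simp: prod_of_bool)
    then show ?thesis using True by (simp add: kron_def)
  next
    case False
    then show ?thesis using assms unfolding kron_def Ten_def by simp
  qed
qed

lemma kron_diff: "kron d n U (\<lambda>\<alpha>. X \<alpha> - Y \<alpha>) = (\<lambda>\<alpha>. kron d n U X \<alpha> - kron d n U Y \<alpha>)"
  unfolding kron_def by (intro ext) (simp add: right_diff_distrib sum_subtractf)

lemma kron_scale: "kron d n U (\<lambda>\<alpha>. c * X \<alpha>) = (\<lambda>\<alpha>. c * kron d n U X \<alpha>)"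
  unfolding kron_def by (intro ext) (simp add: sum_distrib_left mult_ac)

section \<open>Norms and marginals under the action\<close>

definition norm_sq :: "nat \<Rightarrow> (nat \<Rightarrow> nat) \<Rightarrow> tensor \<Rightarrow> real" where
  "norm_sq d n Y = (\<Sum>\<alpha>\<in>multi_indices d n. (cmod (Y \<alpha>))\<^sup>2)"

lemma tensor_norm_eq_1_iff: "tensor_norm d n Y = 1 \<longleftrightarrow> norm_sq d n Y = 1"
  unfolding tensor_norm_def L2_set_def norm_sq_def by simp

definition marginal_entry :: "nat \<Rightarrow> (nat \<Rightarrow> nat) \<Rightarrow> tensor \<Rightarrow> nat \<Rightarrow> nat \<Rightarrow> nat \<Rightarrow> complex" where
  "marginal_entry d n Y i a b = (\<Sum>\<alpha> | \<alpha> \<in> multi_indices d n \<and> \<alpha> i = a. Y \<alpha> * cnj (Y (\<alpha>(i := b))))"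

lemma sum_multi_indices_slice:
  fixes f :: "(nat \<Rightarrow> nat) \<Rightarrow> 'a::comm_monoid_add"
  assumes "i \<le> d"
  shows "(\<Sum>\<alpha>\<in>multi_indices d n. f \<alpha>) = (\<Sum>a<n i. \<Sum>\<alpha> | \<alpha> \<in> multi_indices d n \<and> \<alpha> i = a. f \<alpha>)"
  by (rule sum.group[symmetric]) (use assms multi_indices_less in auto)

text \<open>The sum over \<alpha> factorises over the tensor factors. Unitarity turns every factor
  except the \<open>i\<close>-th into a Kronecker delta, which leaves the trace of the
  \<open>i\<close>-th marginal against the diagonal observable \<open>f\<close> conjugated by
  \<open>W i\<close>.\<close>

lemma kron_weighted_norm:
  fixes W :: "nat \<Rightarrow> nat \<Rightarrow> nat \<Rightarrow> complex" and f :: "nat \<Rightarrow> real"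
  assumes unitary: "\<And>j b c. j \<le> d \<Longrightarrow> j \<noteq> i \<Longrightarrow> b < n j \<Longrightarrow> c < n j \<Longrightarrow>
      (\<Sum>a<n j. W j a b * cnj (W j a c)) = of_bool (b = c)"
    and "i \<le> d"
  shows "(\<Sum>\<alpha>\<in>multi_indices d n. of_real (f (\<alpha> i) * (cmod (kron d n W Y \<alpha>))\<^sup>2)) =
    (\<Sum>b<n i. \<Sum>c<n i. (\<Sum>a<n i. of_real (f a) * W i a b * cnj (W i a c)) * marginal_entry d n Y i b c)"
proof -
  let ?M = "multi_indices d n"
  \<comment> \<open>The weight \<open>f (\<alpha> i)\<close> is written as a product over all
    factors, so that it takes part in the factorisation.\<close>
  define g where "g j a = (if j = i then complex_of_real (f a) else 1)" for j a
  define S where "S j b c = (\<Sum>a<n j. g j a * (W j a b * cnj (W j a c)))" for j b c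
  have g: "of_real (f (\<alpha> i)) = (\<Prod>j\<in>{0..d}. g j (\<alpha> j))" for \<alpha>
    unfolding g_def using \<open>i \<le> d\<close> by (simp add: prod.delta)
  have sq: "of_real (f (\<alpha> i) * (cmod (kron d n W Y \<alpha>))\<^sup>2) =
      (\<Sum>\<beta>\<in>?M. \<Sum>\<gamma>\<in>?M. (\<Prod>j\<in>{0..d}. g j (\<alpha> j) * (W j (\<alpha> j) (\<beta> j) * cnj (W j (\<alpha> j) (\<gamma> j)))) * (Y \<beta> * cnj (Y \<gamma>)))"
    if "\<alpha> \<in> ?M" for \<alpha>
  proof -
    have "complex_of_real (f (\<alpha> i) * (cmod (kron d n W Y \<alpha>))\<^sup>2) =
        (\<Prod>j\<in>{0..d}. g j (\<alpha> j)) * (kron d n W Y \<alpha> * cnj (kron d n W Y \<alpha>))"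
      by (simp only: of_real_mult g complex_norm_square)
    also have "kron d n W Y \<alpha> * cnj (kron d n W Y \<alpha>) = (\<Sum>\<beta>\<in>?M. \<Sum>\<gamma>\<in>?M.
        ((\<Prod>j\<in>{0..d}. W j (\<alpha> j) (\<beta> j)) * Y \<beta>) * ((\<Prod>j\<in>{0..d}. cnj (W j (\<alpha> j) (\<gamma> j))) * cnj (Y \<gamma>)))"
      using that by (simp add: kron_def sum_product)
    finally show ?thesis
      by (simp add: sum_distrib_left prod.distrib mult_ac)
  qed
  have delta: "(\<Prod>j\<in>{0..d}. S j (\<beta> j) (\<gamma> j)) =
      (if \<gamma> = \<beta>(i := \<gamma> i) then S i (\<beta> i) (\<gamma> i) else 0)" if \<beta>: "\<beta> \<in> ?M" and \<gamma>: "\<gamma> \<in> ?M" for \<beta> \<gamma>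
  proof -
    have "(\<Prod>j\<in>{0..d}. S j (\<beta> j) (\<gamma> j)) = S i (\<beta> i) (\<gamma> i) * (\<Prod>j\<in>{0..d} - {i}. S j (\<beta> j) (\<gamma> j))"
      using \<open>i \<le> d\<close> by (simp add: prod.remove)
    also have "(\<Prod>j\<in>{0..d} - {i}. S j (\<beta> j) (\<gamma> j)) = (\<Prod>j\<in>{0..d} - {i}. of_bool (\<beta> j = \<gamma> j))"
      using unitary multi_indices_less[OF \<beta>] multi_indices_less[OF \<gamma>]
      by (intro prod.cong refl) (simp add: S_def g_def)
    also have "\<dots> = of_bool (\<forall>j\<in>{0..d} - {i}. \<beta> j = \<gamma> j)" by (rule prod_of_bool) simp
    also have "(\<forall>j\<in>{0..d} - {i}. \<beta> j = \<gamma> j) \<longleftrightarrow> \<gamma> = \<beta>(i := \<gamma> i)"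
    proof
      assume eq: "\<forall>j\<in>{0..d} - {i}. \<beta> j = \<gamma> j"
      have "\<beta>(i := \<gamma> i) \<in> ?M" using \<beta> \<gamma> \<open>i \<le> d\<close> by (intro multi_indices_upd multi_indices_less)
      then show "\<gamma> = \<beta>(i := \<gamma> i)" using eq by (intro multi_indices_eqI[OF \<gamma>]) auto
    next
      assume "\<gamma> = \<beta>(i := \<gamma> i)"
      then show "\<forall>j\<in>{0..d} - {i}. \<beta> j = \<gamma> j" by (metis DiffD2 fun_upd_apply singletonI)
    qed
    finally show ?thesis by simp
  qed
  have inner: "(\<Sum>\<gamma>\<in>?M. (\<Prod>j\<in>{0..d}. S j (\<beta> j) (\<gamma> j)) * (Y \<beta> * cnj (Y \<gamma>))) =
      (\<Sum>c<n i. S i (\<beta> i) c * (Y \<beta> * cnj (Y (\<beta>(i := c)))))" if \<beta>: "\<beta> \<in> ?M" for \<beta>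
  proof -
    have inj: "inj_on (\<lambda>c. \<beta>(i := c)) {..<n i}" by (rule inj_onI) (metis fun_upd_eqD)
    have sub: "(\<lambda>c. \<beta>(i := c)) ` {..<n i} \<subseteq> ?M" using multi_indices_upd[OF \<beta> \<open>i \<le> d\<close>] by auto
    have "(\<Sum>\<gamma>\<in>?M. (\<Prod>j\<in>{0..d}. S j (\<beta> j) (\<gamma> j)) * (Y \<beta> * cnj (Y \<gamma>))) =
        (\<Sum>\<gamma>\<in>(\<lambda>c. \<beta>(i := c)) ` {..<n i}. (\<Prod>j\<in>{0..d}. S j (\<beta> j) (\<gamma> j)) * (Y \<beta> * cnj (Y \<gamma>)))"
    proof (rule sum.mono_neutral_right[OF _ sub])
      show "\<forall>\<gamma>\<in>?M - (\<lambda>c. \<beta>(i := c)) ` {..<n i}.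
          (\<Prod>j\<in>{0..d}. S j (\<beta> j) (\<gamma> j)) * (Y \<beta> * cnj (Y \<gamma>)) = 0"
      proof
        fix \<gamma> assume \<gamma>: "\<gamma> \<in> ?M - (\<lambda>c. \<beta>(i := c)) ` {..<n i}"
        then have "\<gamma> \<noteq> \<beta>(i := \<gamma> i)" using multi_indices_less[of \<gamma> d n i] \<open>i \<le> d\<close> by blast
        then show "(\<Prod>j\<in>{0..d}. S j (\<beta> j) (\<gamma> j)) * (Y \<beta> * cnj (Y \<gamma>)) = 0"
          using delta[OF \<beta>, of \<gamma>] \<gamma> by simp
      qed
    qed simp
    also have "\<dots> = (\<Sum>c<n i. S i (\<beta> i) c * (Y \<beta> * cnj (Y (\<beta>(i := c)))))"
    proof -
      have "(\<Prod>j\<in>{0..d}. S j (\<beta> j) ((\<beta>(i := c)) j)) = S i (\<beta> i) c" if "c < n i" for c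
        using delta[OF \<beta> multi_indices_upd[OF \<beta> \<open>i \<le> d\<close> that]] by (simp only: fun_upd_same if_True simp_thms)
      then show ?thesis unfolding sum.reindex[OF inj] o_def by (intro sum.cong refl) simp
    qed
    finally show ?thesis .
  qed
  have "(\<Sum>\<alpha>\<in>?M. of_real (f (\<alpha> i) * (cmod (kron d n W Y \<alpha>))\<^sup>2)) =
      (\<Sum>\<alpha>\<in>?M. \<Sum>\<beta>\<in>?M. \<Sum>\<gamma>\<in>?M. (\<Prod>j\<in>{0..d}. g j (\<alpha> j) * (W j (\<alpha> j) (\<beta> j) * cnj (W j (\<alpha> j) (\<gamma> j)))) * (Y \<beta> * cnj (Y \<gamma>)))"
    by (intro sum.cong refl sq)
  also have "\<dots> = (\<Sum>\<beta>\<in>?M. \<Sum>\<gamma>\<in>?M. \<Sum>\<alpha>\<in>?M. (\<Prod>j\<in>{0..d}. g j (\<alpha> j) * (W j (\<alpha> j) (\<beta> j) * cnj (W j (\<alpha> j) (\<gamma> j)))) * (Y \<beta> * cnj (Y \<gamma>)))"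
    by (subst sum.swap) (intro sum.cong refl sum.swap)
  also have "\<dots> = (\<Sum>\<beta>\<in>?M. \<Sum>\<gamma>\<in>?M. (\<Prod>j\<in>{0..d}. S j (\<beta> j) (\<gamma> j)) * (Y \<beta> * cnj (Y \<gamma>)))"
    unfolding S_def sum_multi_indices_prod[symmetric] sum_distrib_right ..
  also have "\<dots> = (\<Sum>\<beta>\<in>?M. \<Sum>c<n i. S i (\<beta> i) c * (Y \<beta> * cnj (Y (\<beta>(i := c)))))"
    by (intro sum.cong refl inner)
  also have "\<dots> = (\<Sum>b<n i. \<Sum>\<beta> | \<beta> \<in> ?M \<and> \<beta> i = b. \<Sum>c<n i. S i (\<beta> i) c * (Y \<beta> * cnj (Y (\<beta>(i := c)))))"
    by (rule sum_multi_indices_slice[OF \<open>i \<le> d\<close>])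
  also have "\<dots> = (\<Sum>b<n i. \<Sum>c<n i. S i b c * marginal_entry d n Y i b c)"
  proof (intro sum.cong refl)
    fix b
    show "(\<Sum>\<beta> | \<beta> \<in> ?M \<and> \<beta> i = b. \<Sum>c<n i. S i (\<beta> i) c * (Y \<beta> * cnj (Y (\<beta>(i := c)))))
        = (\<Sum>c<n i. S i b c * marginal_entry d n Y i b c)"
      unfolding marginal_entry_def sum_distrib_left by (subst sum.swap) simp
  qed
  finally show ?thesis unfolding S_def g_def by (simp add: mult.assoc)
qed

text \<open>The weighted formula with weight 1, read at factor 0, which exists for every
  \<open>d\<close>.\<close>

lemma norm_sq_kron_unitary:
  assumes unitary: "\<And>j b c. j \<le> d \<Longrightarrow> b < n j \<Longrightarrow> c < n j \<Longrightarrow>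
      (\<Sum>a<n j. W j a b * cnj (W j a c)) = of_bool (b = c)"
  shows "norm_sq d n (kron d n W Y) = norm_sq d n Y"
proof -
  have "complex_of_real (norm_sq d n (kron d n W Y)) =
      (\<Sum>b<n 0. \<Sum>c<n 0. (\<Sum>a<n 0. W 0 a b * cnj (W 0 a c)) * marginal_entry d n Y 0 b c)"
    using kron_weighted_norm[of d 0 n W "\<lambda>_. 1" Y] unitary
    unfolding norm_sq_def by simp
  also have "\<dots> = (\<Sum>b<n 0. \<Sum>c<n 0. of_bool (b = c) * marginal_entry d n Y 0 b c)"
    using unitary by (intro sum.cong refl) simp
  also have "\<dots> = (\<Sum>b<n 0. marginal_entry d n Y 0 b b)" by (intro sum.cong refl) (simp add: sum.delta')
  also have "\<dots> = (\<Sum>b<n 0. \<Sum>\<alpha> | \<alpha> \<in> multi_indices d n \<and> \<alpha> 0 = b. of_real ((cmod (Y \<alpha>))\<^sup>2))"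
    unfolding marginal_entry_def by (intro sum.cong refl) (auto simp: complex_norm_square simp del: of_real_power)
  also have "\<dots> = (\<Sum>\<alpha>\<in>multi_indices d n. of_real ((cmod (Y \<alpha>))\<^sup>2))"
    by (rule sum_multi_indices_slice[symmetric]) simp
  also have "\<dots> = of_real (norm_sq d n Y)" unfolding norm_sq_def by simp
  finally show ?thesis by (simp only: of_real_eq_iff)
qed

section \<open>Greedy Gram-Schmidt orthogonalisation\<close>

definition inner_prod :: "nat \<Rightarrow> (nat \<Rightarrow> complex) \<Rightarrow> (nat \<Rightarrow> complex) \<Rightarrow> complex" where
  "inner_prod n x y = (\<Sum>i<n. cnj (x i) * y i)"

lemma inner_prod_sum_right: "inner_prod n x (\<lambda>i. \<Sum>c\<in>S. f c * y c i) = (\<Sum>c\<in>S. f c * inner_prod n x (y c))"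
  unfolding inner_prod_def sum_distrib_left by (subst sum.swap) (simp add: mult_ac)

lemma inner_prod_diff_right: "inner_prod n x (\<lambda>i. y i - z i) = inner_prod n x y - inner_prod n x z"
  unfolding inner_prod_def by (simp add: right_diff_distrib sum_subtractf)

lemma inner_prod_scale_right: "inner_prod n x (\<lambda>i. c * y i) = c * inner_prod n x y"
  unfolding inner_prod_def by (simp add: sum_distrib_left mult_ac)

lemma inner_prod_cnj: "inner_prod n y x = cnj (inner_prod n x y)"
  unfolding inner_prod_def by (simp add: mult.commute)

lemma inner_prod_self: "inner_prod n x x = of_real (\<Sum>i<n. (cmod (x i))\<^sup>2)"
  unfolding inner_prod_def by (simp add: complex_norm_square mult.commute del: of_real_power)

text \<open>For orthonormal \<open>K\<close>, the squared distance of \<open>A l\<close> from the span of \<open>K 0, \<dots>, K (a - 1)\<close>.\<close>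

definition residual :: "nat \<Rightarrow> (nat \<Rightarrow> nat \<Rightarrow> complex) \<Rightarrow> (nat \<Rightarrow> nat \<Rightarrow> complex) \<Rightarrow> nat \<Rightarrow> nat \<Rightarrow> real" where
  "residual n K A a l = Re (inner_prod n (A l) (A l)) - (\<Sum>c<a. (cmod (inner_prod n (K c) (A l)))\<^sup>2)"

text \<open>The last two clauses say that the chosen vectors and the \<open>K a\<close> span the
  same space. The first of them makes the next residual vector nonzero by independence, the second
  makes it orthogonal to the vectors already chosen.\<close>

definition gram_schmidt_state :: "nat \<Rightarrow> (nat \<Rightarrow> real \<Rightarrow> real) \<Rightarrow> (nat \<Rightarrow> nat \<Rightarrow> complex) \<Rightarrow> nat \<Rightarrow>
    (nat \<Rightarrow> nat) \<Rightarrow> (nat \<Rightarrow> nat \<Rightarrow> complex) \<Rightarrow> bool" where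
  "gram_schmidt_state n g A r \<sigma> K \<longleftrightarrow> inj_on \<sigma> {..<r} \<and> \<sigma> ` {..<r} \<subseteq> {..<n} \<and>
    (\<forall>a<r. \<forall>b<r. inner_prod n (K a) (K b) = of_bool (a = b)) \<and>
    (\<forall>a<r. \<forall>b<a. inner_prod n (K a) (A (\<sigma> b)) = 0) \<and>
    (\<forall>a<r. \<exists>t>0. inner_prod n (K a) (A (\<sigma> a)) = complex_of_real t) \<and>
    (\<forall>a<r. \<forall>l<n. l \<notin> \<sigma> ` {..<a} \<longrightarrow> g l (residual n K A a l) \<le> g (\<sigma> a) (residual n K A a (\<sigma> a))) \<and>
    (\<forall>a<r. \<exists>y. (\<forall>l. y l \<noteq> 0 \<longrightarrow> l \<in> \<sigma> ` {..<r}) \<and> (\<forall>i. K a i = (\<Sum>l<n. y l * A l i))) \<and>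
    (\<forall>b<r. \<forall>i. A (\<sigma> b) i = (\<Sum>c<r. inner_prod n (K c) (A (\<sigma> b)) * K c i))"

text \<open>The priority \<open>g\<close> decides which vector is orthogonalised next.  Depending on \<open>g\<close>, this is the
  QR decomposition with a prescribed order of the columns, or with column pivoting.\<close>

lemma gram_schmidt_greedy_partial:
  fixes A :: "nat \<Rightarrow> nat \<Rightarrow> complex" and g :: "nat \<Rightarrow> real \<Rightarrow> real"
  assumes indep: "\<forall>x. (\<forall>i<n. (\<Sum>l<n. x l * A l i) = 0) \<longrightarrow> (\<forall>l<n. x l = 0)"
    and "r \<le> n"
  shows "\<exists>\<sigma> K. gram_schmidt_state n g A r \<sigma> K"
  using \<open>r \<le> n\<close>
proof (induction r)
  case 0
  show ?case unfolding gram_schmidt_state_def by auto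
next
  case (Suc r)
  then have "r < n" by simp
  from Suc.IH[OF less_imp_le[OF \<open>r < n\<close>]] obtain \<sigma> K where state: "gram_schmidt_state n g A r \<sigma> K" by blast
  have inj: "inj_on \<sigma> {..<r}" and sub: "\<sigma> ` {..<r} \<subseteq> {..<n}"
    and orth: "\<And>a b. a < r \<Longrightarrow> b < r \<Longrightarrow> inner_prod n (K a) (K b) = of_bool (a = b)"
    and tri: "\<And>a b. a < r \<Longrightarrow> b < a \<Longrightarrow> inner_prod n (K a) (A (\<sigma> b)) = 0"
    and diag: "\<And>a. a < r \<Longrightarrow> \<exists>t>0. inner_prod n (K a) (A (\<sigma> a)) = complex_of_real t"
    and greedy: "\<And>a l. a < r \<Longrightarrow> l < n \<Longrightarrow> l \<notin> \<sigma> ` {..<a} \<Longrightarrow>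
        g l (residual n K A a l) \<le> g (\<sigma> a) (residual n K A a (\<sigma> a))"
    and span: "\<And>a. a < r \<Longrightarrow> \<exists>y. (\<forall>l. y l \<noteq> 0 \<longrightarrow> l \<in> \<sigma> ` {..<r}) \<and> (\<forall>i. K a i = (\<Sum>l<n. y l * A l i))"
    and expand: "\<And>b i. b < r \<Longrightarrow> A (\<sigma> b) i = (\<Sum>c<r. inner_prod n (K c) (A (\<sigma> b)) * K c i)"
    using state unfolding gram_schmidt_state_def by (elim conjE; simp)+
  define S where "S = {..<n} - \<sigma> ` {..<r}"
  have "card (\<sigma> ` {..<r}) = r" using inj by (simp add: card_image)
  then have "S \<noteq> {}" unfolding S_def using \<open>r < n\<close>
    by (metis Diff_eq_empty_iff card_lessThan card_mono finite_imageI finite_lessThan not_less)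
  define f where "f l = g l (residual n K A r l)" for l
  obtain l0 where l0: "l0 \<in> S" "\<And>l. l \<in> S \<Longrightarrow> f l \<le> f l0"
  proof -
    have "finite S" unfolding S_def by simp
    then have "Max (f ` S) \<in> f ` S" using \<open>S \<noteq> {}\<close> by (intro Max_in) auto
    then obtain l0 where "l0 \<in> S" "Max (f ` S) = f l0" by blast
    then show ?thesis using that[of l0] \<open>finite S\<close> by (metis Max_ge finite_imageI imageI)
  qed
  obtain y where y: "\<And>a l. a < r \<Longrightarrow> y a l \<noteq> 0 \<Longrightarrow> l \<in> \<sigma> ` {..<r}"
      "\<And>a i. a < r \<Longrightarrow> K a i = (\<Sum>l<n. y a l * A l i)"
  proof -
    have "\<exists>y. \<forall>a<r. (\<forall>l. y a l \<noteq> 0 \<longrightarrow> l \<in> \<sigma> ` {..<r}) \<and> (\<forall>i. K a i = (\<Sum>l<n. y a l * A l i))"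
      using span by metis
    then show ?thesis using that by blast
  qed
  define w where "w i = A l0 i - (\<Sum>c<r. inner_prod n (K c) (A l0) * K c i)" for i
  \<comment> \<open>The coefficients of \<open>w\<close> in the given vectors. No \<open>y c\<close>
    involves \<open>l0\<close>, which has not been chosen yet, so \<open>z l0 = 1\<close> and
    independence makes \<open>w\<close> nonzero.\<close>
  define z where "z l = of_bool (l = l0) - (\<Sum>c<r. inner_prod n (K c) (A l0) * y c l)" for l
  have wz: "w i = (\<Sum>l<n. z l * A l i)" for i
  proof -
    have "(\<Sum>l<n. z l * A l i) = (\<Sum>l<n. of_bool (l = l0) * A l i)
        - (\<Sum>l<n. \<Sum>c<r. inner_prod n (K c) (A l0) * y c l * A l i)"
      unfolding z_def by (simp add: left_diff_distrib sum_subtractf sum_distrib_right)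
    also have "(\<Sum>l<n. of_bool (l = l0) * A l i) = A l0 i"
      using l0(1) unfolding S_def by (simp add: sum.delta)
    also have "(\<Sum>l<n. \<Sum>c<r. inner_prod n (K c) (A l0) * y c l * A l i) =
        (\<Sum>c<r. inner_prod n (K c) (A l0) * K c i)"
      by (subst sum.swap) (simp add: y(2) sum_distrib_left mult.assoc)
    finally show ?thesis unfolding w_def by simp
  qed
  have y_l0: "y c l0 = 0" if "c < r" for c
    using y(1)[OF that, of l0] l0(1) unfolding S_def by blast
  have z_l0: "z l0 = 1" unfolding z_def by (simp add: y_l0)
  define N where "N = (\<Sum>i<n. (cmod (w i))\<^sup>2)"
  have "N \<noteq> 0"
  proof
    assume "N = 0"
    then have "\<forall>i<n. w i = 0" unfolding N_def by (subst (asm) sum_nonneg_eq_0_iff) auto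
    then have "\<forall>l<n. z l = 0" using indep wz by simp
    then show False using z_l0 l0(1) unfolding S_def by simp
  qed
  moreover have "N \<ge> 0" unfolding N_def by (simp add: sum_nonneg)
  ultimately have "N > 0" by simp
  have Kw: "inner_prod n (K a) w = 0" if "a < r" for a
  proof -
    have "inner_prod n (K a) w = inner_prod n (K a) (A l0) - (\<Sum>c<r. inner_prod n (K c) (A l0) * of_bool (a = c))"
      unfolding w_def inner_prod_diff_right inner_prod_sum_right using that by (simp add: orth)
    also have "\<dots> = 0" using that by (simp add: sum.delta')
    finally show ?thesis .
  qed
  have wK: "inner_prod n w (K a) = 0" if "a < r" for a
    using Kw[OF that] by (subst inner_prod_cnj) simp
  have wA: "inner_prod n w (A (\<sigma> b)) = 0" if "b < r" for b
  proof -
    have "inner_prod n w (A (\<sigma> b)) =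
        inner_prod n w (\<lambda>i. \<Sum>c<r. inner_prod n (K c) (A (\<sigma> b)) * K c i)"
      by (rule arg_cong[of _ _ "inner_prod n w"]) (use expand[OF that] in blast)
    then show ?thesis unfolding inner_prod_sum_right by (simp add: wK)
  qed
  have ww: "inner_prod n w w = of_real N" unfolding inner_prod_self N_def ..
  have wl0: "inner_prod n w (A l0) = of_real N"
  proof -
    have "w = (\<lambda>i. A l0 i - (\<Sum>c<r. inner_prod n (K c) (A l0) * K c i))" by (rule ext) (rule w_def)
    then have "inner_prod n w w = inner_prod n w (\<lambda>i. A l0 i - (\<Sum>c<r. inner_prod n (K c) (A l0) * K c i))"
      by (rule arg_cong)
    also have "\<dots> = inner_prod n w (A l0) - (\<Sum>c<r. inner_prod n (K c) (A l0) * inner_prod n w (K c))"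
      unfolding inner_prod_diff_right inner_prod_sum_right ..
    finally have "inner_prod n w w =
      inner_prod n w (A l0) - (\<Sum>c<r. inner_prod n (K c) (A l0) * inner_prod n w (K c))" .
    then show ?thesis using ww by (simp add: wK)
  qed
  define u where "u i = of_real (1 / sqrt N) * w i" for i
  have uu: "inner_prod n u v = of_real (1 / sqrt N) * inner_prod n w v" for v
    unfolding inner_prod_def u_def by (simp add: sum_distrib_left mult.assoc)
  have vu: "inner_prod n v u = of_real (1 / sqrt N) * inner_prod n v w" for v
    unfolding u_def by (rule inner_prod_scale_right)
  have sq: "sqrt N * sqrt N = N" using \<open>N > 0\<close> by simp
  define K' where "K' = K(r := u)"
  define \<sigma>' where "\<sigma>' = \<sigma>(r := l0)"
  have K': "K' a = K a" if "a < r" for a using that unfolding K'_def by simp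
  have K'r: "K' r = u" unfolding K'_def by simp
  have \<sigma>': "\<sigma>' a = \<sigma> a" if "a < r" for a using that unfolding \<sigma>'_def by simp
  have \<sigma>'r: "\<sigma>' r = l0" unfolding \<sigma>'_def by simp
  have img: "\<sigma>' ` {..<a} = \<sigma> ` {..<a}" if "a \<le> r" for a
    using that \<sigma>' by (intro image_cong) auto
  have imgS: "\<sigma>' ` {..<Suc r} = insert l0 (\<sigma> ` {..<r})"
    using img[of r] \<sigma>'r by (simp add: lessThan_Suc)
  have res: "residual n K' A a l = residual n K A a l" if "a \<le> r" for a l
    unfolding residual_def using that K' by simp
  have 1: "inj_on \<sigma>' {..<Suc r}"
    using inj l0(1) img[of r] inj_on_cong[of "{..<r}" \<sigma>' \<sigma>] \<sigma>' unfolding S_def lessThan_Suc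
    by (auto simp: \<sigma>'r)
  have 2: "\<sigma>' ` {..<Suc r} \<subseteq> {..<n}" unfolding imgS using sub l0(1) unfolding S_def by auto
  have uu1: "inner_prod n u u = 1"
    unfolding uu vu ww using sq \<open>N > 0\<close> by (simp flip: of_real_mult)
  have 3: "inner_prod n (K' a) (K' b) = of_bool (a = b)" if "a < Suc r" "b < Suc r" for a b
    using that orth[of a b] uu1 Kw wK
    by (cases "a = r"; cases "b = r") (simp_all add: K' K'r uu vu)
  have 4: "inner_prod n (K' a) (A (\<sigma>' b)) = 0" if "a < Suc r" "b < a" for a b
    using that tri[of a b] wA by (cases "a = r") (simp_all add: K' K'r \<sigma>' uu)
  have ul0: "inner_prod n u (A l0) = complex_of_real (sqrt N)"
    unfolding uu wl0 using \<open>N > 0\<close> by (simp add: real_div_sqrt flip: of_real_mult of_real_divide)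
  have 5: "\<exists>t>0. inner_prod n (K' a) (A (\<sigma>' a)) = complex_of_real t" if "a < Suc r" for a
    using that diag[of a] ul0 \<open>N > 0\<close> real_sqrt_gt_zero[OF \<open>N > 0\<close>]
    by (cases "a = r") (auto simp: K' K'r \<sigma>' \<sigma>'r intro!: exI[of _ "sqrt N"])
  have 6: "g l (residual n K' A a l) \<le> g (\<sigma>' a) (residual n K' A a (\<sigma>' a))"
    if "a < Suc r" "l < n" "l \<notin> \<sigma>' ` {..<a}" for a l
  proof (cases "a = r")
    case True
    then have "l \<in> S" using that img[of r] unfolding S_def by simp
    then show ?thesis using l0(2) True unfolding f_def by (simp add: res \<sigma>'r)
  next
    case False
    then show ?thesis using that greedy[of a l] img[of a] by (simp add: res \<sigma>')
  qed
  have 7: "\<exists>y. (\<forall>l. y l \<noteq> 0 \<longrightarrow> l \<in> \<sigma>' ` {..<Suc r}) \<and> (\<forall>i. K' a i = (\<Sum>l<n. y l * A l i))"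
    if "a < Suc r" for a
  proof (cases "a = r")
    case True
    have "l \<in> \<sigma>' ` {..<Suc r}" if "z l \<noteq> 0" for l
    proof (rule ccontr)
      assume l: "l \<notin> \<sigma>' ` {..<Suc r}"
      then have "y c l = 0" if "c < r" for c using y(1)[OF that, of l] unfolding imgS by blast
      then show False using \<open>z l \<noteq> 0\<close> l unfolding z_def imgS by simp
    qed
    moreover have "K' a i = (\<Sum>l<n. (of_real (1 / sqrt N) * z l) * A l i)" for i
      unfolding True K'r u_def wz by (simp add: sum_distrib_left mult.assoc)
    ultimately show ?thesis by (intro exI[of _ "\<lambda>l. of_real (1 / sqrt N) * z l"]) auto
  next
    case False
    then have "a < r" using that by simp
    then show ?thesis using y[of a] unfolding imgS K'[OF \<open>a < r\<close>] by blast
  qed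
  have 8: "A (\<sigma>' b) i = (\<Sum>c<Suc r. inner_prod n (K' c) (A (\<sigma>' b)) * K' c i)" if "b < Suc r" for b i
  proof (cases "b = r")
    case True
    have "of_real (sqrt N) * u i = w i"
      unfolding u_def using sq \<open>N > 0\<close> by (simp flip: of_real_mult add: mult.assoc[symmetric])
    then show ?thesis unfolding True \<sigma>'r by (simp add: K' K'r ul0 w_def)
  next
    case False
    then have "b < r" using that by simp
    then show ?thesis using expand[of b i] wA[of b] by (simp add: K' K'r \<sigma>' uu)
  qed
  have "gram_schmidt_state n g A (Suc r) \<sigma>' K'"
    unfolding gram_schmidt_state_def
    by (intro conjI allI impI; (rule 1 2 3 4 5 6 7 8; assumption))
  then show ?case by blast
qed

text \<open>A one-sided inverse of a square matrix is two-sided, so orthonormality of the rows gives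
  orthonormality of the columns.\<close>

lemma orthonormal_complete:
  assumes orth: "\<And>a b. a < n \<Longrightarrow> b < n \<Longrightarrow> inner_prod n (K a) (K b) = of_bool (a = b)"
    and "i < n" "j < n"
  shows "(\<Sum>a<n. K a i * cnj (K a j)) = of_bool (i = j)"
proof -
  define P where "P = Matrix.mat n n (\<lambda>(a, i). cnj (K a i))"
  define Q where "Q = Matrix.mat n n (\<lambda>(i, a). K a i)"
  have P: "P \<in> carrier_mat n n" and Q: "Q \<in> carrier_mat n n" unfolding P_def Q_def by auto
  have "P * Q = 1\<^sub>m n"
    by (rule eq_matI) (use orth in \<open>auto simp: P_def Q_def scalar_prod_def inner_prod_def lessThan_atLeast0\<close>)
  then have "Q * P = 1\<^sub>m n" using mat_mult_left_right_inverse[OF P Q] by simp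
  then have "(Q * P) $$ (i, j) = of_bool (i = j)" using assms(2,3) by simp
  then show ?thesis using assms(2,3) by (simp add: P_def Q_def scalar_prod_def lessThan_atLeast0)
qed

lemma orthonormal_expand:
  assumes orth: "\<And>a b. a < n \<Longrightarrow> b < n \<Longrightarrow> inner_prod n (K a) (K b) = of_bool (a = b)"
    and "i < n"
  shows "v i = (\<Sum>a<n. inner_prod n (K a) v * K a i)"
proof -
  have "(\<Sum>a<n. inner_prod n (K a) v * K a i) = (\<Sum>j<n. (\<Sum>a<n. K a i * cnj (K a j)) * v j)"
    unfolding inner_prod_def sum_distrib_right by (subst sum.swap) (simp add: mult_ac)
  also have "\<dots> = (\<Sum>j<n. of_bool (i = j) * v j)"
    using orthonormal_complete[OF orth \<open>i < n\<close>] by (intro sum.cong refl) simp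
  also have "\<dots> = v i" using \<open>i < n\<close> by (simp add: sum.delta')
  finally show ?thesis by simp
qed

lemma parseval:
  assumes orth: "\<And>a b. a < n \<Longrightarrow> b < n \<Longrightarrow> inner_prod n (K a) (K b) = of_bool (a = b)"
  shows "inner_prod n v v = (\<Sum>a<n. of_real ((cmod (inner_prod n (K a) v))\<^sup>2))"
proof -
  have "inner_prod n v v = inner_prod n v (\<lambda>i. \<Sum>a<n. inner_prod n (K a) v * K a i)"
    unfolding inner_prod_def[of n v] by (intro sum.cong refl) (simp add: orthonormal_expand[OF orth, of _ v])
  also have "\<dots> = (\<Sum>a<n. inner_prod n (K a) v * cnj (inner_prod n (K a) v))"
    unfolding inner_prod_sum_right by (subst inner_prod_cnj[of n _ v]) simp
  finally show ?thesis by (simp only: complex_norm_square)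
qed

text \<open>A QR decomposition with permuted columns: the \<open>K a\<close> form the unitary factor
  and the numbers \<open>inner_prod n (K a) (A (\<sigma> b))\<close> the triangular one, with
  positive diagonal. The tail sums in the last clause are the squared distances of the vectors from
  the span of \<open>K 0, ..., K (a - 1)\<close>.\<close>

definition adapted_basis :: "nat \<Rightarrow> (nat \<Rightarrow> real \<Rightarrow> real) \<Rightarrow> (nat \<Rightarrow> nat \<Rightarrow> complex) \<Rightarrow>
    (nat \<Rightarrow> nat) \<Rightarrow> (nat \<Rightarrow> nat \<Rightarrow> complex) \<Rightarrow> bool" where
  "adapted_basis n g A \<sigma> K \<longleftrightarrow> bij_betw \<sigma> {..<n} {..<n} \<and>
    (\<forall>a<n. \<forall>b<n. inner_prod n (K a) (K b) = of_bool (a = b)) \<and>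
    (\<forall>a<n. \<forall>b<a. inner_prod n (K a) (A (\<sigma> b)) = 0) \<and>
    (\<forall>a<n. \<exists>t>0. inner_prod n (K a) (A (\<sigma> a)) = complex_of_real t) \<and>
    (\<forall>a<n. \<forall>l<n. l \<notin> \<sigma> ` {..<a} \<longrightarrow>
      g l (\<Sum>c\<in>{a..<n}. (cmod (inner_prod n (K c) (A l)))\<^sup>2) \<le>
      g (\<sigma> a) (\<Sum>c\<in>{a..<n}. (cmod (inner_prod n (K c) (A (\<sigma> a))))\<^sup>2))"

lemma adapted_basisD:
  assumes "adapted_basis n g A \<sigma> K"
  shows "bij_betw \<sigma> {..<n} {..<n}"
    and "\<And>a b. a < n \<Longrightarrow> b < n \<Longrightarrow> inner_prod n (K a) (K b) = of_bool (a = b)"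
    and "\<And>a b. a < n \<Longrightarrow> b < a \<Longrightarrow> inner_prod n (K a) (A (\<sigma> b)) = 0"
    and "\<And>a. a < n \<Longrightarrow> \<exists>t>0. inner_prod n (K a) (A (\<sigma> a)) = complex_of_real t"
    and "\<And>a l. a < n \<Longrightarrow> l < n \<Longrightarrow> l \<notin> \<sigma> ` {..<a} \<Longrightarrow>
      g l (\<Sum>c\<in>{a..<n}. (cmod (inner_prod n (K c) (A l)))\<^sup>2) \<le>
      g (\<sigma> a) (\<Sum>c\<in>{a..<n}. (cmod (inner_prod n (K c) (A (\<sigma> a))))\<^sup>2)"
  using assms unfolding adapted_basis_def by (elim conjE; simp)+

theorem gram_schmidt_greedy:
  fixes A :: "nat \<Rightarrow> nat \<Rightarrow> complex" and g :: "nat \<Rightarrow> real \<Rightarrow> real"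
  assumes indep: "\<forall>x. (\<forall>i<n. (\<Sum>l<n. x l * A l i) = 0) \<longrightarrow> (\<forall>l<n. x l = 0)"
  shows "\<exists>\<sigma> K. adapted_basis n g A \<sigma> K"
proof -
  obtain \<sigma> K where state: "gram_schmidt_state n g A n \<sigma> K"
    using gram_schmidt_greedy_partial[where A = A and n = n and r = n and g = g] indep by blast
  have inj: "inj_on \<sigma> {..<n}" and sub: "\<sigma> ` {..<n} \<subseteq> {..<n}"
    and orth: "\<And>a b. a < n \<Longrightarrow> b < n \<Longrightarrow> inner_prod n (K a) (K b) = of_bool (a = b)"
    and tri: "\<And>a b. a < n \<Longrightarrow> b < a \<Longrightarrow> inner_prod n (K a) (A (\<sigma> b)) = 0"
    and diag: "\<And>a. a < n \<Longrightarrow> \<exists>t>0. inner_prod n (K a) (A (\<sigma> a)) = complex_of_real t"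
    and greedy: "\<And>a l. a < n \<Longrightarrow> l < n \<Longrightarrow> l \<notin> \<sigma> ` {..<a} \<Longrightarrow>
        g l (residual n K A a l) \<le> g (\<sigma> a) (residual n K A a (\<sigma> a))"
    using state unfolding gram_schmidt_state_def by (elim conjE; simp)+
  have bij: "bij_betw \<sigma> {..<n} {..<n}"
    unfolding bij_betw_def using inj sub by (simp add: endo_inj_surj)
  \<comment> \<open>By Parseval the squared norm of \<open>A l\<close> is the full sum, and the
    residual subtracts its head.\<close>
  have res: "residual n K A a l = (\<Sum>c\<in>{a..<n}. (cmod (inner_prod n (K c) (A l)))\<^sup>2)" if "a < n" for a l
  proof -
    have "Re (inner_prod n (A l) (A l)) = (\<Sum>c<n. (cmod (inner_prod n (K c) (A l)))\<^sup>2)"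
      using parseval[OF orth, of "A l"] by (simp flip: of_real_sum of_real_power)
    also have "{..<n} = {..<a} \<union> {a..<n}" using that by auto
    also have "(\<Sum>c\<in>{..<a} \<union> {a..<n}. (cmod (inner_prod n (K c) (A l)))\<^sup>2) =
        (\<Sum>c<a. (cmod (inner_prod n (K c) (A l)))\<^sup>2) + (\<Sum>c\<in>{a..<n}. (cmod (inner_prod n (K c) (A l)))\<^sup>2)"
      by (intro sum.union_disjoint) auto
    finally show ?thesis unfolding residual_def by simp
  qed
  have "adapted_basis n g A \<sigma> K"
    unfolding adapted_basis_def
    by (intro conjI allI impI) (use bij orth tri diag greedy res in simp_all)
  then show ?thesis by blast
qed

section \<open>The trace inequality\<close>

text \<open>Summation by parts: moving mass towards larger indices without changing the total cannot
  lower the pairing with an increasing \<open>u\<close>. Both the trace inequality and the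
  comparison of characters rest on it.\<close>

lemma sum_mult_mono_nonneg:
  fixes u z :: "nat \<Rightarrow> real"
  assumes mono: "\<And>i j. i \<le> j \<Longrightarrow> j < n \<Longrightarrow> u i \<le> u j"
    and tail: "\<And>j. j < n \<Longrightarrow> 0 \<le> (\<Sum>i\<in>{j..<n}. z i)"
    and total: "(\<Sum>i<n. z i) = 0"
  shows "0 \<le> (\<Sum>i<n. u i * z i)"
proof -
  \<comment> \<open>The partial form, proved from the right end; at \<open>m = 0\<close> its left
    side vanishes by \<open>total\<close>.\<close>
  have "u m * (\<Sum>i\<in>{m..<n}. z i) \<le> (\<Sum>i\<in>{m..<n}. u i * z i)" if "m \<le> n" for m
    using that
  proof (induction "n - m" arbitrary: m)
    case 0
    then show ?case by simp
  next
    case (Suc k)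
    then have "m < n" by simp
    show ?case
    proof (cases "Suc m < n")
      case True
      have "u m * (\<Sum>i\<in>{Suc m..<n}. z i) \<le> u (Suc m) * (\<Sum>i\<in>{Suc m..<n}. z i)"
        using mono[of m "Suc m"] tail[OF True] True by (intro mult_right_mono) auto
      also have "\<dots> \<le> (\<Sum>i\<in>{Suc m..<n}. u i * z i)" using Suc True by auto
      finally show ?thesis using \<open>m < n\<close> by (simp add: sum.atLeast_Suc_lessThan distrib_left)
    next
      case False
      then have "n = Suc m" using \<open>m < n\<close> by simp
      then show ?thesis by simp
    qed
  qed
  from this[of 0] show ?thesis using total by (simp add: lessThan_atLeast0)
qed

text \<open>\<open>A l\<close> is the column with index \<open>l\<close>. At the largest index
  \<open>m\<close> with \<open>x m\<close> nonzero, only the diagonal term of the combination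
  survives.\<close>

lemma upper_triangular_independent:
  fixes A :: "nat \<Rightarrow> nat \<Rightarrow> complex"
  assumes upper: "\<And>l i. l < n \<Longrightarrow> l < i \<Longrightarrow> i < n \<Longrightarrow> A l i = 0"
    and diag: "\<And>l. l < n \<Longrightarrow> A l l \<noteq> 0"
    and x: "\<And>i. i < n \<Longrightarrow> (\<Sum>l<n. x l * A l i) = 0"
  shows "\<forall>l<n. x l = 0"
proof (rule ccontr)
  assume "\<not> (\<forall>l<n. x l = 0)"
  then have ne: "{l. l < n \<and> x l \<noteq> 0} \<noteq> {}" by blast
  define m where "m = Max {l. l < n \<and> x l \<noteq> 0}"
  have "m \<in> {l. l < n \<and> x l \<noteq> 0}" unfolding m_def using ne by (intro Max_in) auto
  then have m: "m < n" "x m \<noteq> 0" by auto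
  have big: "x l = 0" if "l < n" "m < l" for l
    using that Max_ge[of "{l. l < n \<and> x l \<noteq> 0}" l] unfolding m_def by fastforce
  have "(\<Sum>l<n. x l * A l m) = (\<Sum>l<n. if l = m then x m * A m m else 0)"
  proof (intro sum.cong refl)
    fix l assume "l \<in> {..<n}"
    then show "x l * A l m = (if l = m then x m * A m m else 0)"
      using upper[of l m] big[of l] m by (cases l m rule: linorder_cases) auto
  qed
  then show False using x[OF m(1)] m diag by simp
qed

text \<open>\<open>A (\<sigma> b)\<close> is a combination of \<open>K 0, ..., K b\<close> with
  nonzero last coefficient. Solving these relations forwards passes orthogonality from the former to
  the latter.\<close>

lemma triangular_orthogonal_span:
  assumes tri: "\<And>a b. a < n \<Longrightarrow> b < a \<Longrightarrow> inner_prod n (K a) (A (\<sigma> b)) = 0"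
    and diag: "\<And>a. a < n \<Longrightarrow> inner_prod n (K a) (A (\<sigma> a)) \<noteq> 0"
    and orth: "\<And>a b. a < n \<Longrightarrow> b < n \<Longrightarrow> inner_prod n (K a) (K b) = of_bool (a = b)"
    and v: "\<And>b. b < r \<Longrightarrow> inner_prod n v (A (\<sigma> b)) = 0"
    and "b < r" "r \<le> n"
  shows "inner_prod n v (K b) = 0"
  using \<open>b < r\<close>
proof (induction b rule: less_induct)
  case (less b)
  have "b < n" using less.prems \<open>r \<le> n\<close> by simp
  have "inner_prod n v (A (\<sigma> b)) = inner_prod n v (\<lambda>i. \<Sum>a<n. inner_prod n (K a) (A (\<sigma> b)) * K a i)"
    unfolding inner_prod_def[of n v]
    by (intro sum.cong refl) (simp add: orthonormal_expand[OF orth, of _ "A (\<sigma> b)"])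
  also have "\<dots> = (\<Sum>a<n. inner_prod n (K a) (A (\<sigma> b)) * inner_prod n v (K a))"
    by (rule inner_prod_sum_right)
  also have "\<dots> = (\<Sum>a<n. if a = b then inner_prod n (K b) (A (\<sigma> b)) * inner_prod n v (K b) else 0)"
  proof (intro sum.cong refl)
    fix a assume a: "a \<in> {..<n}"
    show "inner_prod n (K a) (A (\<sigma> b)) * inner_prod n v (K a) =
        (if a = b then inner_prod n (K b) (A (\<sigma> b)) * inner_prod n v (K b) else 0)"
      using a tri[of a b] less.IH[of a] less.prems by (cases a b rule: linorder_cases) auto
  qed
  finally show ?case using v[OF less.prems] diag[OF \<open>b < n\<close>] \<open>b < n\<close> by simp
qed

text \<open>\<open>w\<close> is the orthogonal projection of the \<open>i\<close>-th unit vector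
  onto the span of the \<open>K' b\<close> with \<open>b \<ge> r\<close>. By \<open>perp\<close>
  each \<open>K a\<close> with \<open>a \<ge> r\<close> lies in that span, so the left side is a
  Bessel sum for \<open>w\<close> and the right side is the squared norm of
  \<open>w\<close>.\<close>

lemma tail_norm_flag_independent:
  assumes orth: "\<And>a b. a < n \<Longrightarrow> b < n \<Longrightarrow> inner_prod n (K a) (K b) = of_bool (a = b)"
    and orth': "\<And>a b. a < n \<Longrightarrow> b < n \<Longrightarrow> inner_prod n (K' a) (K' b) = of_bool (a = b)"
    and perp: "\<And>a b. r \<le> a \<Longrightarrow> a < n \<Longrightarrow> b < r \<Longrightarrow> inner_prod n (K a) (K' b) = 0"
    and "i < n"
  shows "(\<Sum>a\<in>{r..<n}. (cmod (K a i))\<^sup>2) \<le> (\<Sum>a\<in>{r..<n}. (cmod (K' a i))\<^sup>2)"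
proof -
  define w where "w j = (\<Sum>b\<in>{r..<n}. cnj (K' b i) * K' b j)" for j
  have Kw: "inner_prod n (K a) w = cnj (K a i)" if a: "r \<le> a" "a < n" for a
  proof -
    have "inner_prod n (K a) w = (\<Sum>b\<in>{r..<n}. cnj (K' b i) * inner_prod n (K a) (K' b))"
      unfolding w_def by (rule inner_prod_sum_right)
    also have "\<dots> = (\<Sum>b<n. cnj (K' b i) * inner_prod n (K a) (K' b))"
      using perp[OF a] a by (intro sum.mono_neutral_left) auto
    also have "\<dots> = inner_prod n (K a) (\<lambda>j. \<Sum>b<n. cnj (K' b i) * K' b j)"
      by (rule inner_prod_sum_right[symmetric])
    also have "\<dots> = (\<Sum>j<n. cnj (K a j) * of_bool (j = i))"
      unfolding inner_prod_def[of n "K a"]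
      by (intro sum.cong refl) (use orthonormal_complete[OF orth', of _ i] \<open>i < n\<close> in \<open>simp add: mult.commute\<close>)
    also have "\<dots> = cnj (K a i)" using \<open>i < n\<close> by simp
    finally show ?thesis .
  qed
  have "(\<Sum>a\<in>{r..<n}. (cmod (K a i))\<^sup>2) = (\<Sum>a\<in>{r..<n}. (cmod (inner_prod n (K a) w))\<^sup>2)"
    using Kw by (intro sum.cong refl) simp
  also have "\<dots> \<le> (\<Sum>a<n. (cmod (inner_prod n (K a) w))\<^sup>2)"
    by (intro sum_mono2) auto
  also have "\<dots> = Re (inner_prod n w w)"
    using parseval[OF orth, of w] by (simp flip: of_real_sum of_real_power)
  also have "inner_prod n w w = (\<Sum>b\<in>{r..<n}. cnj (K' b i) * inner_prod n w (K' b))"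
    by (subst (2) w_def[abs_def]) (rule inner_prod_sum_right)
  also have "\<dots> = (\<Sum>b\<in>{r..<n}. of_real ((cmod (K' b i))\<^sup>2))"
  proof (intro sum.cong refl)
    fix b assume b: "b \<in> {r..<n}"
    have "inner_prod n (K' b) w = (\<Sum>c\<in>{r..<n}. cnj (K' c i) * inner_prod n (K' b) (K' c))"
      unfolding w_def by (rule inner_prod_sum_right)
    also have "\<dots> = (\<Sum>c\<in>{r..<n}. cnj (K' c i) * of_bool (b = c))"
      using b by (intro sum.cong refl) (simp add: orth')
    also have "\<dots> = cnj (K' b i)" using b by (simp add: sum.delta')
    finally have "inner_prod n w (K' b) = K' b i" by (subst inner_prod_cnj) simp
    then show "cnj (K' b i) * inner_prod n w (K' b) = of_real ((cmod (K' b i))\<^sup>2)"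
      by (simp only: complex_norm_square mult.commute)
  qed
  finally show ?thesis by simp
qed

text \<open>The tail sum over \<open>a \<ge> r\<close> is the squared distance of a unit vector from the span of the
  first \<open>r\<close> chosen columns, hence independent of the orthonormal basis.  The basis \<open>K'\<close> used in the
  proof orthogonalises the remaining columns with index below \<open>j\<close> next, so that all but
  \<open>card {a. r \<le> a < n \<and> \<sigma> a < j}\<close> of its vectors vanish in the first \<open>j\<close> coordinates.\<close>

lemma tail_norm_le_card:
  assumes upper: "\<And>l i. l < n \<Longrightarrow> l < i \<Longrightarrow> i < n \<Longrightarrow> A l i = 0"
    and Adiag: "\<And>l. l < n \<Longrightarrow> A l l \<noteq> 0"
    and bij: "bij_betw \<sigma> {..<n} {..<n}"
    and orth: "\<And>a b. a < n \<Longrightarrow> b < n \<Longrightarrow> inner_prod n (K a) (K b) = of_bool (a = b)"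
    and tri: "\<And>a b. a < n \<Longrightarrow> b < a \<Longrightarrow> inner_prod n (K a) (A (\<sigma> b)) = 0"
    and "r \<le> n" "j \<le> n"
  shows "(\<Sum>i<j. \<Sum>a\<in>{r..<n}. (cmod (K a i))\<^sup>2) \<le> card {a\<in>{r..<n}. \<sigma> a < j}"
proof -
  define E where "E = \<sigma> ` {..<r}"
  define F where "F = {..<j} - E"
  \<comment> \<open>The priorities form three classes: the columns in \<open>E\<close> come before
    the remaining ones below \<open>j\<close>, and these before all others.\<close>
  define g where "g l x = (if l \<in> E then 2 else if l < j then 1 else 0 :: real)" for l :: nat and x :: real
  have "E \<subseteq> {..<n}" unfolding E_def using bij \<open>r \<le> n\<close> unfolding bij_betw_def by auto
  have cardE: "card E = r" unfolding E_def using bij \<open>r \<le> n\<close>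
    by (subst card_image) (auto simp: bij_betw_def intro: inj_on_subset)
  have finF: "finite F" unfolding F_def by simp
  have indep: "\<forall>x. (\<forall>i<n. (\<Sum>l<n. x l * A l i) = 0) \<longrightarrow> (\<forall>l<n. x l = 0)"
  proof (intro allI impI)
    fix x l assume x: "\<forall>i<n. (\<Sum>l<n. x l * A l i) = 0" and l: "l < n"
    have "\<forall>l<n. x l = 0"
      by (rule upper_triangular_independent[of n A x]) (use upper Adiag x in auto)
    then show "x l = 0" using l by blast
  qed
  obtain \<tau> K' where "adapted_basis n g A \<tau> K'" using gram_schmidt_greedy[OF indep] by blast
  note bij' = adapted_basisD(1)[OF this] and orth' = adapted_basisD(2)[OF this]
    and tri' = adapted_basisD(3)[OF this] and diag' = adapted_basisD(4)[OF this]
    and greedy' = adapted_basisD(5)[OF this]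
  have greedy: "g l 0 \<le> g (\<tau> a) 0" if "a < n" "l < n" "l \<notin> \<tau> ` {..<a}" for a l
    using greedy'[OF that] unfolding g_def .
  have diag'': "inner_prod n (K' a) (A (\<tau> a)) \<noteq> 0" if "a < n" for a using diag'[OF that] by force
  have \<tau>inj: "inj_on \<tau> {..<n}" and \<tau>img: "\<tau> ` {..<n} = {..<n}" using bij' by (auto simp: bij_betw_def)
  \<comment> \<open>A set whose members all have larger priority than the other columns is exhausted
    before any of those is taken.\<close>
  have greedyset: "T \<subseteq> \<tau> ` {..<card T}" if T: "T \<subseteq> {..<n}"
    "\<And>l m. l \<in> T \<Longrightarrow> m < n \<Longrightarrow> m \<notin> T \<Longrightarrow> g m 0 < g l 0" for T
  proof (rule ccontr)
    have finT: "finite T" using T(1) finite_subset by blast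
    have "card T \<le> n" using card_mono[OF _ T(1)] by simp
    assume "\<not> T \<subseteq> \<tau> ` {..<card T}"
    then obtain l where l: "l \<in> T" "l \<notin> \<tau> ` {..<card T}" by blast
    have "\<tau> ` {..<card T} \<subseteq> T"
    proof
      fix m assume "m \<in> \<tau> ` {..<card T}"
      then obtain a where a: "a < card T" "m = \<tau> a" by blast
      have "a < n" using a \<open>card T \<le> n\<close> by simp
      then have "m < n" using \<tau>img a by blast
      have "l \<notin> \<tau> ` {..<a}" using l(2) a(1) by auto
      moreover have "l < n" using l T(1) by blast
      ultimately have "g l 0 \<le> g m 0" using greedy[OF \<open>a < n\<close>] a(2) by blast
      then show "m \<in> T" using T(2)[OF l(1) \<open>m < n\<close>] by force
    qed
    moreover have "card (\<tau> ` {..<card T}) = card T"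
      using \<tau>inj \<open>card T \<le> n\<close> by (subst card_image) (auto intro: inj_on_subset)
    ultimately have "\<tau> ` {..<card T} = T" using finT by (intro card_subset_eq) auto
    then show False using l by blast
  qed
  have E\<tau>: "\<tau> ` {..<r} = E"
  proof -
    have "E \<subseteq> \<tau> ` {..<card E}" using \<open>E \<subseteq> {..<n}\<close> by (rule greedyset) (auto simp: g_def)
    moreover have "card (\<tau> ` {..<r}) = r"
      using \<tau>inj \<open>r \<le> n\<close> by (subst card_image) (auto intro: inj_on_subset)
    ultimately show ?thesis using cardE by (intro card_subset_eq[symmetric]) auto
  qed
  have cardEF: "card (E \<union> F) = r + card F"
    using cardE finF \<open>E \<subseteq> {..<n}\<close> finite_subset[of E "{..<n}"] unfolding F_def
    by (subst card_Un_disjoint) auto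
  have EF\<tau>: "E \<union> F \<subseteq> \<tau> ` {..<r + card F}"
  proof -
    have "E \<union> F \<subseteq> {..<n}" using \<open>E \<subseteq> {..<n}\<close> \<open>j \<le> n\<close> unfolding F_def by auto
    then have "E \<union> F \<subseteq> \<tau> ` {..<card (E \<union> F)}" by (rule greedyset) (auto simp: g_def F_def)
    then show ?thesis unfolding cardEF .
  qed
  have cardEFn: "r + card F \<le> n"
    using card_mono[of "{..<n}" "E \<union> F"] \<open>E \<subseteq> {..<n}\<close> \<open>j \<le> n\<close> cardEF unfolding F_def by auto
  \<comment> \<open>Orthogonality to the first \<open>j\<close> columns of a triangular matrix with
    nonzero diagonal kills the first \<open>j\<close> coordinates one after the other.\<close>
  have late: "K' a i = 0" if a: "r + card F \<le> a" "a < n" and i: "i < j" for a i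
  proof -
    have perp: "inner_prod n (K' a) (A l) = 0" if "l < j" for l
    proof -
      have "l \<in> E \<union> F" using that unfolding F_def by blast
      then obtain b where "b < r + card F" "l = \<tau> b" using EF\<tau> by blast
      then show ?thesis using tri'[of a b] a by simp
    qed
    have "cnj (K' a i) = 0" using i
    proof (induction i rule: less_induct)
      case (less i)
      have "i < n" using less.prems \<open>j \<le> n\<close> by simp
      have "inner_prod n (K' a) (A i) = (\<Sum>m<n. if m = i then cnj (K' a i) * A i i else 0)"
        unfolding inner_prod_def
      proof (intro sum.cong refl)
        fix m assume m: "m \<in> {..<n}"
        show "cnj (K' a m) * A i m = (if m = i then cnj (K' a i) * A i i else 0)"
          using less.IH[of m] less.prems upper[of i m] m \<open>i < n\<close> by (cases m i rule: linorder_cases) auto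
      qed
      then show ?case using perp[OF less.prems] \<open>i < n\<close> Adiag by simp
    qed
    then show ?thesis by simp
  qed
  have perp: "inner_prod n (K a) (K' b) = 0" if "r \<le> a" "a < n" "b < r" for a b
  proof -
    have "inner_prod n (K a) (A (\<tau> c)) = 0" if "c < r" for c
    proof -
      have "\<tau> c \<in> E" using E\<tau> that by blast
      then obtain c' where "c' < r" "\<tau> c = \<sigma> c'" unfolding E_def by auto
      then show ?thesis using tri[of a c'] \<open>r \<le> a\<close> \<open>a < n\<close> by simp
    qed
    then show ?thesis
      by (intro triangular_orthogonal_span[of n K' A \<tau> r "K a" b] tri' diag'' orth' \<open>b < r\<close> \<open>r \<le> n\<close>)
  qed
  have "(\<Sum>i<j. \<Sum>a\<in>{r..<n}. (cmod (K a i))\<^sup>2) \<le> (\<Sum>i<j. \<Sum>a\<in>{r..<n}. (cmod (K' a i))\<^sup>2)"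
    by (intro sum_mono tail_norm_flag_independent[of n K K' r] orth orth' perp) (use \<open>j \<le> n\<close> in auto)
  also have "\<dots> = (\<Sum>a\<in>{r..<n}. \<Sum>i<j. (cmod (K' a i))\<^sup>2)" by (rule sum.swap)
  also have "\<dots> = (\<Sum>a\<in>{r..<r + card F}. \<Sum>i<j. (cmod (K' a i))\<^sup>2)"
    using late cardEFn by (intro sum.mono_neutral_right) auto
  \<comment> \<open>Each of the remaining \<open>card F\<close> vectors has norm 1 and contributes
    at most 1.\<close>
  also have "\<dots> \<le> (\<Sum>a\<in>{r..<r + card F}. 1)"
  proof (intro sum_mono)
    fix a assume "a \<in> {r..<r + card F}"
    then have "a < n" using cardEFn by simp
    have "(\<Sum>i<j. (cmod (K' a i))\<^sup>2) \<le> (\<Sum>i<n. (cmod (K' a i))\<^sup>2)"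
      using \<open>j \<le> n\<close> by (intro sum_mono2) auto
    also have "\<dots> = 1"
      using inner_prod_self[of n "K' a"] orth'[OF \<open>a < n\<close> \<open>a < n\<close>] by (metis of_real_eq_1_iff of_bool_eq(2))
    finally show "(\<Sum>i<j. (cmod (K' a i))\<^sup>2) \<le> 1" .
  qed
  also have "\<dots> = card F" by simp
  also have "F = \<sigma> ` {a\<in>{r..<n}. \<sigma> a < j}"
  proof -
    have img: "\<sigma> ` {..<n} = {..<n}" and inj: "inj_on \<sigma> {..<n}" using bij by (auto simp: bij_betw_def)
    show ?thesis
    proof (intro equalityI subsetI)
      fix l assume l: "l \<in> F"
      then have "l \<in> \<sigma> ` {..<n}" using \<open>j \<le> n\<close> unfolding img F_def by auto
      then obtain a where a: "a < n" "l = \<sigma> a" by blast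
      then have "\<not> a < r" using l unfolding F_def E_def by blast
      then show "l \<in> \<sigma> ` {a\<in>{r..<n}. \<sigma> a < j}" using a l unfolding F_def by auto
    next
      fix l assume "l \<in> \<sigma> ` {a\<in>{r..<n}. \<sigma> a < j}"
      then obtain a where a: "r \<le> a" "a < n" "l = \<sigma> a" "\<sigma> a < j" by auto
      have "l \<notin> E"
      proof
        assume "l \<in> E"
        then obtain b where "b < r" "\<sigma> a = \<sigma> b" unfolding E_def a(3) by blast
        then show False using inj a \<open>r \<le> n\<close> by (auto dest!: inj_onD[of _ _ a b])
      qed
      then show "l \<in> F" using a unfolding F_def by simp
    qed
  qed
  also have "card (\<sigma> ` {a\<in>{r..<n}. \<sigma> a < j}) = card {a\<in>{r..<n}. \<sigma> a < j}"
    using bij by (intro card_image) (auto simp: bij_betw_def intro: inj_on_subset)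
  finally show ?thesis by simp
qed

text \<open>Let \<open>x a\<close> be the mean of \<open>p\<close> with respect to
  \<open>K a\<close>. A first summation by parts, fed with the counting bound for triangular
  \<open>A\<close>, compares the tail sums of \<open>x\<close> and of
  \<open>p \<circ> \<sigma>\<close>; a second one pairs these tails with
  \<open>h \<circ> \<sigma>\<close>, which decreases by greediness. For an arbitrary unitary matrix
  in place of \<open>K\<close> the bound by the unsorted pairing of \<open>h\<close> and
  \<open>p\<close> would be false.\<close>

lemma adapted_basis_trace_inequality:
  fixes A :: "nat \<Rightarrow> nat \<Rightarrow> complex" and h p :: "nat \<Rightarrow> real"
  assumes upper: "\<And>l i. l < n \<Longrightarrow> l < i \<Longrightarrow> i < n \<Longrightarrow> A l i = 0"
    and Adiag: "\<And>l. l < n \<Longrightarrow> A l l \<noteq> 0"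
    and basis: "adapted_basis n (\<lambda>l _. h l) A \<sigma> K"
    and mono: "\<And>i j. i \<le> j \<Longrightarrow> j < n \<Longrightarrow> p i \<le> p j"
  shows "(\<Sum>a<n. h (\<sigma> a) * (\<Sum>i<n. p i * (cmod (K a i))\<^sup>2)) \<le> (\<Sum>l<n. h l * p l)"
proof -
  note bij = adapted_basisD(1)[OF basis] and orth = adapted_basisD(2)[OF basis]
    and tri = adapted_basisD(3)[OF basis] and greedy = adapted_basisD(5)[OF basis]
  have inj: "inj_on \<sigma> {..<n}" and img: "\<sigma> ` {..<n} = {..<n}" using bij by (auto simp: bij_betw_def)
  have \<sigma>n: "\<sigma> a < n" if "a < n" for a using img that by blast
  define x where "x a = (\<Sum>i<n. p i * (cmod (K a i))\<^sup>2)" for a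
  have unit: "(\<Sum>i<n. (cmod (K a i))\<^sup>2) = 1" if "a < n" for a
    using inner_prod_self[of n "K a"] orth[OF that that] by (metis of_real_eq_1_iff of_bool_eq(2))
  have tail: "0 \<le> (\<Sum>i<n. p i * ((\<Sum>a\<in>{r..<n}. (cmod (K a i))\<^sup>2) - (\<Sum>a\<in>{r..<n}. of_bool (\<sigma> a = i))))"
    if "r \<le> n" for r
  proof (rule sum_mult_mono_nonneg[OF mono])
    \<comment> \<open>\<open>?z i\<close> is the mass of the last vectors at the coordinate
      \<open>i\<close> minus the number of their columns \<open>\<sigma> a\<close> equal to
      \<open>i\<close>. The counting bound makes its head sums nonpositive, and its total is
      0.\<close>
    let ?z = "\<lambda>i. (\<Sum>a\<in>{r..<n}. (cmod (K a i))\<^sup>2) - (\<Sum>a\<in>{r..<n}. of_bool (\<sigma> a = i))"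
    have head: "(\<Sum>i<j. ?z i) = (\<Sum>i<j. \<Sum>a\<in>{r..<n}. (cmod (K a i))\<^sup>2) - card {a\<in>{r..<n}. \<sigma> a < j}" for j
    proof -
      have "(\<Sum>i<j. \<Sum>a\<in>{r..<n}. of_bool (\<sigma> a = i) :: real) = (\<Sum>a\<in>{r..<n}. of_bool (\<sigma> a < j))"
      proof (subst sum.swap, intro sum.cong refl)
        fix a
        have "(\<Sum>i<j. of_bool (\<sigma> a = i) :: real) = (\<Sum>i<j. if \<sigma> a = i then 1 else 0)"
          by (intro sum.cong) auto
        also have "\<dots> = of_bool (\<sigma> a < j)" by (subst sum.delta') auto
        finally show "(\<Sum>i<j. of_bool (\<sigma> a = i) :: real) = of_bool (\<sigma> a < j)" .
      qed
      also have "\<dots> = (\<Sum>a\<in>{r..<n}. if \<sigma> a < j then 1 else 0)" by (intro sum.cong) auto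
      also have "\<dots> = (\<Sum>a\<in>{a\<in>{r..<n}. \<sigma> a < j}. 1)" by (rule sum.inter_filter[symmetric]) simp
      also have "\<dots> = card {a\<in>{r..<n}. \<sigma> a < j}" by simp
      finally show ?thesis by (simp add: sum_subtractf)
    qed
    show total: "(\<Sum>i<n. ?z i) = 0"
    proof -
      have "(\<Sum>i<n. \<Sum>a\<in>{r..<n}. (cmod (K a i))\<^sup>2) = (\<Sum>a\<in>{r..<n}. 1)"
        by (subst sum.swap) (intro sum.cong refl, simp add: unit)
      moreover have "{a\<in>{r..<n}. \<sigma> a < n} = {r..<n}"
        using \<sigma>n by (intro equalityI subsetI) simp_all
      ultimately show ?thesis unfolding head by simp
    qed
    show "0 \<le> (\<Sum>i\<in>{j..<n}. ?z i)" if "j < n" for j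
    proof -
      have "(\<Sum>i<n. ?z i) = (\<Sum>i<j. ?z i) + (\<Sum>i\<in>{j..<n}. ?z i)"
        unfolding lessThan_atLeast0 by (rule sum.atLeastLessThan_concat[symmetric]) (use that in simp_all)
      moreover have "(\<Sum>i<j. ?z i) \<le> 0"
        unfolding head using tail_norm_le_card[of n A \<sigma> K r j] upper Adiag bij orth tri \<open>r \<le> n\<close> that by simp
      ultimately show ?thesis using total by linarith
    qed
  qed
  have split: "(\<Sum>i<n. p i * ((\<Sum>a\<in>{r..<n}. (cmod (K a i))\<^sup>2) - (\<Sum>a\<in>{r..<n}. of_bool (\<sigma> a = i))))
      = (\<Sum>a\<in>{r..<n}. x a - p (\<sigma> a))" for r
  proof -
    have "(\<Sum>i<n. p i * (\<Sum>a\<in>{r..<n}. (cmod (K a i))\<^sup>2)) = (\<Sum>a\<in>{r..<n}. x a)"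
      unfolding x_def sum_distrib_left by (rule sum.swap)
    moreover have "(\<Sum>i<n. p i * (\<Sum>a\<in>{r..<n}. of_bool (\<sigma> a = i))) = (\<Sum>a\<in>{r..<n}. p (\<sigma> a))"
      unfolding sum_distrib_left by (subst sum.swap) (use \<sigma>n in \<open>simp add: of_bool_def if_distrib sum.delta' cong: if_cong\<close>)
    ultimately show ?thesis by (simp add: right_diff_distrib sum_subtractf)
  qed
  \<comment> \<open>The second summation by parts; the sign makes the weights increasing.\<close>
  have "0 \<le> (\<Sum>a<n. - h (\<sigma> a) * (x a - p (\<sigma> a)))"
  proof (rule sum_mult_mono_nonneg)
    show "- h (\<sigma> a) \<le> - h (\<sigma> b)" if "a \<le> b" "b < n" for a b
    proof -
      have "\<sigma> b \<notin> \<sigma> ` {..<a}" using inj that by (auto dest: inj_onD)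
      then show ?thesis using greedy[of a "\<sigma> b"] that \<sigma>n by simp
    qed
    show "0 \<le> (\<Sum>a\<in>{j..<n}. x a - p (\<sigma> a))" if "j < n" for j
      using tail[of j] that unfolding split by simp
    have "(\<Sum>a<n. x a) = (\<Sum>i<n. p i)"
    proof -
      have "(\<Sum>a<n. x a) = (\<Sum>i<n. p i * (\<Sum>a<n. (cmod (K a i))\<^sup>2))"
        unfolding x_def sum_distrib_left by (rule sum.swap)
      also have "\<dots> = (\<Sum>i<n. p i)"
      proof (intro sum.cong refl)
        fix i assume "i \<in> {..<n}"
        then have "complex_of_real (\<Sum>a<n. (cmod (K a i))\<^sup>2) = 1"
          using orthonormal_complete[OF orth, where i = i and j = i]
          by (simp add: complex_norm_square del: of_real_power)
        then have "(\<Sum>a<n. (cmod (K a i))\<^sup>2) = 1" using of_real_eq_1_iff by blast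
        then show "p i * (\<Sum>a<n. (cmod (K a i))\<^sup>2) = p i" by simp
      qed
      finally show ?thesis .
    qed
    moreover have "(\<Sum>a<n. p (\<sigma> a)) = (\<Sum>i<n. p i)" using sum.reindex_bij_betw[OF bij, of p] .
    ultimately show "(\<Sum>a<n. x a - p (\<sigma> a)) = 0" by (simp add: sum_subtractf)
  qed
  then have "(\<Sum>a<n. h (\<sigma> a) * x a) \<le> (\<Sum>a<n. h (\<sigma> a) * p (\<sigma> a))"
    by (simp add: right_diff_distrib sum_subtractf sum_negf)
  also have "\<dots> = (\<Sum>l<n. h l * p l)" using sum.reindex_bij_betw[OF bij, of "\<lambda>l. h l * p l"] .
  finally show ?thesis unfolding x_def .
qed

section \<open>Compactness and separation\<close>

lemma bounded_family_convergent_subsequence: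
  fixes f :: "nat \<Rightarrow> 'i \<Rightarrow> 'b::heine_borel"
  assumes "finite I" and "\<And>i. i \<in> I \<Longrightarrow> bounded (range (\<lambda>m. f m i))"
  shows "\<exists>r l. strict_mono r \<and> (\<forall>i\<in>I. (\<lambda>m. f (r m) i) \<longlonglongrightarrow> l i)"
  using assms
proof (induction I rule: finite_induct)
  case empty
  show ?case by (intro exI[of _ id]) (auto simp: strict_mono_def)
next
  case (insert i I)
  then obtain r l where r: "strict_mono r" "\<And>i. i \<in> I \<Longrightarrow> (\<lambda>m. f (r m) i) \<longlonglongrightarrow> l i" by auto
  have "bounded (range (\<lambda>m. f (r m) i))"
    using insert.prems[of i] by (rule bounded_subset) auto
  then obtain l' s where s: "strict_mono s" "((\<lambda>m. f (r m) i) \<circ> s) \<longlonglongrightarrow> l'"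
    using bounded_imp_convergent_subsequence by blast
  have "(\<lambda>m. f ((r \<circ> s) m) j) \<longlonglongrightarrow> (l(i := l')) j" if "j \<in> insert i I" for j
  proof (cases "j = i")
    case True
    then show ?thesis using s(2) by (simp add: o_def)
  next
    case False
    then have "((\<lambda>m. f (r m) j) \<circ> s) \<longlonglongrightarrow> l j"
      using r(2)[of j] s(1) that by (intro LIMSEQ_subseq_LIMSEQ) auto
    then show ?thesis using False by (simp add: o_def)
  qed
  then show ?case using strict_mono_o[OF r(1) s(1)] by blast
qed

text \<open>The functional \<open>h\<close> is the difference between the nearest point of the hull and \<open>p\<close>.\<close>

lemma separating_functional_finite:
  fixes v :: "'s \<Rightarrow> 't \<Rightarrow> real" and p :: "'t \<Rightarrow> real"
  assumes finS: "finite S" and finT: "finite T"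
    and no: "\<nexists>q. (\<forall>s\<in>S. 0 \<le> q s) \<and> sum q S = 1 \<and> (\<forall>t\<in>T. (\<Sum>s\<in>S. q s * v s t) = p t)"
  obtains h c where "(\<Sum>t\<in>T. h t * p t) < c" "\<And>s. s \<in> S \<Longrightarrow> c \<le> (\<Sum>t\<in>T. h t * v s t)"
proof (cases "S = {}")
  case True
  \<comment> \<open>Without points the hull is empty, and the zero functional with
    \<open>c = 1\<close> separates.\<close>
  then show ?thesis using that[of "\<lambda>_. 0" 1] by simp
next
  case False
  define Q where "Q = {q. (\<forall>s\<in>S. 0 \<le> q s) \<and> sum q S = (1::real)}"
  define e where "e q t = (\<Sum>s\<in>S. q s * v s t) - p t" for q t
  define D where "D q = (\<Sum>t\<in>T. (e q t)\<^sup>2)" for q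
  obtain s0 where "s0 \<in> S" using False by blast
  then have "(\<lambda>s. of_bool (s = s0)) \<in> Q" using finS unfolding Q_def by (simp add: of_bool_def)
  then have ne: "D ` Q \<noteq> {}" by blast
  have D0: "0 \<le> D q" for q unfolding D_def by (simp add: sum_nonneg)
  have bdd: "bdd_below (D ` Q)" by (intro bdd_belowI[of _ 0]) (auto simp: D0)
  define \<delta> where "\<delta> = Inf (D ` Q)"
  have "\<exists>q\<in>Q. D q < \<delta> + inverse (real (Suc m))" for m
    using cInf_lessD[OF ne, of "\<delta> + inverse (real (Suc m))"] unfolding \<delta>_def by auto
  then obtain q where q: "\<And>m. q m \<in> Q" "\<And>m. D (q m) < \<delta> + inverse (real (Suc m))" by metis
  have le1: "q m s \<le> 1" if "s \<in> S" for m s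
    using q(1)[of m] finS that member_le_sum[of s S "q m"] unfolding Q_def by auto
  have "bounded (range (\<lambda>m. q m s))" if "s \<in> S" for s
    using le1[OF that] q(1) that unfolding Q_def bounded_iff by (intro exI[of _ 1]) auto
  then obtain r l where r: "strict_mono r" "\<And>s. s \<in> S \<Longrightarrow> (\<lambda>m. q (r m) s) \<longlonglongrightarrow> l s"
    using bounded_family_convergent_subsequence[OF finS, of q] by blast
  have "0 \<le> l s" if "s \<in> S" for s
    using r(2)[OF that] q(1) that unfolding Q_def by (intro LIMSEQ_le_const) auto
  moreover have "sum l S = 1"
  proof -
    have "(\<lambda>m. \<Sum>s\<in>S. q (r m) s) \<longlonglongrightarrow> sum l S" using r(2) by (intro tendsto_sum)
    moreover have "(\<Sum>s\<in>S. q (r m) s) = 1" for m using q(1) unfolding Q_def by blast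
    ultimately show ?thesis by (simp add: LIMSEQ_const_iff)
  qed
  ultimately have lQ: "l \<in> Q" unfolding Q_def by blast
  have "(\<lambda>m. D (q (r m))) \<longlonglongrightarrow> D l" unfolding D_def e_def using r(2) by (intro tendsto_intros)
  moreover have "(\<lambda>m. \<delta> + inverse (real (Suc (r m)))) \<longlonglongrightarrow> \<delta> + 0"
    using LIMSEQ_subseq_LIMSEQ[OF LIMSEQ_inverse_real_of_nat r(1)] unfolding o_def by (intro tendsto_intros)
  ultimately have "D l \<le> \<delta> + 0" by (rule LIMSEQ_le) (intro exI[of _ 0] allI impI less_imp_le q(2))
  then have min: "D l \<le> D q" if "q \<in> Q" for q
    using cInf_lower[OF _ bdd, of "D q"] that unfolding \<delta>_def by force
  define h where "h = e l"
  have "D l \<noteq> 0"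
  proof
    assume "D l = 0"
    then have "\<forall>t\<in>T. e l t = 0" unfolding D_def using finT by (subst (asm) sum_nonneg_eq_0_iff) auto
    then have "\<forall>t\<in>T. (\<Sum>s\<in>S. l s * v s t) = p t" unfolding e_def by simp
    moreover have "(\<forall>s\<in>S. 0 \<le> l s) \<and> sum l S = 1" using lQ unfolding Q_def by simp
    ultimately have "\<exists>q. (\<forall>s\<in>S. 0 \<le> q s) \<and> sum q S = 1 \<and> (\<forall>t\<in>T. (\<Sum>s\<in>S. q s * v s t) = p t)"
      by (intro exI[of _ l]) simp
    then show False using no by (rule notE[rotated])
  qed
  then have Dpos: "0 < D l" using D0[of l] by simp
  \<comment> \<open>The variational inequality of the nearest point: shifting the weights from
    \<open>l\<close> towards the vertex \<open>s\<close> cannot bring the combination closer to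
    \<open>p\<close>.\<close>
  have key: "0 \<le> (\<Sum>t\<in>T. h t * (v s t - (\<Sum>s\<in>S. l s * v s t)))" if "s \<in> S" for s
  proof (rule ccontr)
    let ?w = "\<lambda>t. v s t - (\<Sum>s\<in>S. l s * v s t)"
    assume "\<not> 0 \<le> (\<Sum>t\<in>T. h t * ?w t)"
    then have neg: "(\<Sum>t\<in>T. h t * ?w t) < 0" by simp
    define B where "B = (\<Sum>t\<in>T. h t * ?w t)"
    define C where "C = (\<Sum>t\<in>T. (?w t)\<^sup>2)"
    have "C \<ge> 0" unfolding C_def by (simp add: sum_nonneg)
    have ineq: "0 \<le> 2 * \<epsilon> * B + \<epsilon>\<^sup>2 * C" if eps: "0 \<le> \<epsilon>" "\<epsilon> \<le> 1" for \<epsilon>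
    proof -
      define q' where "q' u = (1 - \<epsilon>) * l u + \<epsilon> * of_bool (u = s)" for u
      have "sum q' S = (1 - \<epsilon>) * sum l S + \<epsilon> * (\<Sum>u\<in>S. of_bool (u = s))"
        unfolding q'_def by (simp add: sum.distrib sum_distrib_left)
      also have "(\<Sum>u\<in>S. of_bool (u = s) :: real) = 1" using finS \<open>s \<in> S\<close> by (simp add: of_bool_def)
      finally have "sum q' S = 1" using lQ unfolding Q_def by simp
      moreover have "0 \<le> q' u" if "u \<in> S" for u
        using lQ that eps unfolding Q_def q'_def by simp
      ultimately have "q' \<in> Q" unfolding Q_def by blast
      have "e q' t = h t + \<epsilon> * ?w t" for t
      proof -
        have "q' u * v u t = (1 - \<epsilon>) * (l u * v u t) + \<epsilon> * (of_bool (u = s) * v u t)" for u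
          unfolding q'_def by (simp add: algebra_simps)
        then have "(\<Sum>u\<in>S. q' u * v u t) = (1 - \<epsilon>) * (\<Sum>u\<in>S. l u * v u t) + \<epsilon> * (\<Sum>u\<in>S. of_bool (u = s) * v u t)"
          by (simp only: sum.distrib sum_distrib_left)
        also have "(\<Sum>u\<in>S. of_bool (u = s) * v u t) = (\<Sum>u\<in>S. if u = s then v s t else 0)"
          by (intro sum.cong) auto
        also have "\<dots> = v s t" using finS \<open>s \<in> S\<close> by simp
        finally show ?thesis unfolding h_def e_def by (simp add: algebra_simps)
      qed
      moreover have "(x + \<epsilon> * y)\<^sup>2 = x\<^sup>2 + (2 * \<epsilon> * (x * y) + \<epsilon>\<^sup>2 * y\<^sup>2)" for x y
        by (simp add: power2_eq_square algebra_simps)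
      ultimately have "(e q' t)\<^sup>2 = (e l t)\<^sup>2 + (2 * \<epsilon> * (h t * ?w t) + \<epsilon>\<^sup>2 * (?w t)\<^sup>2)" for t
        unfolding h_def by (simp only:)
      then have "D q' = D l + (2 * \<epsilon> * B + \<epsilon>\<^sup>2 * C)"
        unfolding D_def B_def C_def by (simp only: sum.distrib sum_distrib_left)
      then show ?thesis using min[OF \<open>q' \<in> Q\<close>] by simp
    qed
    \<comment> \<open>Small enough that \<open>\<epsilon> * C\<close> cannot make up for the
      negative \<open>2 * B\<close>. The summand 1 avoids division by 0, and
      \<open>\<epsilon> \<le> 1\<close> keeps the weights nonnegative.\<close>
    define \<epsilon> where "\<epsilon> = min 1 (- B / (C + 1))"
    have B: "B < 0" using neg by (simp only: B_def)
    have "0 < \<epsilon>" unfolding \<epsilon>_def using B \<open>C \<ge> 0\<close> by (simp add: divide_neg_pos)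
    have "\<epsilon> \<le> - B / (C + 1)" unfolding \<epsilon>_def by (rule min.cobounded2)
    then have "\<epsilon> * (C + 1) \<le> - B" by (subst (asm) pos_le_divide_eq) (use \<open>C \<ge> 0\<close> in simp_all)
    then have "\<epsilon> * C \<le> - B" using \<open>0 < \<epsilon>\<close> by (simp add: distrib_left)
    have "0 \<le> \<epsilon> * (2 * B + \<epsilon> * C)"
      using ineq[of \<epsilon>] \<open>0 < \<epsilon>\<close> unfolding \<epsilon>_def power2_eq_square by (simp add: algebra_simps)
    then have "0 \<le> 2 * B + \<epsilon> * C" using \<open>0 < \<epsilon>\<close> by (simp add: zero_le_mult_iff)
    then show False using B \<open>\<epsilon> * C \<le> - B\<close> by linarith
  qed
  show ?thesis
  proof (rule that[of h "(\<Sum>t\<in>T. h t * (\<Sum>s\<in>S. l s * v s t))"])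
    have "h t * (\<Sum>s\<in>S. l s * v s t) = h t * p t + (e l t)\<^sup>2" for t
      unfolding h_def e_def by (simp add: power2_eq_square left_diff_distrib right_diff_distrib)
    then have "(\<Sum>t\<in>T. h t * (\<Sum>s\<in>S. l s * v s t)) = (\<Sum>t\<in>T. h t * p t) + D l"
      unfolding D_def by (simp add: sum.distrib)
    then show "(\<Sum>t\<in>T. h t * p t) < (\<Sum>t\<in>T. h t * (\<Sum>s\<in>S. l s * v s t))" using Dpos by simp
    show "(\<Sum>t\<in>T. h t * (\<Sum>s\<in>S. l s * v s t)) \<le> (\<Sum>t\<in>T. h t * v s t)" if "s \<in> S" for s
      using key[OF that] by (simp add: right_diff_distrib sum_subtractf)
  qed
qed

section \<open>Marginals of limits lie in weight hulls\<close>

text \<open>Slot 0 is the identity, so that \<open>kron\<close> treats the factor on which the group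
  does not act like the others. Entries with an index beyond the format are free, hence one group
  element has many representatives.\<close>

definition borel_coords :: "nat \<Rightarrow> (nat \<Rightarrow> nat) \<Rightarrow> (nat \<Rightarrow> nat \<Rightarrow> nat \<Rightarrow> complex) \<Rightarrow> bool" where
  "borel_coords d n U \<longleftrightarrow> (\<forall>a b. U 0 a b = of_bool (a = b)) \<and>
    (\<forall>i\<in>{1..d}. \<forall>a<n i. U i a a \<noteq> 0 \<and> (\<forall>b<a. U i a b = 0))"

text \<open>The determinant is the product of the diagonal, so an inverse exists. It is triangular
  because the relation \<open>B A = 1\<close> can be solved column by column from the left.\<close>

lemma upper_triangular_inverse:
  fixes A :: "nat \<Rightarrow> nat \<Rightarrow> complex"
  assumes A: "\<forall>a<n. A a a \<noteq> 0 \<and> (\<forall>b<a. A a b = 0)"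
  obtains B where "\<forall>a<n. B a a \<noteq> 0 \<and> (\<forall>b<a. B a b = 0)"
    "\<forall>a<n. \<forall>c<n. (\<Sum>b<n. A a b * B b c) = of_bool (a = c)"
    "\<forall>a<n. \<forall>c<n. (\<Sum>b<n. B a b * A b c) = of_bool (a = c)"
proof -
  define M where "M = Matrix.mat n n (\<lambda>(a, b). A a b)"
  have M: "M \<in> carrier_mat n n" unfolding M_def by simp
  have "upper_triangular M" using A unfolding M_def by auto
  then have "Determinant.det M = prod_list (diag_mat M)" using M by (rule det_upper_triangular)
  also have "\<dots> \<noteq> 0" using A unfolding diag_mat_def M_def by (auto simp: prod_list_zero_iff)
  finally have "M \<in> Units (ring_mat TYPE(complex) n ())"
    by (rule det_non_zero_imp_unit[OF M])
  then obtain N where N: "N \<in> carrier_mat n n" "N * M = 1\<^sub>m n" "M * N = 1\<^sub>m n"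
    unfolding Units_def ring_mat_def by auto
  define B where "B a b = N $$ (a, b)" for a b
  have 1: "(\<Sum>b<n. A a b * B b c) = of_bool (a = c)" if "a < n" "c < n" for a c
  proof -
    have "(M * N) $$ (a, c) = of_bool (a = c)" using that N(3) by simp
    then show ?thesis using that M N(1) by (simp add: M_def B_def scalar_prod_def lessThan_atLeast0)
  qed
  have 2: "(\<Sum>b<n. B a b * A b c) = of_bool (a = c)" if "a < n" "c < n" for a c
  proof -
    have "(N * M) $$ (a, c) = of_bool (a = c)" using that N(2) by simp
    then show ?thesis using that M N(1) by (simp add: M_def B_def scalar_prod_def lessThan_atLeast0)
  qed
  have low: "B a b = 0" if "a < n" "b < a" for a b
    using that
  proof (induction b rule: less_induct)
    case (less b)
    have "(\<Sum>c<n. B a c * A c b) = (\<Sum>c<n. if c = b then B a b * A b b else 0)"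
    proof (intro sum.cong refl)
      fix c assume "c \<in> {..<n}"
      then show "B a c * A c b = (if c = b then B a b * A b b else 0)"
        using less A by (cases c b rule: linorder_cases) auto
    qed
    then show ?case using 2[of a b] less.prems A by simp
  qed
  have diag: "B a a \<noteq> 0" if "a < n" for a
  proof -
    have "(\<Sum>c<n. B a c * A c a) = (\<Sum>c<n. if c = a then B a a * A a a else 0)"
    proof (intro sum.cong refl)
      fix c assume "c \<in> {..<n}"
      then show "B a c * A c a = (if c = a then B a a * A a a else 0)"
        using low[OF that] A by (cases c a rule: linorder_cases) auto
    qed
    then show ?thesis using 2[of a a] that by auto
  qed
  show ?thesis using that[of B] 1 2 low diag by blast
qed

lemma borel_coords_inverse:
  assumes "borel_coords d n U"
  obtains V where "borel_coords d n V"
    "\<And>X. X \<in> Ten d n \<Longrightarrow> kron d n U (kron d n V X) = X"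
    "\<And>X. X \<in> Ten d n \<Longrightarrow> kron d n V (kron d n U X) = X"
proof -
  have "\<forall>i\<in>{1..d}. \<exists>B. (\<forall>a<n i. B a a \<noteq> 0 \<and> (\<forall>b<a. B a b = 0)) \<and>
    (\<forall>a<n i. \<forall>c<n i. (\<Sum>b<n i. U i a b * B b c) = of_bool (a = c)) \<and>
    (\<forall>a<n i. \<forall>c<n i. (\<Sum>b<n i. B a b * U i b c) = of_bool (a = c))"
  proof
    fix i assume "i \<in> {1..d}"
    then have "\<forall>a<n i. U i a a \<noteq> 0 \<and> (\<forall>b<a. U i a b = 0)" using assms unfolding borel_coords_def by blast
    from upper_triangular_inverse[OF this]
    obtain B where "\<forall>a<n i. B a a \<noteq> 0 \<and> (\<forall>b<a. B a b = 0)"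
      "\<forall>a<n i. \<forall>c<n i. (\<Sum>b<n i. U i a b * B b c) = of_bool (a = c)"
      "\<forall>a<n i. \<forall>c<n i. (\<Sum>b<n i. B a b * U i b c) = of_bool (a = c)" .
    then show "\<exists>B. (\<forall>a<n i. B a a \<noteq> 0 \<and> (\<forall>b<a. B a b = 0)) \<and>
      (\<forall>a<n i. \<forall>c<n i. (\<Sum>b<n i. U i a b * B b c) = of_bool (a = c)) \<and>
      (\<forall>a<n i. \<forall>c<n i. (\<Sum>b<n i. B a b * U i b c) = of_bool (a = c))" by (intro exI[of _ B] conjI)
  qed
  then obtain B where B: "\<forall>i\<in>{1..d}. (\<forall>a<n i. B i a a \<noteq> 0 \<and> (\<forall>b<a. B i a b = 0)) \<and>
    (\<forall>a<n i. \<forall>c<n i. (\<Sum>b<n i. U i a b * B i b c) = of_bool (a = c)) \<and>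
    (\<forall>a<n i. \<forall>c<n i. (\<Sum>b<n i. B i a b * U i b c) = of_bool (a = c))"
    unfolding bchoice_iff by blast
  define V where "V i a b = (if i = 0 then of_bool (a = b) else B i a b)" for i a b
  have U0: "U 0 a b = of_bool (a = b)" for a b using assms unfolding borel_coords_def by blast
  have UV: "(\<Sum>b<n i. U i a b * V i b c) = of_bool (a = c)" "(\<Sum>b<n i. V i a b * U i b c) = of_bool (a = c)"
    if "i \<le> d" "a < n i" "c < n i" for i a c
  proof -
    show "(\<Sum>b<n i. U i a b * V i b c) = of_bool (a = c)"
      using B that U0 unfolding V_def by (cases "i = 0") auto
    show "(\<Sum>b<n i. V i a b * U i b c) = of_bool (a = c)"
      using B that U0 unfolding V_def by (cases "i = 0") auto
  qed
  show ?thesis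
  proof
    show "borel_coords d n V" using B unfolding borel_coords_def V_def by auto
    show "kron d n U (kron d n V X) = X" if "X \<in> Ten d n" for X
      unfolding kron_comp using kron_id[OF that] UV(1)
      by (subst kron_cong[of d n _ "\<lambda>i a b. of_bool (a = b)" X X]) auto
    show "kron d n V (kron d n U X) = X" if "X \<in> Ten d n" for X
      unfolding kron_comp using kron_id[OF that] UV(2)
      by (subst kron_cong[of d n _ "\<lambda>i a b. of_bool (a = b)" X X]) auto
  qed
qed

lemma borel_coords_mult:
  assumes U: "borel_coords d n U" and V: "borel_coords d n V"
  obtains T where "borel_coords d n T" "\<And>X. kron d n U (kron d n V X) = kron d n T X"
    "\<And>i a. i \<in> {1..d} \<Longrightarrow> a < n i \<Longrightarrow> T i a a = U i a a * V i a a"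
proof -
  define T where "T i a c = (if i = 0 then of_bool (a = c) else \<Sum>b<n i. U i a b * V i b c)" for i a c
  have upper: "U i a b = 0" "V i a b = 0" if "i \<in> {1..d}" "a < n i" "b < a" for i a b
    using U V that unfolding borel_coords_def by auto
  have diag: "T i a a = U i a a * V i a a" if "i \<in> {1..d}" "a < n i" for i a
  proof -
    have "(\<Sum>b<n i. U i a b * V i b a) = (\<Sum>b<n i. if b = a then U i a a * V i a a else 0)"
    proof (intro sum.cong refl)
      fix b assume "b \<in> {..<n i}"
      then show "U i a b * V i b a = (if b = a then U i a a * V i a a else 0)"
        using upper[OF that(1)] that(2) by (cases b a rule: linorder_cases) auto
    qed
    then show ?thesis using that unfolding T_def by simp
  qed
  have "T i a c = 0" if "i \<in> {1..d}" "a < n i" "c < a" for i a c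
  proof -
    have "(\<Sum>b<n i. U i a b * V i b c) = 0"
    proof (intro sum.neutral ballI)
      fix b assume "b \<in> {..<n i}"
      then show "U i a b * V i b c = 0" using upper[OF that(1)] that by (cases "b < a") auto
    qed
    then show ?thesis using that unfolding T_def by simp
  qed
  moreover have "T i a a \<noteq> 0" if "i \<in> {1..d}" "a < n i" for i a
    using diag[OF that] U V that unfolding borel_coords_def by simp
  ultimately have "borel_coords d n T" unfolding borel_coords_def by (simp add: T_def[of 0])
  moreover have "kron d n U (kron d n V X) = kron d n T X" for X
    unfolding kron_comp
  proof (rule kron_cong)
    fix i a b assume "i \<le> d" "a < n i" "b < n i"
    then show "(\<Sum>c<n i. U i a c * V i c b) = T i a b"
      using U V unfolding T_def borel_coords_def by (cases "i = 0") (auto simp: if_distrib cong: if_cong)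
  qed simp
  ultimately show ?thesis using that diag by blast
qed

text \<open>The weight of the basis tensor at \<alpha> under the torus of diagonal matrices: the
  value at \<open>(i, j)\<close> is the exponent of the \<open>j\<close>-th diagonal entry of the
  \<open>i\<close>-th matrix.\<close>

definition weight_vec :: "(nat \<Rightarrow> nat) \<Rightarrow> nat \<times> nat \<Rightarrow> real" where
  "weight_vec \<alpha> = (\<lambda>(i, j). of_bool (\<alpha> i = j))"

definition in_weight_hull :: "nat \<Rightarrow> (nat \<Rightarrow> nat) \<Rightarrow> (nat \<Rightarrow> nat \<Rightarrow> real) \<Rightarrow> (nat \<Rightarrow> nat) set \<Rightarrow> bool" where
  "in_weight_hull d n p S \<longleftrightarrow> (\<exists>q. (\<forall>\<alpha>\<in>S. 0 \<le> q \<alpha>) \<and> sum q S = 1 \<and>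
    (\<forall>t\<in>(SIGMA i:{1..d}. {..<n i}). (\<Sum>\<alpha>\<in>S. q \<alpha> * weight_vec \<alpha> t) = case_prod p t))"

definition supp :: "nat \<Rightarrow> (nat \<Rightarrow> nat) \<Rightarrow> tensor \<Rightarrow> (nat \<Rightarrow> nat) set" where
  "supp d n X = {\<alpha>\<in>multi_indices d n. X \<alpha> \<noteq> 0}"

text \<open>The arguments of \<open>U i\<close> are swapped because its columns are
  orthogonalised.\<close>

lemma borel_coords_adapted_basis:
  assumes "borel_coords d n U" "i \<in> {1..d}"
  shows "\<exists>\<sigma> K. adapted_basis (n i) g (\<lambda>l a. U i a l) \<sigma> K"
proof (rule gram_schmidt_greedy, intro allI impI)
  fix x l assume x: "\<forall>j<n i. (\<Sum>l<n i. x l * U i j l) = 0" and l: "l < n i"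
  have "\<forall>l<n i. x l = 0"
    by (rule upper_triangular_independent[of "n i" "\<lambda>l a. U i a l" x])
       (use assms x in \<open>auto simp: borel_coords_def\<close>)
  then show "x l = 0" using l by blast
qed

text \<open>Suppose that \<open>X\<close> lies in the sum of the weight spaces on which the functional \<open>h\<close> is at
  least \<open>c\<close>.  Writing \<open>U i\<close> as a unitary matrix times one that preserves this filtration, the
  unitary factor carries \<open>Y\<close> close to the filtration subspace, while the trace inequality
  bounds the expectation of \<open>h\<close> from above.\<close>

lemma functional_le_of_approx:
  fixes X Y :: tensor and h :: "nat \<times> nat \<Rightarrow> real" and \<epsilon> :: real
  assumes Y: "norm_sq d n Y = 1"
    and marg: "\<And>i a b. i \<in> {1..d} \<Longrightarrow> a < n i \<Longrightarrow> b < n i \<Longrightarrow>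
      marginal_entry d n Y i a b = of_bool (a = b) * of_real (p i a)"
    and mono: "\<And>i a b. i \<in> {1..d} \<Longrightarrow> a \<le> b \<Longrightarrow> b < n i \<Longrightarrow> p i a \<le> p i b"
    and U: "borel_coords d n U"
    and approx: "\<And>\<alpha>. \<alpha> \<in> multi_indices d n \<Longrightarrow> cmod (s * kron d n U X \<alpha> - Y \<alpha>) \<le> \<epsilon>"
    and X: "\<And>\<alpha>. \<alpha> \<in> supp d n X \<Longrightarrow> c \<le> (\<Sum>i\<in>{1..d}. h (i, \<alpha> i))"
  shows "c - (\<Sum>i\<in>{1..d}. \<Sum>l<n i. h (i, l) * p i l) \<le>
    (\<bar>c\<bar> + (\<Sum>i\<in>{1..d}. \<Sum>l<n i. \<bar>h (i, l)\<bar>)) * (card (multi_indices d n) * \<epsilon>\<^sup>2)"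
proof -
  let ?M = "multi_indices d n"
  have "\<forall>i\<in>{1..d}. \<exists>\<sigma>K. adapted_basis (n i) (\<lambda>l _. h (i, l)) (\<lambda>l a. U i a l) (fst \<sigma>K) (snd \<sigma>K)"
    using borel_coords_adapted_basis[OF U] by simp
  then obtain \<sigma>K where "\<forall>i\<in>{1..d}. adapted_basis (n i) (\<lambda>l _. h (i, l)) (\<lambda>l a. U i a l) (fst (\<sigma>K i)) (snd (\<sigma>K i))"
    unfolding bchoice_iff by blast
  then obtain \<sigma> K where basis: "\<And>i. i \<in> {1..d} \<Longrightarrow>
      adapted_basis (n i) (\<lambda>l _. h (i, l)) (\<lambda>l a. U i a l) (\<sigma> i) (K i)"
    using that[of "\<lambda>i. fst (\<sigma>K i)" "\<lambda>i. snd (\<sigma>K i)"] by blast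
  \<comment> \<open>The rows are the conjugated basis vectors, so \<open>W i\<close> inverts the
    unitary factor of \<open>U i\<close>, and the product of \<open>W i\<close> and
    \<open>U i\<close> is triangular once the columns are permuted by
    \<open>\<sigma> i\<close>.\<close>
  define W where "W i a b = (if i = 0 then of_bool (a = b) else cnj (K i a b))" for i a b
  have unitary: "(\<Sum>a<n i. W i a b * cnj (W i a b')) = of_bool (b = b')"
    if "i \<le> d" "b < n i" "b' < n i" for i b b'
  proof (cases "i = 0")
    case True
    have "(\<Sum>a<n i. of_bool (a = b) * of_bool (a = b') :: complex) = (\<Sum>a<n i. if a = b then of_bool (b = b') else 0)"
      by (intro sum.cong) auto
    then show ?thesis using that True unfolding W_def by simp
  next
    case False
    then have "i \<in> {1..d}" using that by simp
    from orthonormal_complete[OF adapted_basisD(2)[OF basis[OF this]] that(3,2)]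
    show ?thesis using False unfolding W_def by (simp add: mult.commute eq_commute[of b])
  qed
  define H where "H \<alpha> = (\<Sum>i\<in>{1..d}. h (i, \<sigma> i (\<alpha> i)))" for \<alpha>
  define Y' where "Y' = kron d n W Y"
  define Z where "Z = (\<lambda>\<alpha>. s * kron d n U X \<alpha>)"
  define Z' where "Z' = kron d n W Z"
  have \<sigma>n: "\<sigma> i a < n i" if "i \<in> {1..d}" "a < n i" for i a
    using adapted_basisD(1)[OF basis[OF that(1)]] that(2) unfolding bij_betw_def by blast
  have Hbound: "\<bar>H \<alpha>\<bar> \<le> (\<Sum>i\<in>{1..d}. \<Sum>l<n i. \<bar>h (i, l)\<bar>)" if "\<alpha> \<in> ?M" for \<alpha>
  proof -
    have "\<bar>H \<alpha>\<bar> \<le> (\<Sum>i\<in>{1..d}. \<bar>h (i, \<sigma> i (\<alpha> i))\<bar>)" unfolding H_def by (rule sum_abs)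
    also have "\<dots> \<le> (\<Sum>i\<in>{1..d}. \<Sum>l<n i. \<bar>h (i, l)\<bar>)"
    proof (rule sum_mono)
      fix i assume i: "i \<in> {1..d}"
      then have "\<sigma> i (\<alpha> i) \<in> {..<n i}" using \<sigma>n multi_indices_less[OF that, of i] by simp
      then show "\<bar>h (i, \<sigma> i (\<alpha> i))\<bar> \<le> (\<Sum>l<n i. \<bar>h (i, l)\<bar>)"
        by (intro member_le_sum) auto
    qed
    finally show ?thesis .
  qed
  \<comment> \<open>A nonzero entry in row \<open>\<alpha> i\<close> of the product of
    \<open>W i\<close> and \<open>U i\<close> lies in a column \<open>\<beta> i\<close> not chosen
    before step \<open>\<alpha> i\<close>. Greediness bounds \<open>h\<close> on that column by its
    value on the column chosen at this step, so the functional can only grow from \<beta> to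
    \<alpha>.\<close>
  have Z'0: "c \<le> H \<alpha>" if "\<alpha> \<in> ?M" "Z' \<alpha> \<noteq> 0" for \<alpha>
  proof -
    have "Z' \<alpha> = s * kron d n (\<lambda>i a c. \<Sum>b<n i. W i a b * U i b c) X \<alpha>"
      unfolding Z'_def Z_def kron_scale kron_comp ..
    then have "(\<Sum>\<beta>\<in>?M. (\<Prod>i\<in>{0..d}. \<Sum>b<n i. W i (\<alpha> i) b * U i b (\<beta> i)) * X \<beta>) \<noteq> 0"
      using that unfolding kron_def by auto
    then obtain \<beta> where \<beta>: "\<beta> \<in> ?M" "(\<Prod>i\<in>{0..d}. \<Sum>b<n i. W i (\<alpha> i) b * U i b (\<beta> i)) * X \<beta> \<noteq> 0"
      by (meson sum.not_neutral_contains_not_neutral)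
    then have "c \<le> (\<Sum>i\<in>{1..d}. h (i, \<beta> i))" by (intro X) (simp add: supp_def)
    also have "\<dots> \<le> H \<alpha>" unfolding H_def
    proof (rule sum_mono)
      fix i assume i: "i \<in> {1..d}"
      note B = basis[OF i]
      have "\<alpha> i < n i" "\<beta> i < n i" using multi_indices_less that(1) \<beta>(1) i by auto
      obtain b where b: "b < n i" "\<beta> i = \<sigma> i b"
        using adapted_basisD(1)[OF B] \<open>\<beta> i < n i\<close> unfolding bij_betw_def by blast
      have "(\<Sum>b<n i. W i (\<alpha> i) b * U i b (\<beta> i)) \<noteq> 0" using \<beta>(2) i by auto
      then have "inner_prod (n i) (K i (\<alpha> i)) (\<lambda>a. U i a (\<sigma> i b)) \<noteq> 0"
        using i b(2) unfolding W_def inner_prod_def by simp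
      then have "\<not> b < \<alpha> i" using adapted_basisD(3)[OF B \<open>\<alpha> i < n i\<close>, of b] by auto
      have "\<beta> i \<notin> \<sigma> i ` {..<\<alpha> i}"
      proof
        assume "\<beta> i \<in> \<sigma> i ` {..<\<alpha> i}"
        then obtain a where "a < \<alpha> i" "\<sigma> i b = \<sigma> i a" unfolding b(2) by blast
        moreover have "a < n i" using \<open>a < \<alpha> i\<close> \<open>\<alpha> i < n i\<close> by simp
        ultimately have "b = a" using adapted_basisD(1)[OF B] b(1) unfolding bij_betw_def by (auto dest: inj_onD)
        then show False using \<open>\<not> b < \<alpha> i\<close> \<open>a < \<alpha> i\<close> by simp
      qed
      then show "h (i, \<beta> i) \<le> h (i, \<sigma> i (\<alpha> i))"
        using adapted_basisD(5)[OF B \<open>\<alpha> i < n i\<close> \<open>\<beta> i < n i\<close>] by blast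
    qed
    finally show ?thesis .
  qed
  \<comment> \<open>Since the marginal is diagonal, the mean of the permuted \<open>h\<close> in
    \<open>Y'\<close> is exactly the left side of the trace inequality.\<close>
  have slice: "(\<Sum>\<alpha>\<in>?M. h (i, \<sigma> i (\<alpha> i)) * (cmod (Y' \<alpha>))\<^sup>2) \<le> (\<Sum>l<n i. h (i, l) * p i l)"
    if i: "i \<in> {1..d}" for i
  proof -
    have "complex_of_real (\<Sum>\<alpha>\<in>?M. h (i, \<sigma> i (\<alpha> i)) * (cmod (Y' \<alpha>))\<^sup>2) =
        (\<Sum>b<n i. \<Sum>b'<n i. (\<Sum>a<n i. of_real (h (i, \<sigma> i a)) * W i a b * cnj (W i a b')) * marginal_entry d n Y i b b')"
      unfolding Y'_def of_real_sum
      by (rule kron_weighted_norm[where f = "\<lambda>a. h (i, \<sigma> i a)"]) (use unitary i in auto)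
    also have "\<dots> = (\<Sum>b<n i. (\<Sum>a<n i. of_real (h (i, \<sigma> i a)) * W i a b * cnj (W i a b)) * of_real (p i b))"
    proof (intro sum.cong refl)
      fix b assume b: "b \<in> {..<n i}"
      have "(\<Sum>b'<n i. (\<Sum>a<n i. of_real (h (i, \<sigma> i a)) * W i a b * cnj (W i a b')) * marginal_entry d n Y i b b')
        = (\<Sum>b'<n i. if b' = b then (\<Sum>a<n i. of_real (h (i, \<sigma> i a)) * W i a b * cnj (W i a b)) * of_real (p i b) else 0)"
        using b by (intro sum.cong refl) (auto simp: marg[OF i])
      then show "(\<Sum>b'<n i. (\<Sum>a<n i. of_real (h (i, \<sigma> i a)) * W i a b * cnj (W i a b')) * marginal_entry d n Y i b b')
        = (\<Sum>a<n i. of_real (h (i, \<sigma> i a)) * W i a b * cnj (W i a b)) * of_real (p i b)"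
        using b by simp
    qed
    also have "\<dots> = (\<Sum>b<n i. \<Sum>a<n i. of_real (h (i, \<sigma> i a) * (p i b * (cmod (K i a b))\<^sup>2)))"
    proof -
      have "of_real (h (i, \<sigma> i a)) * W i a b * cnj (W i a b) * of_real (p i b) =
          of_real (h (i, \<sigma> i a) * (p i b * (cmod (K i a b))\<^sup>2))" for a b
        using i unfolding W_def by (simp add: complex_norm_square mult_ac del: of_real_power)
      then show ?thesis unfolding sum_distrib_right by (intro sum.cong refl)
    qed
    also have "\<dots> = of_real (\<Sum>a<n i. h (i, \<sigma> i a) * (\<Sum>b<n i. p i b * (cmod (K i a b))\<^sup>2))"
      by (subst sum.swap) (simp add: sum_distrib_left)
    finally have "(\<Sum>\<alpha>\<in>?M. h (i, \<sigma> i (\<alpha> i)) * (cmod (Y' \<alpha>))\<^sup>2) =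
        (\<Sum>a<n i. h (i, \<sigma> i a) * (\<Sum>b<n i. p i b * (cmod (K i a b))\<^sup>2))"
      by (simp only: of_real_eq_iff)
    also have "\<dots> \<le> (\<Sum>l<n i. h (i, l) * p i l)"
      by (rule adapted_basis_trace_inequality[of "n i" "\<lambda>l a. U i a l" "\<lambda>l. h (i, l)"])
         (use U i basis mono in \<open>auto simp: borel_coords_def\<close>)
    finally show ?thesis .
  qed
  have "(\<Sum>\<alpha>\<in>?M. H \<alpha> * (cmod (Y' \<alpha>))\<^sup>2) = (\<Sum>i\<in>{1..d}. \<Sum>\<alpha>\<in>?M. h (i, \<sigma> i (\<alpha> i)) * (cmod (Y' \<alpha>))\<^sup>2)"
    unfolding H_def sum_distrib_right by (rule sum.swap)
  also have "\<dots> \<le> (\<Sum>i\<in>{1..d}. \<Sum>l<n i. h (i, l) * p i l)" by (intro sum_mono slice)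
  finally have HY: "(\<Sum>\<alpha>\<in>?M. H \<alpha> * (cmod (Y' \<alpha>))\<^sup>2) \<le> (\<Sum>i\<in>{1..d}. \<Sum>l<n i. h (i, l) * p i l)" .
  have "norm_sq d n Y' = 1" unfolding Y'_def using norm_sq_kron_unitary[of d n W Y] unitary Y by simp
  then have Y'1: "(\<Sum>\<alpha>\<in>?M. c * (cmod (Y' \<alpha>))\<^sup>2) = c"
    unfolding norm_sq_def by (simp add: sum_distrib_left[symmetric])
  define D where "D = \<bar>c\<bar> + (\<Sum>i\<in>{1..d}. \<Sum>l<n i. \<bar>h (i, l)\<bar>)"
  have "D \<ge> 0" unfolding D_def by (intro add_nonneg_nonneg sum_nonneg) auto
  have "c - (\<Sum>i\<in>{1..d}. \<Sum>l<n i. h (i, l) * p i l) \<le> (\<Sum>\<alpha>\<in>?M. c * (cmod (Y' \<alpha>))\<^sup>2) - (\<Sum>\<alpha>\<in>?M. H \<alpha> * (cmod (Y' \<alpha>))\<^sup>2)"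
    using HY Y'1 by linarith
  also have "\<dots> = (\<Sum>\<alpha>\<in>?M. (c - H \<alpha>) * (cmod (Y' \<alpha>))\<^sup>2)"
    by (simp add: left_diff_distrib sum_subtractf)
  also have "\<dots> \<le> (\<Sum>\<alpha>\<in>?M. D * (cmod (Y' \<alpha> - Z' \<alpha>))\<^sup>2)"
  proof (rule sum_mono)
    fix \<alpha> assume \<alpha>: "\<alpha> \<in> ?M"
    show "(c - H \<alpha>) * (cmod (Y' \<alpha>))\<^sup>2 \<le> D * (cmod (Y' \<alpha> - Z' \<alpha>))\<^sup>2"
    \<comment> \<open>Where \<open>Z'\<close> vanishes, \<open>Y'\<close> consists of error only and
      \<open>D\<close> bounds the coefficient; elsewhere \<open>H \<alpha> \<ge> c\<close> and the
      left side is at most 0.\<close>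
    proof (cases "Z' \<alpha> = 0")
      case True
      have "c - H \<alpha> \<le> D" using Hbound[OF \<alpha>] unfolding D_def by linarith
      then show ?thesis using True by (simp add: mult_right_mono)
    next
      case False
      then have "(c - H \<alpha>) * (cmod (Y' \<alpha>))\<^sup>2 \<le> 0"
        using Z'0[OF \<alpha>] by (intro mult_nonpos_nonneg) auto
      also have "0 \<le> D * (cmod (Y' \<alpha> - Z' \<alpha>))\<^sup>2" using \<open>D \<ge> 0\<close> by simp
      finally show ?thesis .
    qed
  qed
  also have "\<dots> = D * norm_sq d n (\<lambda>\<alpha>. Y' \<alpha> - Z' \<alpha>)" unfolding norm_sq_def sum_distrib_left ..
  also have "(\<lambda>\<alpha>. Y' \<alpha> - Z' \<alpha>) = kron d n W (\<lambda>\<alpha>. Y \<alpha> - Z \<alpha>)"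
    unfolding Y'_def Z'_def kron_diff ..
  also have "norm_sq d n \<dots> = norm_sq d n (\<lambda>\<alpha>. Y \<alpha> - Z \<alpha>)" using norm_sq_kron_unitary[of d n W] unitary by simp
  also have "D * \<dots> \<le> D * (card ?M * \<epsilon>\<^sup>2)"
  proof (rule mult_left_mono)
    have "norm_sq d n (\<lambda>\<alpha>. Y \<alpha> - Z \<alpha>) \<le> (\<Sum>\<alpha>\<in>?M. \<epsilon>\<^sup>2)"
      unfolding norm_sq_def Z_def
      by (intro sum_mono power_mono) (use approx in \<open>auto simp: norm_minus_commute\<close>)
    then show "norm_sq d n (\<lambda>\<alpha>. Y \<alpha> - Z \<alpha>) \<le> card ?M * \<epsilon>\<^sup>2" by simp
  qed (rule \<open>D \<ge> 0\<close>)
  finally show ?thesis unfolding D_def .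
qed

text \<open>A separating functional leaves a fixed gap \<open>c - m\<close>, whereas
  \<open>functional_le_of_approx\<close> bounds this gap by a multiple of the squared error of an
  approximation that may be arbitrarily good.\<close>

lemma in_weight_hull_of_approx:
  assumes Y: "norm_sq d n Y = 1"
    and marg: "\<And>i a b. i \<in> {1..d} \<Longrightarrow> a < n i \<Longrightarrow> b < n i \<Longrightarrow>
      marginal_entry d n Y i a b = of_bool (a = b) * of_real (p i a)"
    and mono: "\<And>i a b. i \<in> {1..d} \<Longrightarrow> a \<le> b \<Longrightarrow> b < n i \<Longrightarrow> p i a \<le> p i b"
    and approx: "\<And>\<epsilon>. 0 < \<epsilon> \<Longrightarrow> \<exists>U s. borel_coords d n U \<and>
      (\<forall>\<alpha>\<in>multi_indices d n. cmod (s * kron d n U X \<alpha> - Y \<alpha>) \<le> \<epsilon>)"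
  shows "in_weight_hull d n p (supp d n X)"
proof (rule ccontr)
  let ?T = "SIGMA i:{1..d}. {..<n i}"
  assume "\<not> in_weight_hull d n p (supp d n X)"
  then have no: "\<nexists>q. (\<forall>\<alpha>\<in>supp d n X. 0 \<le> q \<alpha>) \<and> sum q (supp d n X) = 1 \<and>
      (\<forall>t\<in>?T. (\<Sum>\<alpha>\<in>supp d n X. q \<alpha> * weight_vec \<alpha> t) = case_prod p t)"
    unfolding in_weight_hull_def .
  have "finite (supp d n X)" unfolding supp_def by simp
  from separating_functional_finite[OF this _ no]
  obtain h c where hp: "(\<Sum>t\<in>?T. h t * case_prod p t) < c"
    and hS: "\<And>\<alpha>. \<alpha> \<in> supp d n X \<Longrightarrow> c \<le> (\<Sum>t\<in>?T. h t * weight_vec \<alpha> t)" by auto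
  define m where "m = (\<Sum>i\<in>{1..d}. \<Sum>l<n i. h (i, l) * p i l)"
  have m: "m < c" using hp unfolding m_def by (simp add: sum.Sigma case_prod_beta)
  have hS': "c \<le> (\<Sum>i\<in>{1..d}. h (i, \<alpha> i))" if "\<alpha> \<in> supp d n X" for \<alpha>
  proof -
    have "\<alpha> \<in> multi_indices d n" using that unfolding supp_def by simp
    have "(\<Sum>t\<in>?T. h t * weight_vec \<alpha> t) = (\<Sum>(i, l)\<in>?T. h (i, l) * of_bool (\<alpha> i = l))"
      unfolding weight_vec_def by (intro sum.cong) auto
    also have "\<dots> = (\<Sum>i\<in>{1..d}. \<Sum>l<n i. h (i, l) * of_bool (\<alpha> i = l))"
      by (rule sum.Sigma[symmetric]) auto
    also have "\<dots> = (\<Sum>i\<in>{1..d}. h (i, \<alpha> i))"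
    proof (intro sum.cong refl)
      fix i assume "i \<in> {1..d}"
      then have "\<alpha> i < n i" using multi_indices_less[OF \<open>\<alpha> \<in> multi_indices d n\<close>] by simp
      have "(\<Sum>l<n i. h (i, l) * of_bool (\<alpha> i = l)) = (\<Sum>l<n i. if l = \<alpha> i then h (i, \<alpha> i) else 0)"
        by (intro sum.cong) auto
      then show "(\<Sum>l<n i. h (i, l) * of_bool (\<alpha> i = l)) = h (i, \<alpha> i)" using \<open>\<alpha> i < n i\<close> by simp
    qed
    finally show ?thesis using hS[OF that] by simp
  qed
  define D where "D = (\<bar>c\<bar> + (\<Sum>i\<in>{1..d}. \<Sum>l<n i. \<bar>h (i, l)\<bar>)) * card (multi_indices d n)"
  have "D \<ge> 0" unfolding D_def by (intro mult_nonneg_nonneg add_nonneg_nonneg sum_nonneg) auto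
  \<comment> \<open>Makes the error bound smaller than the gap; the summand 1 allows
    \<open>D = 0\<close>.\<close>
  define \<epsilon> where "\<epsilon> = sqrt ((c - m) / (D + 1))"
  have \<epsilon>: "0 < \<epsilon>" "\<epsilon>\<^sup>2 = (c - m) / (D + 1)" unfolding \<epsilon>_def using m \<open>D \<ge> 0\<close> by simp_all
  obtain U s where U: "borel_coords d n U"
    and "\<forall>\<alpha>\<in>multi_indices d n. cmod (s * kron d n U X \<alpha> - Y \<alpha>) \<le> \<epsilon>"
    using approx[OF \<epsilon>(1)] by blast
  note close = this(2)[rule_format]
  have "c - m \<le> D * \<epsilon>\<^sup>2" unfolding m_def D_def mult.assoc
    by (rule functional_le_of_approx[where U = U and s = s and X = X and Y = Y])
       (fact Y marg mono U close hS')+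
  then have "(c - m) * (D + 1) \<le> D * (c - m)" unfolding \<epsilon>(2) using \<open>D \<ge> 0\<close> by (simp add: pos_le_divide_eq)
  then show False using m by (simp add: algebra_simps)
qed

section \<open>Degenerations of sequences of triangular matrices\<close>

text \<open>Rows may only receive multiples of earlier rows, so they cannot be exchanged. Among the
  admissible combinations for row \<open>a\<close>, one is taken whose first nonzero column
  \<open>\<kappa> a\<close> is as far right as possible. If two rows shared this column, subtracting
  a multiple of the earlier from the later one would move the latter further right.\<close>

lemma echelon_exists:
  fixes c :: "nat \<Rightarrow> nat \<Rightarrow> complex"
  assumes indep: "\<forall>x. (\<exists>a<n. x a \<noteq> 0) \<longrightarrow> (\<exists>l<n. (\<Sum>b<n. x b * c b l) \<noteq> 0)"
  shows "\<exists>q \<kappa>. bij_betw \<kappa> {..<n} {..<n} \<and> (\<forall>a b. a < b \<longrightarrow> q a b = 0) \<and>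
    (\<forall>a<n. (\<Sum>b<n. q a b * c b (\<kappa> a)) \<noteq> 0) \<and>
    (\<forall>a<n. \<forall>l<\<kappa> a. (\<Sum>b<n. q a b * c b l) = 0)"
proof -
  define row where "row x l = (\<Sum>b<n. x b * c b l)" for x l
  define P where "P a k x \<longleftrightarrow> k < n \<and> x a = 1 \<and> (\<forall>b>a. x b = 0) \<and> (\<forall>l<k. row x l = 0) \<and> row x k \<noteq> 0"
    for a k and x :: "nat \<Rightarrow> complex"
  have lead: "\<exists>k. P a k x" if "a < n" "x a = 1" "\<forall>b>a. x b = 0" for a x
  proof -
    have "\<exists>a<n. x a \<noteq> 0" using that by (intro exI[of _ a]) simp
    then have ex: "\<exists>l. l < n \<and> row x l \<noteq> 0" using indep unfolding row_def by blast
    define k where "k = (LEAST l. l < n \<and> row x l \<noteq> 0)"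
    have "k < n" "row x k \<noteq> 0" using LeastI_ex[OF ex] unfolding k_def by auto
    moreover have "row x l = 0" if "l < k" for l
      using not_less_Least[of l "\<lambda>l. l < n \<and> row x l \<noteq> 0"] that \<open>k < n\<close> unfolding k_def by auto
    ultimately show ?thesis unfolding P_def using that by blast
  qed
  have "\<exists>kx. P a (fst kx) (snd kx) \<and> (\<forall>k' x'. P a k' x' \<longrightarrow> k' \<le> fst kx)" if "a < n" for a
  proof -
    define S where "S = {k. \<exists>x. P a k x}"
    have "finite S" unfolding S_def P_def by (rule finite_subset[of _ "{..<n}"]) auto
    moreover have "S \<noteq> {}" using lead[of a "\<lambda>b. of_bool (b = a)"] that unfolding S_def by auto
    ultimately have "Max S \<in> S" "\<And>k. k \<in> S \<Longrightarrow> k \<le> Max S" by auto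
    moreover obtain x where "P a (Max S) x" using \<open>Max S \<in> S\<close> unfolding S_def by blast
    ultimately show ?thesis unfolding S_def by (intro exI[of _ "(Max S, x)"]) (auto simp: S_def)
  qed
  then obtain kx where kx: "\<And>a. a < n \<Longrightarrow> P a (fst (kx a)) (snd (kx a))"
    "\<And>a k' x'. a < n \<Longrightarrow> P a k' x' \<Longrightarrow> k' \<le> fst (kx a)" by metis
  define \<kappa> where "\<kappa> a = fst (kx a)" for a
  define q where "q a b = (if a < b then 0 else snd (kx a) b)" for a b
  have qa: "q a = snd (kx a)" if "a < n" for a
    using kx(1)[OF that] unfolding q_def P_def by auto
  have ne: "\<kappa> a \<noteq> \<kappa> a'" if aa: "a < a'" "a' < n" for a a'
  proof
    assume eq: "\<kappa> a = \<kappa> a'"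
    have Pa: "P a (\<kappa> a) (q a)" and Pa': "P a' (\<kappa> a) (q a')"
      using kx(1)[of a] kx(1)[of a'] aa eq unfolding \<kappa>_def by (simp_all add: qa)
    define w where "w = row (q a') (\<kappa> a) / row (q a) (\<kappa> a)"
    define x where "x b = q a' b - w * q a b" for b
    have row: "row x l = row (q a') l - w * row (q a) l" for l
      unfolding row_def x_def by (simp add: left_diff_distrib sum_subtractf sum_distrib_left mult.assoc)
    have "row x l = 0" if "l \<le> \<kappa> a" for l
      using that Pa Pa' unfolding row w_def P_def by (cases "l = \<kappa> a") auto
    moreover have "x a' = 1" "\<forall>b>a'. x b = 0" using Pa Pa' aa unfolding x_def P_def by auto
    then obtain k where k: "P a' k x" using lead[of a' x] aa by blast
    ultimately have "\<kappa> a < k" unfolding P_def by (meson not_le)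
    moreover have "k \<le> \<kappa> a'" using kx(2)[OF aa(2) k] unfolding \<kappa>_def .
    ultimately show False using eq by simp
  qed
  have "inj_on \<kappa> {..<n}"
    using ne by (intro inj_onI) (metis lessThan_iff linorder_neqE_nat)
  moreover have "\<kappa> ` {..<n} \<subseteq> {..<n}" using kx(1) unfolding \<kappa>_def P_def by auto
  ultimately have bij: "bij_betw \<kappa> {..<n} {..<n}" unfolding bij_betw_def by (simp add: endo_inj_surj)
  show ?thesis
  proof (intro exI[of _ q] exI[of _ \<kappa>] conjI allI impI bij)
    show "q a b = 0" if "a < b" for a b using that unfolding q_def by simp
    show "(\<Sum>b<n. q a b * c b (\<kappa> a)) \<noteq> 0" if "a < n" for a
      using kx(1)[OF that] qa[OF that] unfolding P_def \<kappa>_def row_def by auto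
    show "(\<Sum>b<n. q a b * c b l) = 0" if "a < n" "l < \<kappa> a" for a l
      using kx(1)[OF that(1)] qa[OF that(1)] that(2) unfolding P_def \<kappa>_def row_def by auto
  qed
qed

section \<open>Leading minors of products with a triangular matrix\<close>

definition leading_minor :: "nat \<Rightarrow> (nat \<Rightarrow> nat \<Rightarrow> complex) \<Rightarrow> complex" where
  "leading_minor k A = Determinant.det (Matrix.mat k k (\<lambda>(i, j). A i j))"

lemma leading_minor_leibniz:
  "leading_minor k A = (\<Sum>\<pi> | \<pi> permutes {0..<k}. of_int (sign \<pi>) * (\<Prod>i = 0..<k. A i (\<pi> i)))"
proof -
  have "leading_minor k A = (\<Sum>\<pi> | \<pi> permutes {0..<k}. of_int (sign \<pi>) *
      (\<Prod>i = 0..<k. Matrix.mat k k (\<lambda>(i, j). A i j) $$ (i, \<pi> i)))"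
    unfolding leading_minor_def by (rule det_def') simp
  also have "\<dots> = (\<Sum>\<pi> | \<pi> permutes {0..<k}. of_int (sign \<pi>) * (\<Prod>i = 0..<k. A i (\<pi> i)))"
  proof (intro sum.cong refl arg_cong2[of _ _ _ _ "(*)"] prod.cong)
    fix \<pi> i assume "\<pi> \<in> {\<pi>. \<pi> permutes {0..<k}}" "i \<in> {0..<k}"
    then have "\<pi> i < k" "i < k" using permutes_in_image[of \<pi> "{0..<k}" i] by auto
    then show "Matrix.mat k k (\<lambda>(i, j). A i j) $$ (i, \<pi> i) = A i (\<pi> i)" by simp
  qed
  finally show ?thesis .
qed

lemma leading_minor_bound:
  assumes "\<And>i j. i < k \<Longrightarrow> j < k \<Longrightarrow> cmod (A i j) \<le> C"
  shows "cmod (leading_minor k A) \<le> fact k * C ^ k"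
proof -
  have "cmod (leading_minor k A) \<le> (\<Sum>\<pi> | \<pi> permutes {0..<k}. cmod (of_int (sign \<pi>) * (\<Prod>i = 0..<k. A i (\<pi> i))))"
    unfolding leading_minor_leibniz by (rule norm_sum)
  also have "\<dots> \<le> (\<Sum>\<pi> | \<pi> permutes {0..<k}. C ^ k)"
  proof (rule sum_mono)
    fix \<pi> assume "\<pi> \<in> {\<pi>. \<pi> permutes {0..<k}}"
    then have \<pi>: "\<pi> i < k" if "i < k" for i using permutes_in_image[of \<pi> "{0..<k}" i] that by auto
    have "cmod (of_int (sign \<pi>) * (\<Prod>i = 0..<k. A i (\<pi> i))) = (\<Prod>i = 0..<k. cmod (A i (\<pi> i)))"
      by (simp add: norm_mult prod_norm sign_def)
    also have "\<dots> \<le> (\<Prod>i = 0..<k. C)" using assms \<pi> by (intro prod_mono) auto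
    finally show "cmod (of_int (sign \<pi>) * (\<Prod>i = 0..<k. A i (\<pi> i))) \<le> C ^ k" by simp
  qed
  also have "\<dots> = fact k * C ^ k" by (simp add: card_permutations[of "{0..<k}" k])
  finally show ?thesis .
qed

lemma leading_minor_row_scale:
  "leading_minor k (\<lambda>i j. t i * A i j) = (\<Prod>i<k. t i) * leading_minor k A"
  unfolding leading_minor_leibniz sum_distrib_left
  by (intro sum.cong refl) (simp add: prod.distrib lessThan_atLeast0 mult_ac)

lemma leading_minor_tendsto:
  assumes "\<And>i j. i < k \<Longrightarrow> j < k \<Longrightarrow> (\<lambda>m. A m i j) \<longlonglongrightarrow> L i j"
  shows "(\<lambda>m. leading_minor k (A m)) \<longlonglongrightarrow> leading_minor k L"
  unfolding leading_minor_leibniz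
proof (intro tendsto_sum tendsto_mult tendsto_const tendsto_prod)
  fix \<pi> i assume "\<pi> \<in> {\<pi>. \<pi> permutes {0..<k}}" "i \<in> {0..<k}"
  then show "(\<lambda>m. A m i (\<pi> i)) \<longlonglongrightarrow> L i (\<pi> i)"
    using permutes_in_image[of \<pi> "{0..<k}" i] by (intro assms) auto
qed

lemma leading_minor_upper:
  assumes "\<And>i j. i < k \<Longrightarrow> j < i \<Longrightarrow> A i j = 0"
  shows "leading_minor k A = (\<Prod>i<k. A i i)"
proof -
  let ?M = "Matrix.mat k k (\<lambda>(i, j). A i j)"
  have "leading_minor k A = prod_list (diag_mat ?M)" unfolding leading_minor_def
    by (rule det_upper_triangular) (use assms in auto)
  also have "diag_mat ?M = map (\<lambda>i. A i i) [0..<k]" unfolding diag_mat_def by (intro map_cong) auto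
  also have "prod_list \<dots> = (\<Prod>i\<in>set [0..<k]. A i i)" by (intro prod.distinct_set_conv_list[symmetric]) simp
  finally show ?thesis by (simp add: lessThan_atLeast0)
qed

lemma leading_minor_mult:
  "leading_minor k (\<lambda>i j. \<Sum>l<k. A i l * B l j) = leading_minor k A * leading_minor k B"
proof -
  have "Matrix.mat k k (\<lambda>(i, j). \<Sum>l<k. A i l * B l j) = Matrix.mat k k (\<lambda>(i, j). A i j) * Matrix.mat k k (\<lambda>(i, j). B i j)"
    by (rule eq_matI) (auto simp: scalar_prod_def lessThan_atLeast0)
  then show ?thesis unfolding leading_minor_def by (simp add: det_mult[of _ k])
qed

lemma leading_minor_cong:
  assumes "\<And>i j. i < k \<Longrightarrow> j < k \<Longrightarrow> A i j = B i j"
  shows "leading_minor k A = leading_minor k B"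
  unfolding leading_minor_def by (intro arg_cong[of _ _ Determinant.det] eq_matI) (use assms in auto)

text \<open>An upper triangular right factor combines the first \<open>k\<close> columns only among
  themselves, so leading blocks multiply for every left factor \<open>A\<close>. This recovers the
  diagonal of a triangular matrix after a bounded but not triangular multiplication from the
  left.\<close>

lemma leading_minor_mult_upper:
  assumes upper: "\<And>i j. i < n \<Longrightarrow> j < i \<Longrightarrow> B i j = 0" and "k \<le> n"
  shows "leading_minor k (\<lambda>i j. \<Sum>l<n. A i l * B l j) = leading_minor k A * (\<Prod>i<k. B i i)"
proof -
  have "(\<Sum>l<n. A i l * B l j) = (\<Sum>l<k. A i l * B l j)" if "j < k" for i j
    using \<open>k \<le> n\<close> upper that by (intro sum.mono_neutral_right) auto
  then have "leading_minor k (\<lambda>i j. \<Sum>l<n. A i l * B l j) = leading_minor k (\<lambda>i j. \<Sum>l<k. A i l * B l j)"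
    by (intro leading_minor_cong) simp
  also have "\<dots> = leading_minor k A * leading_minor k B" by (rule leading_minor_mult)
  also have "leading_minor k B = (\<Prod>i<k. B i i)"
    by (rule leading_minor_upper) (use upper \<open>k \<le> n\<close> in auto)
  finally show ?thesis .
qed

text \<open>Comparing logarithms of leading minors yields upper bounds for the head sums and a lower
  bound for the total. Adding \<open>2 * C\<close> at the last index and removing
  \<open>L + 2 * C\<close> at index 0 makes the total 0 and the tails nonnegative, so that summation
  by parts applies.\<close>

lemma sum_mono_weights_bound:
  fixes x p :: "nat \<Rightarrow> real"
  assumes mono: "\<And>i j. i \<le> j \<Longrightarrow> j < n \<Longrightarrow> p i \<le> p j" and p01: "\<And>i. i < n \<Longrightarrow> 0 \<le> p i \<and> p i \<le> 1"
    and head: "\<And>k. k \<le> n \<Longrightarrow> (\<Sum>i<k. x i) \<le> C" and total: "- C \<le> (\<Sum>i<n. x i)" and "0 \<le> C"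
  shows "- 2 * C \<le> (\<Sum>i<n. p i * x i)"
proof (cases "n = 0")
  case True
  then show ?thesis using \<open>0 \<le> C\<close> by simp
next
  case False
  define L where "L = (\<Sum>i<n. x i)"
  define z where "z i = x i + 2 * C * of_bool (i = n - 1) - (L + 2 * C) * of_bool (i = 0)" for i
  have one: "(\<Sum>i\<in>A. u i * of_bool (i = a)) = u a" if "a \<in> A" "finite A" for A a and u :: "nat \<Rightarrow> real"
  proof -
    have "(\<Sum>i\<in>A. u i * of_bool (i = a)) = (\<Sum>i\<in>A. if i = a then u a else 0)" by (intro sum.cong) auto
    then show ?thesis using that by simp
  qed
  have zsum: "(\<Sum>i\<in>A. u i * z i) = (\<Sum>i\<in>A. u i * x i) + 2 * C * (\<Sum>i\<in>A. u i * of_bool (i = n - 1))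
      - (L + 2 * C) * (\<Sum>i\<in>A. u i * of_bool (i = 0))" for A and u :: "nat \<Rightarrow> real"
    unfolding z_def by (simp add: sum.distrib sum_subtractf sum_distrib_left algebra_simps)
  have tot: "(\<Sum>i<n. z i) = 0"
    using zsum[of "\<lambda>_. 1" "{..<n}"] one[of "n - 1" "{..<n}" "\<lambda>_. 1"] one[of 0 "{..<n}" "\<lambda>_. 1"] False
    unfolding L_def by simp
  have tail: "0 \<le> (\<Sum>i\<in>{j..<n}. z i)" if "j < n" for j
  proof (cases "j = 0")
    case True
    then show ?thesis using tot by (simp add: lessThan_atLeast0)
  next
    case False
    have "(\<Sum>i\<in>{j..<n}. z i) = (\<Sum>i\<in>{j..<n}. x i) + 2 * C - (L + 2 * C) * (\<Sum>i\<in>{j..<n}. of_bool (i = 0))"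
      using zsum[of "\<lambda>_. 1" "{j..<n}"] one[of "n - 1" "{j..<n}" "\<lambda>_. 1"] that by simp
    also have "(\<Sum>i\<in>{j..<n}. of_bool (i = 0) :: real) = 0" using False by (intro sum.neutral) auto
    finally have eq: "(\<Sum>i\<in>{j..<n}. z i) = (\<Sum>i\<in>{j..<n}. x i) + 2 * C" by simp
    have "(\<Sum>i<j. x i) + (\<Sum>i\<in>{j..<n}. x i) = L"
      unfolding L_def lessThan_atLeast0 by (rule sum.atLeastLessThan_concat) (use that in simp_all)
    then show ?thesis unfolding eq using head[of j] total that unfolding L_def by simp
  qed
  have "0 \<le> (\<Sum>i<n. p i * z i)" by (rule sum_mult_mono_nonneg[OF mono tail tot])
  also have "\<dots> = (\<Sum>i<n. p i * x i) + 2 * C * p (n - 1) - (L + 2 * C) * p 0"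
    unfolding zsum using one[of "n - 1" "{..<n}" p] one[of 0 "{..<n}" p] False by simp
  \<comment> \<open>The correction at the last index costs at most \<open>2 * C\<close> because
    \<open>p \<le> 1\<close>, and the one at index 0 has the favourable sign.\<close>
  also have "\<dots> \<le> (\<Sum>i<n. p i * x i) + 2 * C"
  proof -
    have "2 * C * p (n - 1) \<le> 2 * C" using p01[of "n - 1"] False \<open>0 \<le> C\<close> by (simp add: mult_left_le)
    moreover have "0 \<le> (L + 2 * C) * p 0" using p01[of 0] total False \<open>0 \<le> C\<close> unfolding L_def by simp
    ultimately show ?thesis by simp
  qed
  finally show ?thesis by simp
qed

section \<open>QR decomposition with column pivoting, and its limits\<close>

definition pivot :: "nat \<Rightarrow> (nat \<Rightarrow> nat \<Rightarrow> complex) \<Rightarrow> (nat \<Rightarrow> nat) \<Rightarrow> (nat \<Rightarrow> nat \<Rightarrow> complex) \<Rightarrow> nat \<Rightarrow> real" where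
  "pivot n b \<sigma> K a = Re (inner_prod n (K a) (\<lambda>i. b i (\<sigma> a)))"

definition normalized_row :: "nat \<Rightarrow> (nat \<Rightarrow> nat \<Rightarrow> complex) \<Rightarrow> (nat \<Rightarrow> nat) \<Rightarrow> (nat \<Rightarrow> nat \<Rightarrow> complex) \<Rightarrow>
    nat \<Rightarrow> nat \<Rightarrow> complex" where
  "normalized_row n b \<sigma> K a l = inner_prod n (K a) (\<lambda>i. b i l) / of_real (pivot n b \<sigma> K a)"

text \<open>The priority is the residual itself. The residual of a chosen column is its squared
  pivot, because the column has no components beyond the diagonal; greediness makes it bound the
  later residuals. Hence the pivots decrease, and a row divided by its pivot has entries of modulus
  at most 1.\<close>

lemma pivoted_qr:
  assumes basis: "adapted_basis n (\<lambda>_ x. x) (\<lambda>l a. b a l) \<sigma> K"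
  shows "a < n \<Longrightarrow> 0 < pivot n b \<sigma> K a"
    and "a < n \<Longrightarrow> inner_prod n (K a) (\<lambda>i. b i l) = of_real (pivot n b \<sigma> K a) * normalized_row n b \<sigma> K a l"
    and "a < n \<Longrightarrow> l < n \<Longrightarrow> cmod (normalized_row n b \<sigma> K a l) \<le> 1"
    and "a < n \<Longrightarrow> normalized_row n b \<sigma> K a (\<sigma> a) = 1"
    and "a < n \<Longrightarrow> a' < a \<Longrightarrow> normalized_row n b \<sigma> K a (\<sigma> a') = 0"
    and "a \<le> a' \<Longrightarrow> a' < n \<Longrightarrow> pivot n b \<sigma> K a' \<le> pivot n b \<sigma> K a"
    and "a < n \<Longrightarrow> i < n \<Longrightarrow> cmod (K a i) \<le> 1"
proof -
  note bij = adapted_basisD(1)[OF basis] and orth = adapted_basisD(2)[OF basis]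
    and tri = adapted_basisD(3)[OF basis] and greedy = adapted_basisD(5)[OF basis]
  let ?R = "\<lambda>a l. inner_prod n (K a) (\<lambda>i. b i l)" and ?t = "pivot n b \<sigma> K"
  have inj: "inj_on \<sigma> {..<n}" and img: "\<sigma> ` {..<n} = {..<n}" using bij by (auto simp: bij_betw_def)
  have t: "0 < ?t a \<and> ?R a (\<sigma> a) = of_real (?t a)" if a: "a < n" for a
    using adapted_basisD(4)[OF basis a] unfolding pivot_def by auto
  have R: "?R a l = of_real (?t a) * normalized_row n b \<sigma> K a l" if "a < n" for a l
    using t[OF that] unfolding normalized_row_def by simp
  have tail: "(\<Sum>c\<in>{a..<n}. (cmod (?R c (\<sigma> a)))\<^sup>2) = (?t a)\<^sup>2" if a: "a < n" for a
  proof -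
    have "(\<Sum>c\<in>{a..<n}. (cmod (?R c (\<sigma> a)))\<^sup>2) = (\<Sum>c\<in>{a}. (cmod (?R c (\<sigma> a)))\<^sup>2)"
      using a tri by (intro sum.mono_neutral_right) auto
    then show ?thesis using t[OF a] by simp
  qed
  have le: "(cmod (?R c l))\<^sup>2 \<le> (?t a)\<^sup>2" if "a \<le> c" "c < n" "l < n" "l \<notin> \<sigma> ` {..<a}" for a c l
  proof -
    have "(cmod (?R c l))\<^sup>2 \<le> (\<Sum>c\<in>{a..<n}. (cmod (?R c l))\<^sup>2)"
      using that by (intro member_le_sum) auto
    also have "\<dots> \<le> (\<Sum>c\<in>{a..<n}. (cmod (?R c (\<sigma> a)))\<^sup>2)" using greedy[of a l] that by simp
    also have "\<dots> = (?t a)\<^sup>2" using tail that by simp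
    finally show ?thesis .
  qed
  show 1: "0 < ?t a" if "a < n" for a using t[OF that] by blast
  show "?R a l = of_real (?t a) * normalized_row n b \<sigma> K a l" if "a < n" for a l by (rule R[OF that])
  show "cmod (normalized_row n b \<sigma> K a l) \<le> 1" if "a < n" "l < n" for a l
  proof (cases "l \<in> \<sigma> ` {..<a}")
    case True
    then show ?thesis using tri[OF that(1)] unfolding normalized_row_def by auto
  next
    case False
    then have "cmod (?R a l) \<le> ?t a" using le[of a a l] 1[of a] that by (simp add: power2_le_iff_abs_le)
    then show ?thesis using 1[of a] that unfolding normalized_row_def by (simp add: norm_divide)
  qed
  show "normalized_row n b \<sigma> K a (\<sigma> a) = 1" if "a < n" for a
    using t[OF that] unfolding normalized_row_def by simp
  show "normalized_row n b \<sigma> K a (\<sigma> a') = 0" if "a < n" "a' < a" for a a'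
    using tri[OF that] unfolding normalized_row_def by simp
  show "?t a' \<le> ?t a" if "a \<le> a'" "a' < n" for a a'
  proof -
    have "\<sigma> a' \<notin> \<sigma> ` {..<a}" using inj that by (auto dest: inj_onD)
    moreover have "\<sigma> a' < n" using img that by blast
    ultimately have "(cmod (?R a' (\<sigma> a')))\<^sup>2 \<le> (?t a)\<^sup>2" using le[of a a' "\<sigma> a'"] that by simp
    then show ?thesis using t[of a'] t[of a] that by (simp add: power2_le_iff_abs_le)
  qed
  show "cmod (K a i) \<le> 1" if "a < n" "i < n" for a i
  proof -
    have "(cmod (K a i))\<^sup>2 \<le> (\<Sum>i<n. (cmod (K a i))\<^sup>2)" using that by (intro member_le_sum) auto
    also have "\<dots> = 1"
      using inner_prod_self[of n "K a"] orth[OF that(1) that(1)] by (metis of_real_eq_1_iff of_bool_eq(2))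
    finally show ?thesis by (simp add: power2_le_iff_abs_le[of 1 _, simplified] abs_square_le_1)
  qed
qed

text \<open>In matrix form, \<open>M m\<close> times \<open>b m\<close> is \<open>e m\<close> with
  its rows scaled by \<open>t m\<close>, where \<open>M m\<close> is bounded and \<open>e m\<close>
  converges to the invertible triangular \<open>E\<close>; \<open>M m\<close> itself is in general
  not triangular. The last clause bounds the loss in the character by a constant that serves all
  admissible exponents \<open>p\<close>.\<close>

definition flag_limit :: "nat \<Rightarrow> (nat \<Rightarrow> nat \<Rightarrow> nat \<Rightarrow> complex) \<Rightarrow> (nat \<Rightarrow> nat \<Rightarrow> nat \<Rightarrow> complex) \<Rightarrow>
    (nat \<Rightarrow> nat \<Rightarrow> complex) \<Rightarrow> (nat \<Rightarrow> nat \<Rightarrow> real) \<Rightarrow> (nat \<Rightarrow> nat \<Rightarrow> nat \<Rightarrow> complex) \<Rightarrow> real \<Rightarrow> real \<Rightarrow> bool" where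
  "flag_limit n b e E t M C B \<longleftrightarrow>
    (\<forall>j<n. E j j \<noteq> 0 \<and> (\<forall>l<j. E j l = 0)) \<and>
    (\<forall>j<n. \<forall>l<n. (\<lambda>m. e m j l) \<longlonglongrightarrow> E j l) \<and>
    (\<forall>m. \<forall>j<n. 0 < t m j) \<and>
    (\<forall>m. \<forall>j<n. \<forall>k<n. cmod (M m j k) \<le> C) \<and>
    (\<forall>m. \<forall>j<n. \<forall>l<n. of_real (t m j) * e m j l = (\<Sum>k<n. M m j k * b m k l)) \<and>
    (\<forall>p. (\<forall>i j. i \<le> j \<longrightarrow> j < n \<longrightarrow> p i \<le> p j) \<longrightarrow> (\<forall>j<n. 0 \<le> p j \<and> p j \<le> 1) \<longrightarrow>
      (\<forall>\<^sub>F m in sequentially. (\<Sum>j<n. p j * ln (cmod (b m j j))) \<le> (\<Sum>j<n. p j * ln (t m j)) + B))"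

text \<open>The pivoted QR decomposition turns \<open>b m\<close>, up to a bounded factor on the left, into a
  diagonal matrix with decreasing entries times a convergent matrix with invertible limit.
  Adding to each row multiples of earlier rows, which have larger pivots, is again a bounded
  operation, so that the limit may be assumed to be a row permutation of a triangular matrix.\<close>

lemma flag_limit_exists:
  fixes b :: "nat \<Rightarrow> nat \<Rightarrow> nat \<Rightarrow> complex"
  assumes b: "\<And>m. \<forall>a<n. b m a a \<noteq> 0 \<and> (\<forall>l<a. b m a l = 0)"
    and basis: "\<And>m. adapted_basis n (\<lambda>_ x. x) (\<lambda>l a. b m a l) (\<sigma> m) (K m)"
    and const: "\<And>m a. a < n \<Longrightarrow> \<sigma> m a = s a"
    and lim: "\<And>a l. a < n \<Longrightarrow> l < n \<Longrightarrow> (\<lambda>m. normalized_row n (b m) (\<sigma> m) (K m) a l) \<longlonglongrightarrow> c a l"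
  shows "\<exists>e E t M C B. flag_limit n b e E t M C B"
proof -
  let ?c = "\<lambda>m. normalized_row n (b m) (\<sigma> m) (K m)" and ?t = "\<lambda>m. pivot n (b m) (\<sigma> m) (K m)"
  note qr = pivoted_qr[OF basis]
  have s: "s a < n" if "a < n" for a
    using bij_betwE[OF adapted_basisD(1)[OF basis, of 0]] const[OF that, of 0] that by force
  have c1: "c a (s a) = 1" if "a < n" for a
    using LIMSEQ_unique[OF lim[OF that s[OF that]], of 1] qr(4)[OF that] const[OF that] by simp
  have c0: "c a (s a') = 0" if "a < n" "a' < a" for a a'
  proof -
    have "a' < n" using that by simp
    then show ?thesis
      using LIMSEQ_unique[OF lim[OF that(1) s[OF \<open>a' < n\<close>]], of 0] qr(5)[OF that] const[OF \<open>a' < n\<close>] by simp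
  qed
  have indep: "\<exists>l<n. (\<Sum>a<n. x a * c a l) \<noteq> 0" if ex: "\<exists>a<n. x a \<noteq> 0" for x
  proof -
    define j where "j = (LEAST a. a < n \<and> x a \<noteq> 0)"
    have j: "j < n" "x j \<noteq> 0" using LeastI_ex[OF ex] unfolding j_def by auto
    have small: "x a = 0" if "a < j" for a
      using not_less_Least[of a "\<lambda>a. a < n \<and> x a \<noteq> 0"] that j(1) unfolding j_def by auto
    have "(\<Sum>a<n. x a * c a (s j)) = (\<Sum>a<n. if a = j then x j else 0)"
    proof (intro sum.cong refl)
      fix a assume "a \<in> {..<n}"
      then show "x a * c a (s j) = (if a = j then x j else 0)"
        using small c0[of a j] c1 j by (cases a j rule: linorder_cases) auto
    qed
    then have "(\<Sum>a<n. x a * c a (s j)) \<noteq> 0" using j by simp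
    then show ?thesis using s[OF j(1)] by blast
  qed
  obtain q \<kappa> where q\<kappa>: "bij_betw \<kappa> {..<n} {..<n} \<and> (\<forall>a b. a < b \<longrightarrow> q a b = 0) \<and>
    (\<forall>a<n. (\<Sum>b<n. q a b * c b (\<kappa> a)) \<noteq> 0) \<and>
    (\<forall>a<n. \<forall>l<\<kappa> a. (\<Sum>b<n. q a b * c b l) = 0)"
    using echelon_exists[of n c] indep by blast
  then have bij: "bij_betw \<kappa> {..<n} {..<n}" and q0: "\<And>a b. a < b \<Longrightarrow> q a b = 0"
    and lead: "\<And>a. a < n \<Longrightarrow> (\<Sum>b<n. q a b * c b (\<kappa> a)) \<noteq> 0"
    and zero: "\<And>a l. a < n \<Longrightarrow> l < \<kappa> a \<Longrightarrow> (\<Sum>b<n. q a b * c b l) = 0"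
    by simp_all
  \<comment> \<open>Sorting the reduced rows by their leading columns makes the limit itself upper
    triangular.\<close>
  define \<mu> where "\<mu> = inv_into {..<n} \<kappa>"
  have \<mu>bij: "bij_betw \<mu> {..<n} {..<n}" unfolding \<mu>_def by (rule bij_betw_inv_into[OF bij])
  have \<mu>n: "\<mu> j < n" if "j < n" for j using \<mu>bij that unfolding bij_betw_def by blast
  have \<kappa>\<mu>: "\<kappa> (\<mu> j) = j" if "j < n" for j
    unfolding \<mu>_def using bij that by (intro f_inv_into_f) (simp add: bij_betw_def)
  define e where "e m j l = (\<Sum>a<n. q (\<mu> j) a * ?c m a l)" for m j l
  define E where "E j l = (\<Sum>a<n. q (\<mu> j) a * c a l)" for j l
  define t where "t m j = ?t m (\<mu> j)" for m j
  \<comment> \<open>The matrix \<open>q\<close> conjugated by the diagonal matrix of pivots, times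
    the conjugate transpose of the unitary factor, with rows sorted by \<open>\<mu>\<close>.\<close>
  define M where "M m j k = (\<Sum>a<n. q (\<mu> j) a * of_real (?t m (\<mu> j) / ?t m a) * cnj (K m a k))" for m j k
  define C where "C = 1 + (\<Sum>j<n. \<Sum>a<n. cmod (q j a))"
  have "1 \<le> C" unfolding C_def by (simp add: sum_nonneg)
  have Eupper: "E j l = 0" if "j < n" "l < j" for j l
    using zero[OF \<mu>n[OF that(1)], of l] that \<kappa>\<mu> unfolding E_def by simp
  have Ediag: "E j j \<noteq> 0" if "j < n" for j
    using lead[OF \<mu>n[OF that]] \<kappa>\<mu>[OF that] unfolding E_def by simp
  have e_lim: "(\<lambda>m. e m j l) \<longlonglongrightarrow> E j l" if "j < n" "l < n" for j l
    unfolding e_def E_def using lim that by (intro tendsto_intros) auto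
  have tpos: "0 < t m j" if "j < n" for m j unfolding t_def by (rule qr(1)[OF \<mu>n[OF that]])
  have Mbound: "cmod (M m j k) \<le> C" if "j < n" "k < n" for m j k
  proof -
    have "cmod (M m j k) \<le> (\<Sum>a<n. cmod (q (\<mu> j) a * of_real (?t m (\<mu> j) / ?t m a) * cnj (K m a k)))"
      unfolding M_def by (rule norm_sum)
    also have "\<dots> \<le> (\<Sum>a<n. cmod (q (\<mu> j) a))"
    proof (rule sum_mono)
      fix a assume "a \<in> {..<n}"
      then have a: "a < n" by simp
      show "cmod (q (\<mu> j) a * of_real (?t m (\<mu> j) / ?t m a) * cnj (K m a k)) \<le> cmod (q (\<mu> j) a)"
      \<comment> \<open>Only rows with \<open>a \<le> \<mu> j\<close> have a nonzero coefficient in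
        \<open>q\<close>; their pivots are at least as large, so the ratio is at most 1.\<close>
      proof (cases "\<mu> j < a")
        case True
        then show ?thesis using q0 by simp
      next
        case False
        then have "?t m (\<mu> j) \<le> ?t m a" using qr(6)[of a "\<mu> j" m] \<mu>n[OF that(1)] by simp
        moreover have "0 < ?t m (\<mu> j)" "0 < ?t m a" using qr(1) a \<mu>n[OF that(1)] by auto
        ultimately have "\<bar>?t m (\<mu> j) / ?t m a\<bar> \<le> 1" by simp
        then have "\<bar>?t m (\<mu> j) / ?t m a\<bar> * cmod (K m a k) \<le> 1"
          using qr(7)[OF a that(2), of m] by (intro mult_le_one) auto
        then have "cmod (q (\<mu> j) a) * (\<bar>?t m (\<mu> j) / ?t m a\<bar> * cmod (K m a k)) \<le> cmod (q (\<mu> j) a)"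
          by (intro mult_left_le) auto
        then show ?thesis by (simp only: norm_mult norm_of_real complex_mod_cnj mult.assoc)
      qed
    qed
    also have "\<dots> \<le> (\<Sum>j<n. \<Sum>a<n. cmod (q j a))"
      using \<mu>n[OF that(1)] by (intro member_le_sum[of "\<mu> j" "{..<n}" "\<lambda>j. \<Sum>a<n. cmod (q j a)"]) (auto simp: sum_nonneg)
    finally show ?thesis unfolding C_def by simp
  qed
  have eq: "of_real (t m j) * e m j l = (\<Sum>k<n. M m j k * b m k l)" if "j < n" "l < n" for m j l
  proof -
    have "(\<Sum>k<n. M m j k * b m k l) =
        (\<Sum>a<n. q (\<mu> j) a * of_real (?t m (\<mu> j) / ?t m a) * inner_prod n (K m a) (\<lambda>i. b m i l))"
      unfolding M_def inner_prod_def sum_distrib_right sum_distrib_left by (subst sum.swap) (simp add: mult_ac)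
    also have "\<dots> = (\<Sum>a<n. of_real (?t m (\<mu> j)) * (q (\<mu> j) a * ?c m a l))"
    proof (intro sum.cong refl)
      fix a assume "a \<in> {..<n}"
      then have a: "a < n" by simp
      have "of_real (?t m (\<mu> j) / ?t m a) * (of_real (?t m a) * ?c m a l) = of_real (?t m (\<mu> j)) * ?c m a l"
        using qr(1)[OF a, of m] by simp
      then show "q (\<mu> j) a * of_real (?t m (\<mu> j) / ?t m a) * inner_prod n (K m a) (\<lambda>i. b m i l) =
          of_real (?t m (\<mu> j)) * (q (\<mu> j) a * ?c m a l)"
        unfolding qr(2)[OF a] by (simp only: mult_ac)
    qed
    finally show ?thesis unfolding e_def t_def by (simp add: sum_distrib_left)
  qed
  have bdiag: "0 < cmod (b m j j)" if "j < n" for m j using b that by simp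
  have lnprod: "ln (\<Prod>j<k. x j) = (\<Sum>j<k. ln (x j))" if "\<And>j. j < k \<Longrightarrow> 0 < x j" for k and x :: "nat \<Rightarrow> real"
    by (rule ln_prod) (use that in force)+
  \<comment> \<open>The moduli of the leading minors of \<open>E\<close>, positive by triangularity;
    half of \<open>G k\<close> bounds the minors of \<open>e m\<close> from below for large
    \<open>m\<close>.\<close>
  define G where "G k = (\<Prod>j<k. cmod (E j j))" for k
  have Gpos: "0 < G k" if "k \<le> n" for k unfolding G_def using Ediag that by (intro prod_pos) auto
  have ev: "\<forall>\<^sub>F m in sequentially. G k / 2 < cmod (leading_minor k (e m))" if "k \<le> n" for k
  proof -
    have "(\<lambda>m. leading_minor k (e m)) \<longlonglongrightarrow> leading_minor k E"
      by (rule leading_minor_tendsto) (use e_lim that in auto)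
    also have "leading_minor k E = (\<Prod>j<k. E j j)"
      by (rule leading_minor_upper) (use Eupper that in auto)
    finally have "(\<lambda>m. cmod (leading_minor k (e m))) \<longlonglongrightarrow> G k"
      unfolding G_def prod_norm by (rule tendsto_norm)
    then show ?thesis by (rule order_tendstoD) (use Gpos[OF that] in simp)
  qed
  then have ev_all: "\<forall>\<^sub>F m in sequentially. \<forall>k\<in>{..n}. G k / 2 < cmod (leading_minor k (e m))"
    by (intro eventually_ball_finite) auto
  define L where "L k = ln (fact k * C ^ k / (G k / 2))" for k
  \<comment> \<open>Leading minors of both sides of \<open>eq\<close>. The minor of
    \<open>M m\<close> is bounded through Leibniz's formula, the one of \<open>e m\<close> is
    bounded away from 0.\<close>
  have head: "(\<Sum>j<k. ln (t m j) - ln (cmod (b m j j))) \<le> L k"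
    if k: "k \<le> n" and m: "G k / 2 < cmod (leading_minor k (e m))" for k m
  proof -
    have "leading_minor k (\<lambda>i j. of_real (t m i) * e m i j) = leading_minor k (\<lambda>i j. \<Sum>l<n. M m i l * b m l j)"
      by (rule leading_minor_cong) (use eq k in auto)
    then have "(\<Prod>j<k. of_real (t m j)) * leading_minor k (e m) = leading_minor k (M m) * (\<Prod>j<k. b m j j)"
      unfolding leading_minor_row_scale using leading_minor_mult_upper[of n "b m" k "M m"] b k by simp
    then have "cmod ((\<Prod>j<k. of_real (t m j)) * leading_minor k (e m)) = cmod (leading_minor k (M m) * (\<Prod>j<k. b m j j))"
      by (rule arg_cong)
    then have id: "(\<Prod>j<k. t m j) * cmod (leading_minor k (e m)) = cmod (leading_minor k (M m)) * (\<Prod>j<k. cmod (b m j j))"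
    proof -
      have "(\<Prod>j<k. \<bar>t m j\<bar>) = (\<Prod>j<k. t m j)" using tpos k by (intro prod.cong) (auto simp: less_imp_le)
      moreover assume "cmod ((\<Prod>j<k. of_real (t m j)) * leading_minor k (e m)) = cmod (leading_minor k (M m) * (\<Prod>j<k. b m j j))"
      ultimately show ?thesis by (simp add: norm_mult prod_norm[symmetric])
    qed
    have P: "0 < (\<Prod>j<k. t m j)" "0 < (\<Prod>j<k. cmod (b m j j))"
      using tpos bdiag k by (auto intro!: prod_pos)
    have "(\<Prod>j<k. t m j) * (G k / 2) \<le> (\<Prod>j<k. t m j) * cmod (leading_minor k (e m))"
      using m P by (intro mult_left_mono) auto
    also have "\<dots> \<le> (fact k * C ^ k) * (\<Prod>j<k. cmod (b m j j))" unfolding id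
      using leading_minor_bound[of k "M m" C] Mbound k P by (intro mult_right_mono) auto
    finally have "(\<Prod>j<k. t m j) / (\<Prod>j<k. cmod (b m j j)) \<le> fact k * C ^ k / (G k / 2)"
      using P Gpos[OF k] by (simp add: field_simps)
    then have "ln ((\<Prod>j<k. t m j) / (\<Prod>j<k. cmod (b m j j))) \<le> L k"
      unfolding L_def using P by (intro ln_mono) auto
    also have "ln ((\<Prod>j<k. t m j) / (\<Prod>j<k. cmod (b m j j))) = ln (\<Prod>j<k. t m j) - ln (\<Prod>j<k. cmod (b m j j))"
    proof -
      have "ln (x / y) = ln x - ln y" if "0 < x" "0 < y" for x y :: real using that by (simp add: ln_div)
      then show ?thesis using P by blast
    qed
    also have "\<dots> = (\<Sum>j<k. ln (t m j)) - (\<Sum>j<k. ln (cmod (b m j j)))"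
      using lnprod[of k "t m"] lnprod[of k "\<lambda>j. cmod (b m j j)"] tpos bdiag k by simp
    finally show ?thesis by (simp add: sum_subtractf)
  qed
  \<comment> \<open>The opposite bound for the full determinant, read off from the QR decomposition.
    The unitary factor and the normalised rows have entries of modulus at most 1, and Leibniz's
    formula gives \<open>fact n\<close> for each.\<close>
  have total: "- (2 * ln (fact n)) \<le> (\<Sum>j<n. ln (t m j) - ln (cmod (b m j j)))" for m
  proof -
    have "leading_minor n (b m) = leading_minor n (\<lambda>i l. \<Sum>a<n. K m a i * (of_real (?t m a) * ?c m a l))"
    proof (rule leading_minor_cong)
      fix i l assume il: "i < n" "l < n"
      have "b m i l = (\<Sum>a<n. inner_prod n (K m a) (\<lambda>i. b m i l) * K m a i)"
        using orthonormal_expand[OF adapted_basisD(2)[OF basis[of m]] il(1), of "\<lambda>i. b m i l"] by simp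
      also have "\<dots> = (\<Sum>a<n. K m a i * (of_real (?t m a) * ?c m a l))"
        by (intro sum.cong refl) (simp add: qr(2) mult_ac)
      finally show "b m i l = (\<Sum>a<n. K m a i * (of_real (?t m a) * ?c m a l))" .
    qed
    also have "\<dots> = leading_minor n (\<lambda>i a. K m a i) * ((\<Prod>a<n. of_real (?t m a)) * leading_minor n (?c m))"
      unfolding leading_minor_mult[of n "\<lambda>i a. K m a i"] leading_minor_row_scale ..
    also have "leading_minor n (b m) = (\<Prod>j<n. b m j j)" by (rule leading_minor_upper) (use b in auto)
    finally have "cmod (\<Prod>j<n. b m j j) =
        cmod (leading_minor n (\<lambda>i a. K m a i) * ((\<Prod>a<n. of_real (?t m a)) * leading_minor n (?c m)))"
      by (rule arg_cong)
    then have "(\<Prod>j<n. cmod (b m j j)) =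
        cmod (leading_minor n (\<lambda>i a. K m a i)) * ((\<Prod>a<n. ?t m a) * cmod (leading_minor n (?c m)))"
    proof -
      have "(\<Prod>j<n. \<bar>?t m j\<bar>) = (\<Prod>j<n. ?t m j)" using qr(1) by (intro prod.cong) (auto simp: less_imp_le)
      moreover assume "cmod (\<Prod>j<n. b m j j) =
        cmod (leading_minor n (\<lambda>i a. K m a i) * ((\<Prod>a<n. of_real (?t m a)) * leading_minor n (?c m)))"
      ultimately show ?thesis by (simp add: norm_mult prod_norm[symmetric])
    qed
    also have "\<dots> \<le> fact n * ((\<Prod>a<n. ?t m a) * fact n)"
      using leading_minor_bound[of n "\<lambda>i a. K m a i" 1] leading_minor_bound[of n "?c m" 1] qr(1,3,7)
      by (intro mult_mono mult_nonneg_nonneg prod_nonneg) (auto intro: less_imp_le)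
    also have "(\<Prod>a<n. ?t m a) = (\<Prod>j<n. t m j)"
      unfolding t_def using prod.reindex_bij_betw[OF \<mu>bij, of "?t m"] by simp
    finally have le: "(\<Prod>j<n. cmod (b m j j)) \<le> fact n * ((\<Prod>j<n. t m j) * fact n)" .
    have P: "0 < (\<Prod>j<n. t m j)" "0 < (\<Prod>j<n. cmod (b m j j))"
      using tpos bdiag by (auto intro!: prod_pos)
    have "ln (\<Prod>j<n. cmod (b m j j)) \<le> ln (fact n * ((\<Prod>j<n. t m j) * fact n))"
      using le P by (intro ln_mono) auto
    also have "\<dots> = 2 * ln (fact n) + ln (\<Prod>j<n. t m j)"
    proof -
      have "ln (fact n * (y * fact n)) = 2 * ln (fact n) + ln y" if "0 < y" for y :: real
        using that by (simp add: ln_mult)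
      then show ?thesis using P(1) by blast
    qed
    also have "ln (\<Prod>j<n. t m j) = (\<Sum>j<n. ln (t m j))" by (rule lnprod) (rule tpos)
    also have "ln (\<Prod>j<n. cmod (b m j j)) = (\<Sum>j<n. ln (cmod (b m j j)))" by (rule lnprod) (rule bdiag)
    finally show ?thesis by (simp add: sum_subtractf)
  qed
  define B where "B = (\<Sum>k\<le>n. \<bar>L k\<bar>) + 2 * ln (fact n)"
  have lnf: "0 \<le> ln (fact n :: real)" by (intro ln_ge_zero) simp
  have "0 \<le> B" unfolding B_def using lnf by (simp add: sum_nonneg)
  have final: "\<forall>\<^sub>F m in sequentially. (\<Sum>j<n. p j * ln (cmod (b m j j))) \<le> (\<Sum>j<n. p j * ln (t m j)) + 2 * B"
    if p: "\<forall>i j. i \<le> j \<longrightarrow> j < n \<longrightarrow> p i \<le> p j" "\<forall>j<n. 0 \<le> p j \<and> p j \<le> 1" for p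
    using ev_all
  proof eventually_elim
    case (elim m)
    have "- 2 * B \<le> (\<Sum>j<n. p j * (ln (t m j) - ln (cmod (b m j j))))"
    proof (rule sum_mono_weights_bound)
      show "(\<Sum>j<k. ln (t m j) - ln (cmod (b m j j))) \<le> B" if "k \<le> n" for k
      proof -
        have "L k \<le> \<bar>L k\<bar>" by simp
        also have "\<dots> \<le> (\<Sum>k\<le>n. \<bar>L k\<bar>)" using that by (intro member_le_sum) auto
        finally have "L k \<le> (\<Sum>k\<le>n. \<bar>L k\<bar>)" .
        moreover have "(\<Sum>j<k. ln (t m j) - ln (cmod (b m j j))) \<le> L k"
          by (rule head[OF that]) (use elim that in simp)
        ultimately show ?thesis using lnf unfolding B_def by linarith
      qed
      show "- B \<le> (\<Sum>j<n. ln (t m j) - ln (cmod (b m j j)))"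
      proof -
        have "0 \<le> (\<Sum>k\<le>n. \<bar>L k\<bar>)" by (intro sum_nonneg) simp
        then show ?thesis using total[of m] unfolding B_def by linarith
      qed
    qed (use p \<open>0 \<le> B\<close> in auto)
    then show ?case by (simp add: right_diff_distrib sum_subtractf)
  qed
  have "flag_limit n b e E t M C (2 * B)"
    unfolding flag_limit_def
    by (intro conjI allI impI) (use Ediag Eupper e_lim tpos Mbound eq final in simp_all)
  then show ?thesis by blast
qed

text \<open>For real exponents \<open>p\<close> only the modulus of a character makes sense; its
  logarithm is linear in \<open>p\<close> and additive on products of triangular matrices.\<close>

definition log_character :: "nat \<Rightarrow> (nat \<Rightarrow> nat) \<Rightarrow> (nat \<Rightarrow> nat \<Rightarrow> real) \<Rightarrow> (nat \<Rightarrow> nat \<Rightarrow> nat \<Rightarrow> complex) \<Rightarrow> real" where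
  "log_character d n p U = (\<Sum>i\<in>{1..d}. \<Sum>j<n i. p i j * ln (cmod (U i j j)))"

lemma flag_limitD:
  assumes "flag_limit n b e E t M C B"
  shows "\<And>j. j < n \<Longrightarrow> E j j \<noteq> 0" and "\<And>j l. j < n \<Longrightarrow> l < j \<Longrightarrow> E j l = 0"
    and "\<And>j l. j < n \<Longrightarrow> l < n \<Longrightarrow> (\<lambda>m. e m j l) \<longlonglongrightarrow> E j l"
    and "\<And>m j. j < n \<Longrightarrow> 0 < t m j"
    and "\<And>m j k. j < n \<Longrightarrow> k < n \<Longrightarrow> cmod (M m j k) \<le> C"
    and "\<And>m j l. j < n \<Longrightarrow> l < n \<Longrightarrow> of_real (t m j) * e m j l = (\<Sum>k<n. M m j k * b m k l)"
    and "\<And>p. \<forall>i j. i \<le> j \<longrightarrow> j < n \<longrightarrow> p i \<le> p j \<Longrightarrow> \<forall>j<n. 0 \<le> p j \<and> p j \<le> 1 \<Longrightarrow>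
      \<forall>\<^sub>F m in sequentially. (\<Sum>j<n. p j * ln (cmod (b m j j))) \<le> (\<Sum>j<n. p j * ln (t m j)) + B"
  using assms unfolding flag_limit_def by blast+

text \<open>The normalised rows lie in the unit disc and the permutations take finitely many values.
  Treating these values as further real coordinates, one subsequence makes everything converge; a
  convergent sequence of integers is eventually equal to its rounded limit, and an initial segment
  is dropped.\<close>

lemma convergent_pivot_subsequence:
  fixes d :: nat and n :: "nat \<Rightarrow> nat" and U :: "nat \<Rightarrow> nat \<Rightarrow> nat \<Rightarrow> nat \<Rightarrow> complex"
    and \<sigma> :: "nat \<Rightarrow> nat \<Rightarrow> nat \<Rightarrow> nat" and K :: "nat \<Rightarrow> nat \<Rightarrow> nat \<Rightarrow> nat \<Rightarrow> complex"
  assumes basis: "\<And>m i. i \<in> {1..d} \<Longrightarrow>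
    adapted_basis (n i) (\<lambda>_ x. x) (\<lambda>l a. U m i a l) (\<sigma> m i) (K m i)"
  shows "\<exists>r s c. strict_mono r \<and> (\<forall>i\<in>{1..d}. \<forall>a<n i.
    (\<forall>m. \<sigma> (r m) i a = s i a) \<and>
    (\<forall>l<n i. (\<lambda>m. normalized_row (n i) (U (r m) i) (\<sigma> (r m) i) (K (r m) i) a l) \<longlonglongrightarrow> c i a l))"
proof -
  define I where "I = (SIGMA i:{1..d}. {..<n i} \<times> {..<n i})"
  define f where "f m t = (case t of (i, a, l) \<Rightarrow>
      (normalized_row (n i) (U m i) (\<sigma> m i) (K m i) a l, real (\<sigma> m i a)))" for m t
  have "finite I" unfolding I_def by (intro finite_SigmaI) auto
  moreover have "bounded (range (\<lambda>m. f m t))" if t: "t \<in> I" for t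
  proof -
    obtain i a l where tt: "t = (i, a, l)" "i \<in> {1..d}" "a < n i" "l < n i" using t unfolding I_def by auto
    have "f m t \<in> cball 0 1 \<times> {0..real (n i)}" for m
    proof -
      have "\<sigma> m i a < n i" using bij_betwE[OF adapted_basisD(1)[OF basis[OF tt(2), of m]]] tt(3) by auto
      then show ?thesis
        using pivoted_qr(3)[OF basis[OF tt(2)] tt(3,4)] unfolding f_def tt(1) by simp
    qed
    then have "range (\<lambda>m. f m t) \<subseteq> cball 0 1 \<times> {0..real (n i)}" by blast
    moreover have "bounded (cball (0::complex) 1 \<times> {0..real (n i)})"
      by (intro bounded_Times bounded_cball bounded_closed_interval)
    ultimately show ?thesis by (rule bounded_subset[rotated])
  qed
  ultimately obtain r L where r: "strict_mono r" "\<And>t. t \<in> I \<Longrightarrow> (\<lambda>m. f (r m) t) \<longlonglongrightarrow> L t"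
    using bounded_family_convergent_subsequence[of I f] by blast
  have rc: "(\<lambda>m. normalized_row (n i) (U (r m) i) (\<sigma> (r m) i) (K (r m) i) a l) \<longlonglongrightarrow> fst (L (i, a, l))"
    and rs: "(\<lambda>m. real (\<sigma> (r m) i a)) \<longlonglongrightarrow> snd (L (i, a, l))" if "(i, a, l) \<in> I" for i a l
    using tendsto_fst[OF r(2)[OF that]] tendsto_snd[OF r(2)[OF that]] unfolding f_def by simp_all
  have "\<forall>\<^sub>F m in sequentially. \<forall>t\<in>I. case t of (i, a, l) \<Rightarrow> real (\<sigma> (r m) i a) = of_int (round (snd (L t)))"
  proof (rule eventually_ball_finite[OF \<open>finite I\<close>], rule ballI)
    fix t assume t: "t \<in> I"
    obtain i a l where tt: "t = (i, a, l)" by (cases t)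
    have "\<forall>\<^sub>F m in sequentially. dist (real (\<sigma> (r m) i a)) (snd (L t)) < 1 / 2"
      using rs[of i a l] t unfolding tt by (intro tendstoD) auto
    then show "\<forall>\<^sub>F m in sequentially. case t of (i, a, l) \<Rightarrow> real (\<sigma> (r m) i a) = of_int (round (snd (L t)))"
    proof eventually_elim
      case (elim m)
      have "round (snd (L t)) = int (\<sigma> (r m) i a)"
        using elim by (intro round_unique') (simp add: dist_real_def abs_minus_commute)
      then show ?case unfolding tt by simp
    qed
  qed
  then obtain N where N: "\<And>m t. N \<le> m \<Longrightarrow> t \<in> I \<Longrightarrow>
      (case t of (i, a, l) \<Rightarrow> real (\<sigma> (r m) i a) = of_int (round (snd (L t))))"
    unfolding eventually_sequentially by blast
  define r' where "r' m = r (m + N)" for m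
  have "strict_mono r'" using r(1) unfolding r'_def strict_mono_def by simp
  moreover have "\<sigma> (r' m) i a = \<sigma> (r' 0) i a" if "i \<in> {1..d}" "a < n i" for m i a
  proof -
    have "(i, a, a) \<in> I" using that unfolding I_def by simp
    then have "real (\<sigma> (r' m) i a) = real (\<sigma> (r' 0) i a)"
      using N[of "m + N" "(i, a, a)"] N[of "0 + N" "(i, a, a)"] unfolding r'_def by simp
    then show ?thesis by simp
  qed
  moreover have "(\<lambda>m. normalized_row (n i) (U (r' m) i) (\<sigma> (r' m) i) (K (r' m) i) a l) \<longlonglongrightarrow> fst (L (i, a, l))"
    if "i \<in> {1..d}" "a < n i" "l < n i" for i a l
  proof -
    have "(i, a, l) \<in> I" using that unfolding I_def by simp
    from LIMSEQ_ignore_initial_segment[OF rc[OF this], of N] show ?thesis unfolding r'_def .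
  qed
  ultimately show ?thesis
    by (intro exI[of _ r'] exI[of _ "\<lambda>i a. \<sigma> (r' 0) i a"] exI[of _ "\<lambda>i a l. fst (L (i, a, l))"]) blast
qed

lemma kron_tendsto:
  assumes "\<And>i a b. i \<le> d \<Longrightarrow> a < n i \<Longrightarrow> b < n i \<Longrightarrow> (\<lambda>m. U m i a b) \<longlonglongrightarrow> V i a b"
  shows "(\<lambda>m. kron d n (U m) X \<alpha>) \<longlonglongrightarrow> kron d n V X \<alpha>"
proof (cases "\<alpha> \<in> multi_indices d n")
  case True
  show ?thesis unfolding kron_def using True
    by (simp del: prod.cl_ivl_Suc) (intro tendsto_sum tendsto_mult tendsto_prod tendsto_const assms; use True in \<open>auto intro: multi_indices_less\<close>)
qed (simp add: kron_def)

lemma kron_row_scale: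
  assumes "\<alpha> \<in> multi_indices d n"
  shows "kron d n (\<lambda>i a b. t i a * U i a b) X \<alpha> = (\<Prod>i\<in>{0..d}. t i (\<alpha> i)) * kron d n U X \<alpha>"
  using assms unfolding kron_def by (simp add: prod.distrib sum_distrib_left mult.assoc)

lemma cmod_le_sqrt_norm_sq:
  assumes "\<beta> \<in> multi_indices d n"
  shows "cmod (Z \<beta>) \<le> sqrt (norm_sq d n Z)"
proof -
  have "(cmod (Z \<beta>))\<^sup>2 \<le> norm_sq d n Z" unfolding norm_sq_def using assms by (intro member_le_sum) auto
  then show ?thesis by (rule real_le_rsqrt)
qed

lemma kron_bounded:
  fixes C :: "nat \<Rightarrow> real"
  assumes bound: "\<And>i a b. i \<le> d \<Longrightarrow> a < n i \<Longrightarrow> b < n i \<Longrightarrow> cmod (M i a b) \<le> C i"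
  shows "cmod (kron d n M Z \<alpha>) \<le> card (multi_indices d n) * (\<Prod>i\<in>{0..d}. \<bar>C i\<bar>) * sqrt (norm_sq d n Z)"
proof (cases "\<alpha> \<in> multi_indices d n")
  case True
  have "cmod (kron d n M Z \<alpha>) \<le> (\<Sum>\<beta>\<in>multi_indices d n. cmod ((\<Prod>i\<in>{0..d}. M i (\<alpha> i) (\<beta> i)) * Z \<beta>))"
    using True unfolding kron_def by (simp add: norm_sum)
  also have "\<dots> \<le> (\<Sum>\<beta>\<in>multi_indices d n. (\<Prod>i\<in>{0..d}. \<bar>C i\<bar>) * sqrt (norm_sq d n Z))"
  proof (rule sum_mono)
    fix \<beta> assume \<beta>: "\<beta> \<in> multi_indices d n"
    have "(\<Prod>i\<in>{0..d}. cmod (M i (\<alpha> i) (\<beta> i))) \<le> (\<Prod>i\<in>{0..d}. \<bar>C i\<bar>)"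
    proof (rule prod_mono)
      fix i assume "i \<in> {0..d}"
      then show "0 \<le> cmod (M i (\<alpha> i) (\<beta> i)) \<and> cmod (M i (\<alpha> i) (\<beta> i)) \<le> \<bar>C i\<bar>"
        using bound[of i "\<alpha> i" "\<beta> i"] multi_indices_less[OF True, of i] multi_indices_less[OF \<beta>, of i] by simp
    qed
    then have "(\<Prod>i\<in>{0..d}. cmod (M i (\<alpha> i) (\<beta> i))) * cmod (Z \<beta>) \<le> (\<Prod>i\<in>{0..d}. \<bar>C i\<bar>) * sqrt (norm_sq d n Z)"
      using cmod_le_sqrt_norm_sq[OF \<beta>] by (intro mult_mono) (auto intro: prod_nonneg)
    then show "cmod ((\<Prod>i\<in>{0..d}. M i (\<alpha> i) (\<beta> i)) * Z \<beta>) \<le> (\<Prod>i\<in>{0..d}. \<bar>C i\<bar>) * sqrt (norm_sq d n Z)"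
      by (simp add: norm_mult prod_norm[symmetric])
  qed
  finally show ?thesis by (simp add: mult.assoc)
next
  case False
  have "0 \<le> norm_sq d n Z" unfolding norm_sq_def by (simp add: sum_nonneg)
  then show ?thesis using False by (simp add: kron_def mult_nonneg_nonneg prod_nonneg)
qed

section \<open>A lower bound for the norm on the orbit\<close>

text \<open>For a sequence violating every bound, the flag limits compare \<open>U m X\<close>, up
  to a bounded left factor, with \<open>e m X\<close> rescaled by the positive diagonal matrices
  \<open>t m\<close>. On the support of \<open>E X\<close> the coordinates of \<open>e m X\<close>
  stay away from 0, so there the logarithm of each torus weight is at most half that of the squared
  norm plus a constant. The hull condition at \<open>E\<close> averages these estimates into one for
  \<open>log_character\<close>.\<close>

theorem norm_sq_lower_bound:
  assumes mono: "\<And>i a b. i \<in> {1..d} \<Longrightarrow> a \<le> b \<Longrightarrow> b < n i \<Longrightarrow> p i a \<le> p i b"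
    and p01: "\<And>i a. i \<in> {1..d} \<Longrightarrow> a < n i \<Longrightarrow> 0 \<le> p i a \<and> p i a \<le> 1"
    and hull: "\<And>U. borel_coords d n U \<Longrightarrow> in_weight_hull d n p (supp d n (kron d n U X))"
  shows "\<exists>\<delta>>0. \<forall>U. borel_coords d n U \<longrightarrow>
    \<delta> * exp (2 * log_character d n p U) \<le> norm_sq d n (kron d n U X)"
proof (rule ccontr)
  let ?I = "multi_indices d n"
  assume neg: "\<not> (\<exists>\<delta>>0. \<forall>U. borel_coords d n U \<longrightarrow>
    \<delta> * exp (2 * log_character d n p U) \<le> norm_sq d n (kron d n U X))"
  have "\<exists>U. borel_coords d n U \<and>
      norm_sq d n (kron d n U X) < inverse (real (Suc m)) * exp (2 * log_character d n p U)" for m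
  proof -
    have "0 < inverse (real (Suc m))" by simp
    then show ?thesis using neg by (meson not_le)
  qed
  then obtain U0 where U0: "\<And>m. borel_coords d n (U0 m)"
    "\<And>m. norm_sq d n (kron d n (U0 m) X) < inverse (real (Suc m)) * exp (2 * log_character d n p (U0 m))"
    by metis
  have "\<forall>m. \<forall>i\<in>{1..d}. \<exists>\<sigma>K. adapted_basis (n i) (\<lambda>_ x. x) (\<lambda>l a. U0 m i a l) (fst \<sigma>K) (snd \<sigma>K)"
    using borel_coords_adapted_basis[OF U0(1)] by simp
  then have "\<exists>\<sigma>K. \<forall>m. \<forall>i\<in>{1..d}. adapted_basis (n i) (\<lambda>_ x. x) (\<lambda>l a. U0 m i a l) (fst (\<sigma>K m i)) (snd (\<sigma>K m i))"
    unfolding bchoice_iff choice_iff .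
  then obtain \<sigma>K where \<sigma>K: "\<And>m i. i \<in> {1..d} \<Longrightarrow>
      adapted_basis (n i) (\<lambda>_ x. x) (\<lambda>l a. U0 m i a l) (fst (\<sigma>K m i)) (snd (\<sigma>K m i))" by blast
  define \<sigma> K where "\<sigma> m i = fst (\<sigma>K m i)" and "K m i = snd (\<sigma>K m i)" for m i
  have basis: "adapted_basis (n i) (\<lambda>_ x. x) (\<lambda>l a. U0 m i a l) (\<sigma> m i) (K m i)" if "i \<in> {1..d}" for m i
    using \<sigma>K[OF that] unfolding \<sigma>_def K_def .
  obtain r s c where r: "strict_mono r"
    and rsc: "\<forall>i\<in>{1..d}. \<forall>a<n i. (\<forall>m. \<sigma> (r m) i a = s i a) \<and>
      (\<forall>l<n i. (\<lambda>m. normalized_row (n i) (U0 (r m) i) (\<sigma> (r m) i) (K (r m) i) a l) \<longlonglongrightarrow> c i a l)"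
    using convergent_pivot_subsequence[where U = U0 and \<sigma> = \<sigma> and K = K and n = n and d = d] basis by blast
  define U where "U m = U0 (r m)" for m
  have U: "borel_coords d n (U m)" for m unfolding U_def by (rule U0(1))
  have "\<exists>w. flag_limit (n i) (\<lambda>m. U m i) (fst w) (fst (snd w)) (fst (snd (snd w)))
      (fst (snd (snd (snd w)))) (fst (snd (snd (snd (snd w))))) (snd (snd (snd (snd (snd w)))))"
    if i: "i \<in> {1..d}" for i
  proof -
    have "\<exists>e E t M C B. flag_limit (n i) (\<lambda>m. U m i) e E t M C B"
    proof (rule flag_limit_exists[where \<sigma> = "\<lambda>m. \<sigma> (r m) i" and K = "\<lambda>m. K (r m) i" and s = "s i" and c = "c i"])
      show "\<forall>a<n i. U m i a a \<noteq> 0 \<and> (\<forall>l<a. U m i a l = 0)" for m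
        using U[of m] i unfolding borel_coords_def by blast
    qed (use basis[OF i] rsc i in \<open>simp_all add: U_def\<close>)
    then obtain e E t M C B where "flag_limit (n i) (\<lambda>m. U m i) e E t M C B" by blast
    then show ?thesis by (intro exI[of _ "(e, E, t, M, C, B)"]) simp
  qed
  then obtain w where "\<And>i. i \<in> {1..d} \<Longrightarrow> flag_limit (n i) (\<lambda>m. U m i) (fst (w i)) (fst (snd (w i)))
      (fst (snd (snd (w i)))) (fst (snd (snd (snd (w i))))) (fst (snd (snd (snd (snd (w i)))))) (snd (snd (snd (snd (snd (w i))))))"
    by metis
  then obtain e0 E0 t0 M0 C0 B where fl: "\<And>i. i \<in> {1..d} \<Longrightarrow>
      flag_limit (n i) (\<lambda>m. U m i) (e0 i) (E0 i) (t0 i) (M0 i) (C0 i) (B i)"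
    using that[of "\<lambda>i. fst (w i)" "\<lambda>i. fst (snd (w i))" "\<lambda>i. fst (snd (snd (w i)))"
      "\<lambda>i. fst (snd (snd (snd (w i))))" "\<lambda>i. fst (snd (snd (snd (snd (w i)))))"
      "\<lambda>i. snd (snd (snd (snd (snd (w i)))))"] by blast
  define e where "e m i a b = (if i = 0 then of_bool (a = b) else e0 i m a b)" for m i a b
  define E where "E i a b = (if i = 0 then of_bool (a = b) else E0 i a b)" for i a b
  define t where "t m i a = (if i = 0 then 1 else t0 i m a)" for m i a
  define M where "M m i a b = (if i = 0 then of_bool (a = b) else M0 i m a b)" for m i a b
  define C where "C i = (if i = 0 then 1 else C0 i)" for i
  have E: "borel_coords d n E" unfolding borel_coords_def E_def using flag_limitD(1,2)[OF fl] by simp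
  have e_lim: "(\<lambda>m. e m i a b) \<longlonglongrightarrow> E i a b" if "i \<le> d" "a < n i" "b < n i" for i a b
    using flag_limitD(3)[OF fl, of i a b] that unfolding e_def E_def by (cases "i = 0") auto
  have tpos: "0 < t m i a" if "i \<le> d" "a < n i" for m i a
    using flag_limitD(4)[OF fl, of i a m] that unfolding t_def by (cases "i = 0") auto
  have MC: "cmod (M m i a b) \<le> C i" if "i \<le> d" "a < n i" "b < n i" for m i a b
    using flag_limitD(5)[OF fl, of i a b m] that unfolding M_def C_def by (cases "i = 0") auto
  have te: "(\<Sum>b<n i. M m i a b * U m i b l) = of_real (t m i a) * e m i a l"
    if "i \<le> d" "a < n i" "l < n i" for m i a l
  proof (cases "i = 0")
    case True
    have "U m 0 b l = of_bool (b = l)" for b using U[of m] unfolding borel_coords_def by blast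
    moreover have "(\<Sum>b<n 0. of_bool (a = b) * of_bool (b = l) :: complex) = (\<Sum>b<n 0. if b = a then of_bool (a = l) else 0)"
      by (intro sum.cong) auto
    ultimately show ?thesis using True that unfolding M_def t_def e_def by simp
  next
    case False
    then show ?thesis using flag_limitD(6)[OF fl, of i a l m] that unfolding M_def t_def e_def by simp
  qed
  have id: "kron d n (M m) (kron d n (U m) X) \<alpha> =
      (\<Prod>i\<in>{0..d}. of_real (t m i (\<alpha> i))) * kron d n (e m) X \<alpha>" if "\<alpha> \<in> ?I" for m \<alpha>
  proof -
    have "kron d n (M m) (kron d n (U m) X) = kron d n (\<lambda>i a b. of_real (t m i a) * e m i a b) X"
      unfolding kron_comp by (rule kron_cong) (use te in auto)
    then show ?thesis using kron_row_scale[OF that, of "\<lambda>i a. of_real (t m i a)"] by simp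
  qed
  define A where "A = card ?I * (\<Prod>i\<in>{0..d}. \<bar>C i\<bar>)"
  define N where "N m = norm_sq d n (kron d n (U m) X)" for m
  define \<tau> where "\<tau> m \<alpha> = (\<Prod>i\<in>{0..d}. t m i (\<alpha> i))" for m \<alpha>
  have \<tau>pos: "0 < \<tau> m \<alpha>" if "\<alpha> \<in> ?I" for m \<alpha>
    unfolding \<tau>_def using tpos multi_indices_less[OF that] by (intro prod_pos) auto
  have upper: "\<tau> m \<alpha> * cmod (kron d n (e m) X \<alpha>) \<le> A * sqrt (N m)" if \<alpha>: "\<alpha> \<in> ?I" for m \<alpha>
  proof -
    have "cmod (kron d n (M m) (kron d n (U m) X) \<alpha>) \<le> A * sqrt (N m)"
      unfolding A_def N_def by (rule kron_bounded) (rule MC)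
    moreover have "cmod (\<Prod>i\<in>{0..d}. of_real (t m i (\<alpha> i)) :: complex) = \<tau> m \<alpha>"
    proof -
      have "(\<Prod>i\<in>{0..d}. of_real (t m i (\<alpha> i)) :: complex) = of_real (\<tau> m \<alpha>)" unfolding \<tau>_def by simp
      then show ?thesis using \<tau>pos[OF \<alpha>, of m] by simp
    qed
    ultimately show ?thesis unfolding id[OF \<alpha>] norm_mult by simp
  qed
  define S where "S = supp d n (kron d n E X)"
  have SI: "S \<subseteq> ?I" and finS: "finite S" unfolding S_def supp_def by auto
  obtain q where q: "(\<forall>\<alpha>\<in>S. 0 \<le> q \<alpha>) \<and> sum q S = 1 \<and>
      (\<forall>t\<in>(SIGMA i:{1..d}. {..<n i}). (\<Sum>\<alpha>\<in>S. q \<alpha> * weight_vec \<alpha> t) = case_prod p t)"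
    using hull[OF E] unfolding in_weight_hull_def S_def[symmetric] by blast
  have q0: "0 \<le> q \<alpha>" if "\<alpha> \<in> S" for \<alpha> using q that by blast
  have q1: "sum q S = 1" using q by blast
  have qp: "(\<Sum>\<alpha>\<in>S. q \<alpha> * weight_vec \<alpha> (i, j)) = p i j" if "i \<in> {1..d}" "j < n i" for i j
  proof -
    have "(i, j) \<in> (SIGMA i:{1..d}. {..<n i})" using that by simp
    then show ?thesis using q by fastforce
  qed
  have "S \<noteq> {}" using q1 by auto
  \<comment> \<open>Half of the smallest modulus on the support, so that the strict bound persists
    for \<open>e m\<close> close to the limit.\<close>
  define \<eta> where "\<eta> = Min ((\<lambda>\<alpha>. cmod (kron d n E X \<alpha>)) ` S) / 2"
  have \<eta>: "0 < \<eta>" "\<eta> < cmod (kron d n E X \<alpha>)" if "\<alpha> \<in> S" for \<alpha>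
  proof -
    have "Min ((\<lambda>\<alpha>. cmod (kron d n E X \<alpha>)) ` S) \<in> (\<lambda>\<alpha>. cmod (kron d n E X \<alpha>)) ` S"
      using finS \<open>S \<noteq> {}\<close> by (intro Min_in) auto
    then have pos: "0 < Min ((\<lambda>\<alpha>. cmod (kron d n E X \<alpha>)) ` S)" unfolding S_def supp_def by auto
    then show "0 < \<eta>" unfolding \<eta>_def by simp
    have "Min ((\<lambda>\<alpha>. cmod (kron d n E X \<alpha>)) ` S) \<le> cmod (kron d n E X \<alpha>)"
      using finS that by (intro Min_le) auto
    then show "\<eta> < cmod (kron d n E X \<alpha>)" using pos unfolding \<eta>_def by simp
  qed
  then have "0 < \<eta>" using \<open>S \<noteq> {}\<close> by blast
  have ev1: "\<forall>\<^sub>F m in sequentially. \<forall>\<alpha>\<in>S. \<eta> < cmod (kron d n (e m) X \<alpha>)"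
  proof (rule eventually_ball_finite[OF finS], rule ballI)
    fix \<alpha> assume "\<alpha> \<in> S"
    have "(\<lambda>m. cmod (kron d n (e m) X \<alpha>)) \<longlonglongrightarrow> cmod (kron d n E X \<alpha>)"
      by (intro tendsto_norm kron_tendsto e_lim)
    then show "\<forall>\<^sub>F m in sequentially. \<eta> < cmod (kron d n (e m) X \<alpha>)"
      by (rule order_tendstoD) (rule \<eta>(2)[OF \<open>\<alpha> \<in> S\<close>])
  qed
  have ev2: "\<forall>\<^sub>F m in sequentially. \<forall>i\<in>{1..d}.
      (\<Sum>j<n i. p i j * ln (cmod (U m i j j))) \<le> (\<Sum>j<n i. p i j * ln (t m i j)) + B i"
  proof (rule eventually_ball_finite, simp, rule ballI)
    fix i assume i: "i \<in> {1..d}"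
    have "\<forall>\<^sub>F m in sequentially. (\<Sum>j<n i. p i j * ln (cmod (U m i j j))) \<le> (\<Sum>j<n i. p i j * ln (t0 i m j)) + B i"
      by (rule flag_limitD(7)[OF fl[OF i]]) (use mono[OF i] p01[OF i] in auto)
    then show "\<forall>\<^sub>F m in sequentially. (\<Sum>j<n i. p i j * ln (cmod (U m i j j))) \<le> (\<Sum>j<n i. p i j * ln (t m i j)) + B i"
      using i unfolding t_def by simp
  qed
  have ln\<tau>: "ln (\<tau> m \<alpha>) = (\<Sum>i\<in>{1..d}. ln (t m i (\<alpha> i)))" if "\<alpha> \<in> ?I" for m \<alpha>
  proof -
    have pos: "0 < t m i (\<alpha> i)" if "i \<in> {0..d}" for i
      using tpos[of i "\<alpha> i" m] multi_indices_less[OF \<open>\<alpha> \<in> ?I\<close>, of i] that by simp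
    have "ln (\<tau> m \<alpha>) = (\<Sum>i\<in>{0..d}. ln (t m i (\<alpha> i)))"
      unfolding \<tau>_def by (rule ln_prod) (use pos in force)+
    also have "\<dots> = (\<Sum>i\<in>{1..d}. ln (t m i (\<alpha> i)))"
      by (rule sum.mono_neutral_right) (auto simp: t_def)
    finally show ?thesis .
  qed
  \<comment> \<open>Averaging with the hull coefficients turns the weights of the multi-indices into
    the exponents \<open>p\<close>.\<close>
  have weighted: "(\<Sum>\<alpha>\<in>S. q \<alpha> * ln (\<tau> m \<alpha>)) = (\<Sum>i\<in>{1..d}. \<Sum>j<n i. p i j * ln (t m i j))" for m
  proof -
    have "(\<Sum>\<alpha>\<in>S. q \<alpha> * ln (\<tau> m \<alpha>)) = (\<Sum>\<alpha>\<in>S. \<Sum>i\<in>{1..d}. q \<alpha> * ln (t m i (\<alpha> i)))"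
      using ln\<tau> SI by (intro sum.cong refl) (auto simp: sum_distrib_left)
    also have "\<dots> = (\<Sum>i\<in>{1..d}. \<Sum>\<alpha>\<in>S. q \<alpha> * ln (t m i (\<alpha> i)))" by (rule sum.swap)
    also have "\<dots> = (\<Sum>i\<in>{1..d}. \<Sum>j<n i. p i j * ln (t m i j))"
    proof (intro sum.cong refl)
      fix i assume i: "i \<in> {1..d}"
      have "(\<Sum>j<n i. p i j * ln (t m i j)) = (\<Sum>j<n i. \<Sum>\<alpha>\<in>S. q \<alpha> * (of_bool (\<alpha> i = j) * ln (t m i j)))"
        by (intro sum.cong refl) (simp add: qp[OF i, symmetric] weight_vec_def sum_distrib_right mult.assoc)
      also have "\<dots> = (\<Sum>\<alpha>\<in>S. q \<alpha> * (\<Sum>j<n i. of_bool (\<alpha> i = j) * ln (t m i j)))"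
        by (subst sum.swap) (simp only: sum_distrib_left)
      also have "\<dots> = (\<Sum>\<alpha>\<in>S. q \<alpha> * ln (t m i (\<alpha> i)))"
      proof (intro sum.cong refl)
        fix \<alpha> assume "\<alpha> \<in> S"
        then have "\<alpha> i < n i" using SI i multi_indices_less[of \<alpha> d n i] by auto
        have "(\<Sum>j<n i. of_bool (\<alpha> i = j) * ln (t m i j)) = (\<Sum>j<n i. if j = \<alpha> i then ln (t m i (\<alpha> i)) else 0)"
          by (intro sum.cong) auto
        then show "q \<alpha> * (\<Sum>j<n i. of_bool (\<alpha> i = j) * ln (t m i j)) = q \<alpha> * ln (t m i (\<alpha> i))"
          using \<open>\<alpha> i < n i\<close> by simp
      qed
      finally show "(\<Sum>\<alpha>\<in>S. q \<alpha> * ln (t m i (\<alpha> i))) = (\<Sum>j<n i. p i j * ln (t m i j))" ..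
    qed
    finally show ?thesis .
  qed
  \<comment> \<open>Collects the constants: the loss in the characters, the bound on the left
    factors and the lower bound on the coordinates.\<close>
  define Z where "Z = (\<Sum>i\<in>{1..d}. B i) + \<bar>ln A\<bar> + \<bar>ln \<eta>\<bar>"
  have "\<forall>\<^sub>F m in sequentially. real (Suc m) < exp (2 * Z)"
    using ev1 ev2
  proof eventually_elim
    case (elim m)
    obtain \<alpha>0 where "\<alpha>0 \<in> S" using \<open>S \<noteq> {}\<close> by blast
    then have "0 < \<tau> m \<alpha>0 * cmod (kron d n (e m) X \<alpha>0)"
      using \<tau>pos[of \<alpha>0 m] SI elim(1) \<open>0 < \<eta>\<close> by (intro mult_pos_pos) (auto intro: less_trans)
    also have "\<dots> \<le> A * sqrt (N m)" using upper \<open>\<alpha>0 \<in> S\<close> SI by blast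
    finally have AN: "0 < A * sqrt (N m)" .
    have "0 \<le> N m" unfolding N_def norm_sq_def by (simp add: sum_nonneg)
    have Npos: "0 < N m" "0 < A"
    proof -
      show "0 < N m" using AN \<open>0 \<le> N m\<close> by (cases "N m = 0") auto
      then show "0 < A" using AN by (simp add: zero_less_mult_iff)
    qed
    have "q \<alpha> * (ln (\<tau> m \<alpha>) + ln \<eta>) \<le> q \<alpha> * (ln A + ln (N m) / 2)" if \<alpha>: "\<alpha> \<in> S" for \<alpha>
    proof (rule mult_left_mono[OF _ q0[OF \<alpha>]])
      have "\<tau> m \<alpha> * \<eta> \<le> \<tau> m \<alpha> * cmod (kron d n (e m) X \<alpha>)"
        using elim(1) \<alpha> \<tau>pos[of \<alpha> m] SI by (intro mult_left_mono) (auto intro: less_imp_le)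
      also have "\<dots> \<le> A * sqrt (N m)" using upper \<alpha> SI by blast
      finally have "ln (\<tau> m \<alpha> * \<eta>) \<le> ln (A * sqrt (N m))"
        using \<tau>pos[of \<alpha> m] SI \<alpha> \<open>0 < \<eta>\<close> by (intro ln_mono) auto
      then show "ln (\<tau> m \<alpha>) + ln \<eta> \<le> ln A + ln (N m) / 2"
        using \<tau>pos[of \<alpha> m] SI \<alpha> \<open>0 < \<eta>\<close> Npos by (simp add: ln_mult ln_sqrt subset_iff)
    qed
    then have "(\<Sum>\<alpha>\<in>S. q \<alpha> * (ln (\<tau> m \<alpha>) + ln \<eta>)) \<le> (\<Sum>\<alpha>\<in>S. q \<alpha> * (ln A + ln (N m) / 2))"
      by (rule sum_mono)
    moreover have "(\<Sum>\<alpha>\<in>S. q \<alpha> * (ln (\<tau> m \<alpha>) + ln \<eta>)) = (\<Sum>\<alpha>\<in>S. q \<alpha> * ln (\<tau> m \<alpha>)) + sum q S * ln \<eta>"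
      by (simp only: distrib_left sum.distrib sum_distrib_right)
    moreover have "(\<Sum>\<alpha>\<in>S. q \<alpha> * (ln A + ln (N m) / 2)) = sum q S * (ln A + ln (N m) / 2)"
      by (simp only: sum_distrib_right)
    ultimately have "(\<Sum>\<alpha>\<in>S. q \<alpha> * ln (\<tau> m \<alpha>)) + ln \<eta> \<le> ln A + ln (N m) / 2"
      using q1 by simp
    moreover have "log_character d n p (U m) \<le> (\<Sum>\<alpha>\<in>S. q \<alpha> * ln (\<tau> m \<alpha>)) + (\<Sum>i\<in>{1..d}. B i)"
      unfolding weighted log_character_def sum.distrib[symmetric] using elim(2) by (intro sum_mono) blast
    ultimately have l1: "log_character d n p (U m) \<le> Z + ln (N m) / 2" unfolding Z_def by linarith
    have "N m < inverse (real (Suc (r m))) * exp (2 * log_character d n p (U m))"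
      using U0(2)[of "r m"] unfolding N_def U_def .
    then have "ln (N m) < ln (inverse (real (Suc (r m))) * exp (2 * log_character d n p (U m)))"
      using Npos by (subst ln_less_cancel_iff) auto
    also have "\<dots> = - ln (real (Suc (r m))) + 2 * log_character d n p (U m)"
      by (simp add: ln_mult ln_inverse)
    finally have "ln (real (Suc (r m))) < 2 * Z" using l1 by linarith
    then have "exp (ln (real (Suc (r m)))) < exp (2 * Z)" by (rule exp_less_mono)
    then have "real (Suc (r m)) < exp (2 * Z)" by simp
    then show "real (Suc m) < exp (2 * Z)" using seq_suble[OF r, of m] by simp
  qed
  then obtain m0 where m0: "\<And>m. m0 \<le> m \<Longrightarrow> real (Suc m) < exp (2 * Z)"
    unfolding eventually_sequentially by blast
  obtain k where "exp (2 * Z) < real k" using reals_Archimedean2 by blast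
  then show False using m0[of "max m0 k"] by simp
qed

section \<open>Existence of a limit with prescribed marginals\<close>

definition single_factor :: "nat \<Rightarrow> (nat \<Rightarrow> nat \<Rightarrow> complex) \<Rightarrow> nat \<Rightarrow> nat \<Rightarrow> nat \<Rightarrow> complex" where
  "single_factor i A = (\<lambda>j. if j = i then A else (\<lambda>a b. of_bool (a = b)))"

lemma kron_single_factor:
  assumes "\<alpha> \<in> multi_indices d n" and "i \<le> d"
  shows "kron d n (single_factor i A) X \<alpha> = (\<Sum>b<n i. A (\<alpha> i) b * X (\<alpha>(i := b)))"
proof -
  let ?M = "multi_indices d n"
  have P: "(\<Prod>j\<in>{0..d}. single_factor i A j (\<alpha> j) (\<beta> j)) = A (\<alpha> i) (\<beta> i) * of_bool (\<beta> = \<alpha>(i := \<beta> i))"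
    if \<beta>: "\<beta> \<in> ?M" for \<beta>
  proof -
    have "(\<Prod>j\<in>{0..d}. single_factor i A j (\<alpha> j) (\<beta> j)) =
        A (\<alpha> i) (\<beta> i) * (\<Prod>j\<in>{0..d} - {i}. of_bool (\<alpha> j = \<beta> j))"
      using \<open>i \<le> d\<close> by (subst prod.remove[of _ i]) (auto simp: single_factor_def intro!: prod.cong)
    also have "(\<Prod>j\<in>{0..d} - {i}. of_bool (\<alpha> j = \<beta> j)) = (of_bool (\<forall>j\<in>{0..d} - {i}. \<alpha> j = \<beta> j) :: complex)"
      by (rule prod_of_bool) simp
    also have "(\<forall>j\<in>{0..d} - {i}. \<alpha> j = \<beta> j) \<longleftrightarrow> \<beta> = \<alpha>(i := \<beta> i)"
    proof
      assume eq: "\<forall>j\<in>{0..d} - {i}. \<alpha> j = \<beta> j"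
      have "\<alpha>(i := \<beta> i) \<in> ?M" using assms \<beta> by (intro multi_indices_upd multi_indices_less)
      then show "\<beta> = \<alpha>(i := \<beta> i)" using eq by (intro multi_indices_eqI[OF \<beta>]) auto
    next
      assume "\<beta> = \<alpha>(i := \<beta> i)"
      then show "\<forall>j\<in>{0..d} - {i}. \<alpha> j = \<beta> j" by (metis DiffD2 fun_upd_apply singletonI)
    qed
    finally show ?thesis .
  qed
  have inj: "inj_on (\<lambda>c. \<alpha>(i := c)) {..<n i}" by (rule inj_onI) (metis fun_upd_eqD)
  have sub: "(\<lambda>c. \<alpha>(i := c)) ` {..<n i} \<subseteq> ?M" using multi_indices_upd[OF assms] by auto
  have "kron d n (single_factor i A) X \<alpha> = (\<Sum>\<beta>\<in>?M. A (\<alpha> i) (\<beta> i) * of_bool (\<beta> = \<alpha>(i := \<beta> i)) * X \<beta>)"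
    using assms P unfolding kron_def by (simp cong: sum.cong)
  also have "\<dots> = (\<Sum>\<beta>\<in>(\<lambda>c. \<alpha>(i := c)) ` {..<n i}. A (\<alpha> i) (\<beta> i) * of_bool (\<beta> = \<alpha>(i := \<beta> i)) * X \<beta>)"
  proof (rule sum.mono_neutral_right[OF _ sub])
    show "\<forall>\<beta>\<in>?M - (\<lambda>c. \<alpha>(i := c)) ` {..<n i}. A (\<alpha> i) (\<beta> i) * of_bool (\<beta> = \<alpha>(i := \<beta> i)) * X \<beta> = 0"
    proof
      fix \<beta> assume \<beta>: "\<beta> \<in> ?M - (\<lambda>c. \<alpha>(i := c)) ` {..<n i}"
      then have "\<beta> \<noteq> \<alpha>(i := \<beta> i)" using multi_indices_less[of \<beta> d n i] \<open>i \<le> d\<close> by blast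
      then show "A (\<alpha> i) (\<beta> i) * of_bool (\<beta> = \<alpha>(i := \<beta> i)) * X \<beta> = 0" by simp
    qed
  qed simp
  also have "\<dots> = (\<Sum>b<n i. A (\<alpha> i) b * X (\<alpha>(i := b)))"
    unfolding sum.reindex[OF inj] o_def by simp
  finally show ?thesis .
qed

lemma borel_single_factor:
  assumes "i \<in> {1..d}" "\<And>a. a < n i \<Longrightarrow> A a a \<noteq> 0" "\<And>a b. a < n i \<Longrightarrow> b < a \<Longrightarrow> A a b = 0"
  shows "borel_coords d n (single_factor i A)"
  using assms unfolding borel_coords_def single_factor_def by auto

lemma log_character_single_factor:
  assumes "i \<in> {1..d}"
  shows "log_character d n p (single_factor i A) = (\<Sum>j<n i. p i j * ln (cmod (A j j)))"
proof -
  have "log_character d n p (single_factor i A) =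
      (\<Sum>k\<in>{1..d}. if k = i then \<Sum>j<n i. p i j * ln (cmod (A j j)) else 0)"
    unfolding log_character_def single_factor_def by (intro sum.cong refl) auto
  then show ?thesis using assms by simp
qed

lemma marginal_entry_cnj:
  assumes "i \<le> d" "a < n i" "b < n i"
  shows "marginal_entry d n Y i b a = cnj (marginal_entry d n Y i a b)"
  unfolding marginal_entry_def cnj_sum
  by (rule sum.reindex_bij_witness[of _ "\<lambda>\<alpha>. \<alpha>(i := b)" "\<lambda>\<alpha>. \<alpha>(i := a)"])
     (use assms in \<open>auto intro: multi_indices_upd simp: mult.commute\<close>)

lemma marginal_entry_diag:
  "marginal_entry d n Y i a a = of_real (\<Sum>\<alpha> | \<alpha> \<in> multi_indices d n \<and> \<alpha> i = a. (cmod (Y \<alpha>))\<^sup>2)"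
  unfolding marginal_entry_def of_real_sum
  by (intro sum.cong refl) (auto simp: complex_norm_square simp del: of_real_power)

text \<open>First-order optimality along the one-parameter subgroups of the Borel group.\<close>

lemma marginal_of_minimizer:
  assumes Y: "norm_sq d n Y = 1"
    and min: "\<And>U. borel_coords d n U \<Longrightarrow> exp (2 * log_character d n p U) \<le> norm_sq d n (kron d n U Y)"
    and i: "i \<in> {1..d}" and a: "a < n i" and b: "b < n i"
  shows "marginal_entry d n Y i a b = of_bool (a = b) * of_real (p i a)"
proof -
  let ?M = "multi_indices d n"
  have "i \<le> d" using i by simp
  have split: "(\<Sum>\<alpha>\<in>?M. f \<alpha> + (if \<alpha> i = a then g \<alpha> else 0)) = sum f ?M + (\<Sum>\<alpha> | \<alpha> \<in> ?M \<and> \<alpha> i = a. g \<alpha>)"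
    for f g :: "(nat \<Rightarrow> nat) \<Rightarrow> real" and a
    unfolding sum.distrib by (subst sum.inter_filter) simp_all
  have off: "marginal_entry d n Y i a b = 0" if ab: "a < b" "b < n i" for a b
  proof -
    have "a < n i" using ab by simp
    define \<mu> where "\<mu> = marginal_entry d n Y i a b"
    define Q where "Q = (\<Sum>\<alpha> | \<alpha> \<in> ?M \<and> \<alpha> i = a. (cmod (Y (\<alpha>(i := b))))\<^sup>2)"
    have "Q \<ge> 0" unfolding Q_def by (simp add: sum_nonneg)
    \<comment> \<open>Tests the unipotent matrix with the single off-diagonal entry
      \<open>z\<close>. It is upper triangular because \<open>a < b\<close>, and its character is
      1.\<close>
    have ineq: "0 \<le> 2 * Re (z * cnj \<mu>) + (cmod z)\<^sup>2 * Q" for z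
    proof -
      define A where "A x y = of_bool (x = y) + (if x = a \<and> y = b then z else 0)" for x y
      have borel: "borel_coords d n (single_factor i A)"
        by (rule borel_single_factor[OF i]) (use ab in \<open>auto simp: A_def\<close>)
      have "log_character d n p (single_factor i A) = 0"
        unfolding log_character_single_factor[OF i] by (rule sum.neutral) (use ab in \<open>auto simp: A_def\<close>)
      then have ge: "1 \<le> norm_sq d n (kron d n (single_factor i A) Y)" using min[OF borel] by simp
      have k: "kron d n (single_factor i A) Y \<alpha> = Y \<alpha> + (if \<alpha> i = a then z * Y (\<alpha>(i := b)) else 0)"
        if \<alpha>: "\<alpha> \<in> ?M" for \<alpha>
      proof -
        have "kron d n (single_factor i A) Y \<alpha> = (\<Sum>y<n i. A (\<alpha> i) y * Y (\<alpha>(i := y)))"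
          by (rule kron_single_factor[OF \<alpha> \<open>i \<le> d\<close>])
        also have "\<dots> = (\<Sum>y<n i. (if y = \<alpha> i then Y \<alpha> else 0) + (if y = b then (if \<alpha> i = a then z * Y (\<alpha>(i := b)) else 0) else 0))"
          by (intro sum.cong refl) (auto simp: A_def distrib_right)
        also have "\<dots> = Y \<alpha> + (if \<alpha> i = a then z * Y (\<alpha>(i := b)) else 0)"
          using multi_indices_less[OF \<alpha> \<open>i \<le> d\<close>] ab by (simp add: sum.distrib)
        finally show ?thesis .
      qed
      have sq: "(cmod (u + v))\<^sup>2 = (cmod u)\<^sup>2 + (2 * Re (v * cnj u) + (cmod v)\<^sup>2)" for u v :: complex
        unfolding cmod_power2 by (simp add: power2_eq_square algebra_simps)
      have "norm_sq d n (kron d n (single_factor i A) Y) = (\<Sum>\<alpha>\<in>?M. (cmod (Y \<alpha>))\<^sup>2 +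
          (if \<alpha> i = a then 2 * Re (z * Y (\<alpha>(i := b)) * cnj (Y \<alpha>)) + (cmod (z * Y (\<alpha>(i := b))))\<^sup>2 else 0))"
        unfolding norm_sq_def by (intro sum.cong refl) (auto simp: k sq)
      also have "\<dots> = norm_sq d n Y +
          (\<Sum>\<alpha> | \<alpha> \<in> ?M \<and> \<alpha> i = a. 2 * Re (z * Y (\<alpha>(i := b)) * cnj (Y \<alpha>)) + (cmod (z * Y (\<alpha>(i := b))))\<^sup>2)"
        unfolding norm_sq_def by (rule split)
      also have "(\<Sum>\<alpha> | \<alpha> \<in> ?M \<and> \<alpha> i = a. 2 * Re (z * Y (\<alpha>(i := b)) * cnj (Y \<alpha>)) + (cmod (z * Y (\<alpha>(i := b))))\<^sup>2)
          = 2 * Re (z * cnj \<mu>) + (cmod z)\<^sup>2 * Q"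
      proof -
        have "z * cnj \<mu> = (\<Sum>\<alpha> | \<alpha> \<in> ?M \<and> \<alpha> i = a. z * Y (\<alpha>(i := b)) * cnj (Y \<alpha>))"
          unfolding \<mu>_def marginal_entry_def cnj_sum sum_distrib_left by (intro sum.cong refl) (simp add: mult_ac)
        then have "2 * Re (z * cnj \<mu>) = (\<Sum>\<alpha> | \<alpha> \<in> ?M \<and> \<alpha> i = a. 2 * Re (z * Y (\<alpha>(i := b)) * cnj (Y \<alpha>)))"
          by (simp only: Re_sum sum_distrib_left)
        moreover have "(cmod z)\<^sup>2 * Q = (\<Sum>\<alpha> | \<alpha> \<in> ?M \<and> \<alpha> i = a. (cmod (z * Y (\<alpha>(i := b))))\<^sup>2)"
          unfolding Q_def by (simp only: sum_distrib_left norm_mult power_mult_distrib)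
        ultimately show ?thesis by (simp only: sum.distrib)
      qed
      finally show ?thesis using ge Y by simp
    qed
    \<comment> \<open>For \<open>z = - s * \<mu>\<close> the linear term is negative unless \<mu> is
      0, and \<open>s * Q < 1\<close> keeps the quadratic term from compensating it.\<close>
    define s where "s = 1 / (Q + 1)"
    have s: "0 < s" "s * Q < 1" unfolding s_def using \<open>Q \<ge> 0\<close> by auto
    have "0 \<le> 2 * Re (- of_real s * \<mu> * cnj \<mu>) + (cmod (- of_real s * \<mu>))\<^sup>2 * Q" by (rule ineq)
    also have "Re (- of_real s * \<mu> * cnj \<mu>) = - s * (cmod \<mu>)\<^sup>2"
    proof -
      have "- of_real s * \<mu> * cnj \<mu> = of_real (- s * (cmod \<mu>)\<^sup>2)"
        by (simp add: complex_norm_square mult.assoc del: of_real_power)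
      then show ?thesis by (simp only: Re_complex_of_real)
    qed
    also have "(cmod (- of_real s * \<mu>))\<^sup>2 = s\<^sup>2 * (cmod \<mu>)\<^sup>2" by (simp add: norm_mult power_mult_distrib)
    finally have "0 \<le> s * (cmod \<mu>)\<^sup>2 * (s * Q - 2)" by (simp add: power2_eq_square algebra_simps)
    then have "(cmod \<mu>)\<^sup>2 \<le> 0" using s by (simp add: zero_le_mult_iff mult_le_0_iff)
    then show ?thesis unfolding \<mu>_def by simp
  qed
  have diag: "marginal_entry d n Y i a a = of_real (p i a)" if a: "a < n i" for a
  proof -
    define \<rho> where "\<rho> = (\<Sum>\<alpha> | \<alpha> \<in> ?M \<and> \<alpha> i = a. (cmod (Y \<alpha>))\<^sup>2)"
    \<comment> \<open>Tests the diagonal matrix with \<open>exp (u / 2)\<close> at index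
      \<open>a\<close>; the squared modulus of its character is
      \<open>exp (p i a * u)\<close>.\<close>
    have ineq: "exp (p i a * u) \<le> 1 + (exp u - 1) * \<rho>" for u
    proof -
      define s where "s = exp (u / 2)"
      have s: "0 < s" "s\<^sup>2 = exp u" unfolding s_def by (simp_all add: power2_eq_square exp_add[symmetric])
      define A where "A x y = (if x = y then if x = a then complex_of_real s else 1 else 0)" for x y :: nat
      have borel: "borel_coords d n (single_factor i A)"
        by (rule borel_single_factor[OF i]) (use s in \<open>auto simp: A_def\<close>)
      have "log_character d n p (single_factor i A) = (\<Sum>j<n i. if j = a then p i a * ln s else 0)"
        unfolding log_character_single_factor[OF i] by (intro sum.cong refl) (use s in \<open>auto simp: A_def\<close>)
      then have "log_character d n p (single_factor i A) = p i a * ln s" using a by simp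
      then have lc: "2 * log_character d n p (single_factor i A) = p i a * u" unfolding s_def by simp
      have k: "kron d n (single_factor i A) Y \<alpha> = (if \<alpha> i = a then of_real s * Y \<alpha> else Y \<alpha>)"
        if \<alpha>: "\<alpha> \<in> ?M" for \<alpha>
      proof -
        have "kron d n (single_factor i A) Y \<alpha> = (\<Sum>y<n i. A (\<alpha> i) y * Y (\<alpha>(i := y)))"
          by (rule kron_single_factor[OF \<alpha> \<open>i \<le> d\<close>])
        also have "\<dots> = (\<Sum>y<n i. if y = \<alpha> i then (if \<alpha> i = a then of_real s * Y \<alpha> else Y \<alpha>) else 0)"
          by (intro sum.cong refl) (auto simp: A_def)
        also have "\<dots> = (if \<alpha> i = a then of_real s * Y \<alpha> else Y \<alpha>)"
          using multi_indices_less[OF \<alpha> \<open>i \<le> d\<close>] by simp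
        finally show ?thesis .
      qed
      have "norm_sq d n (kron d n (single_factor i A) Y) =
          (\<Sum>\<alpha>\<in>?M. (cmod (Y \<alpha>))\<^sup>2 + (if \<alpha> i = a then (s\<^sup>2 - 1) * (cmod (Y \<alpha>))\<^sup>2 else 0))"
        unfolding norm_sq_def
        by (intro sum.cong refl) (auto simp: k norm_mult power_mult_distrib algebra_simps)
      also have "\<dots> = norm_sq d n Y + (\<Sum>\<alpha> | \<alpha> \<in> ?M \<and> \<alpha> i = a. (s\<^sup>2 - 1) * (cmod (Y \<alpha>))\<^sup>2)"
        unfolding norm_sq_def by (rule split)
      also have "\<dots> = 1 + (exp u - 1) * \<rho>" unfolding Y \<rho>_def s(2) by (simp add: sum_distrib_left)
      finally show ?thesis using min[OF borel] unfolding lc by simp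
    qed
    \<comment> \<open>Nonnegative with \<open>f 0 = 0\<close>, so its derivative vanishes at
      0.\<close>
    define f where "f u = 1 + (exp u - 1) * \<rho> - exp (p i a * u)" for u
    have "(f has_real_derivative (\<rho> - p i a)) (at 0)"
      unfolding f_def by (auto intro!: derivative_eq_intros)
    then have "\<rho> - p i a = 0"
      by (rule DERIV_local_min[of _ _ _ 1]) (use ineq in \<open>auto simp: f_def\<close>)
    then show ?thesis unfolding marginal_entry_diag \<rho>_def[symmetric] by simp
  qed
  show ?thesis
  proof (cases a b rule: linorder_cases)
    case less
    then show ?thesis using off[OF less b] by simp
  next
    case equal
    then show ?thesis using diag[OF a] by simp
  next
    case greater
    \<comment> \<open>No unipotent group element reaches an entry below the diagonal; it is the
      conjugate of one above.\<close>
    then show ?thesis using off[OF greater a] marginal_entry_cnj[of i d b n a Y] a b \<open>i \<le> d\<close> by simp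
  qed
qed

lemma norm_sq_scale: "norm_sq d n (\<lambda>\<alpha>. c * X \<alpha>) = (cmod c)\<^sup>2 * norm_sq d n X"
  unfolding norm_sq_def by (simp add: norm_mult power_mult_distrib sum_distrib_left)

lemma norm_sq_nonneg: "0 \<le> norm_sq d n X"
  unfolding norm_sq_def by (simp add: sum_nonneg)

text \<open>Since the character is multiplicative, the action of \<open>V\<close> on
  \<open>U m X\<close> compares the value of \<open>\<Phi>\<close> at the product of
  \<open>V\<close> and \<open>U m\<close>, which is at least the infimum \<open>c\<close>, with its
  value at \<open>U m\<close>, which tends to \<open>c\<close>. The resulting inequality passes to
  the limit tensor even if the \<open>U m\<close> diverge.\<close>

theorem exists_moment_limit:
  assumes "0 < \<delta>" and bound: "\<And>U. borel_coords d n U \<Longrightarrow>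
    \<delta> * exp (2 * log_character d n p U) \<le> norm_sq d n (kron d n U X)"
  shows "\<exists>Y\<in>Ten d n. norm_sq d n Y = 1 \<and>
    (\<forall>i\<in>{1..d}. \<forall>a<n i. \<forall>b<n i. marginal_entry d n Y i a b = of_bool (a = b) * of_real (p i a)) \<and>
    (\<exists>U s. (\<forall>m. borel_coords d n (U m) \<and> s m \<noteq> 0) \<and>
      (\<forall>\<alpha>. (\<lambda>m. s m * kron d n (U m) X \<alpha>) \<longlonglongrightarrow> Y \<alpha>))"
proof -
  let ?M = "multi_indices d n"
  define \<Phi> where "\<Phi> U = norm_sq d n (kron d n U X) / exp (2 * log_character d n p U)" for U
  define S where "S = \<Phi> ` {U. borel_coords d n U}"
  have \<delta>: "\<delta> \<le> \<Phi> U" if "borel_coords d n U" for U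
    using bound[OF that] unfolding \<Phi>_def by (simp add: field_simps)
  have bdd: "bdd_below S" unfolding S_def by (intro bdd_belowI[of _ \<delta>]) (use \<delta> in auto)
  have "borel_coords d n (\<lambda>i a b. of_bool (a = b))" unfolding borel_coords_def by auto
  then have ne: "S \<noteq> {}" unfolding S_def by blast
  define c where "c = Inf S"
  have "\<delta> \<le> c" unfolding c_def using ne \<delta> by (intro cInf_greatest) (auto simp: S_def)
  then have "0 < c" using \<open>0 < \<delta>\<close> by simp
  have c: "c \<le> \<Phi> U" if "borel_coords d n U" for U
    unfolding c_def using bdd that by (intro cInf_lower) (auto simp: S_def)
  \<comment> \<open>The slack is a factor rather than a summand; this is where \<open>c\<close> must
    be positive.\<close>
  have "\<exists>U. borel_coords d n U \<and> \<Phi> U < c * (1 + inverse (real (Suc m)))" for m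
  proof -
    have "Inf S < c * (1 + inverse (real (Suc m)))" using \<open>0 < c\<close> unfolding c_def[symmetric] by (simp add: algebra_simps)
    from cInf_lessD[OF ne this] show ?thesis unfolding S_def by auto
  qed
  then obtain U where U: "\<And>m. borel_coords d n (U m)" "\<And>m. \<Phi> (U m) < c * (1 + inverse (real (Suc m)))"
    by metis
  define N where "N m = norm_sq d n (kron d n (U m) X)" for m
  have Npos: "0 < N m" for m
    using less_le_trans[OF _ bound[OF U(1)[of m]]] \<open>0 < \<delta>\<close> unfolding N_def by simp
  define Z where "Z m = (\<lambda>\<alpha>. of_real (1 / sqrt (N m)) * kron d n (U m) X \<alpha>)" for m
  have Z1: "norm_sq d n (Z m) = 1" for m
    unfolding Z_def norm_sq_scale N_def[symmetric] using Npos[of m] by (simp add: norm_divide power_divide)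
  have "bounded (range (\<lambda>m. Z m \<alpha>))" if "\<alpha> \<in> ?M" for \<alpha>
    unfolding bounded_iff using cmod_le_sqrt_norm_sq[OF that, of "Z _"] Z1 by (intro exI[of _ 1]) auto
  then obtain r L where r: "strict_mono r" "\<And>\<alpha>. \<alpha> \<in> ?M \<Longrightarrow> (\<lambda>m. Z (r m) \<alpha>) \<longlonglongrightarrow> L \<alpha>"
    using bounded_family_convergent_subsequence[of ?M Z] by auto
  define Y where "Y \<alpha> = (if \<alpha> \<in> ?M then L \<alpha> else 0)" for \<alpha>
  have ZY: "(\<lambda>m. Z (r m) \<alpha>) \<longlonglongrightarrow> Y \<alpha>" for \<alpha>
    using r(2)[of \<alpha>] unfolding Y_def by (cases "\<alpha> \<in> ?M") (auto simp: Z_def kron_def)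
  have "Y \<in> Ten d n" unfolding Ten_def Y_def by simp
  have nlim: "(\<lambda>m. norm_sq d n (kron d n V (Z (r m)))) \<longlonglongrightarrow> norm_sq d n (kron d n V Y)" for V
  proof -
    have "(\<lambda>m. kron d n V (Z (r m)) \<alpha>) \<longlonglongrightarrow> kron d n V Y \<alpha>" for \<alpha>
      using ZY by (cases "\<alpha> \<in> ?M") (auto simp: kron_def intro!: tendsto_sum tendsto_mult_left)
    then show ?thesis unfolding norm_sq_def by (intro tendsto_intros)
  qed
  have "(\<lambda>m. norm_sq d n (Z (r m))) \<longlonglongrightarrow> norm_sq d n Y"
    unfolding norm_sq_def using ZY by (intro tendsto_intros)
  then have Y1: "norm_sq d n Y = 1" using Z1 by (simp add: LIMSEQ_const_iff)
  have min: "exp (2 * log_character d n p V) \<le> norm_sq d n (kron d n V Y)" if V: "borel_coords d n V" for V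
  proof -
    have step: "exp (2 * log_character d n p V) / (1 + inverse (real (Suc m))) \<le> norm_sq d n (kron d n V (Z m))" for m
    proof -
      obtain T where T: "borel_coords d n T" "\<And>X. kron d n V (kron d n (U m) X) = kron d n T X"
        "\<And>i a. i \<in> {1..d} \<Longrightarrow> a < n i \<Longrightarrow> T i a a = V i a a * U m i a a"
        using borel_coords_mult[OF V U(1)[of m]] by blast
      have lc: "log_character d n p T = log_character d n p V + log_character d n p (U m)"
      proof -
        have "ln (cmod (T i j j)) = ln (cmod (V i j j)) + ln (cmod (U m i j j))" if "i \<in> {1..d}" "j < n i" for i j
          using T(3)[OF that] V U(1)[of m] that unfolding borel_coords_def by (simp add: norm_mult ln_mult)
        then show ?thesis unfolding log_character_def by (simp add: distrib_left sum.distrib)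
      qed
      define x where "x = exp (2 * log_character d n p (U m))"
      have x: "0 < x" "N m < c * (1 + inverse (real (Suc m))) * x"
        using U(2)[of m] unfolding x_def \<Phi>_def N_def by (simp_all add: divide_less_eq)
      have pos: "0 < 1 + inverse (real (Suc m))" by (simp add: add_pos_pos)
      have "c * (exp (2 * log_character d n p V) * x) \<le> norm_sq d n (kron d n T X)"
        using c[OF T(1)] unfolding \<Phi>_def lc x_def by (simp add: field_simps exp_add distrib_left)
      also have "norm_sq d n (kron d n T X) = N m * norm_sq d n (kron d n V (Z m))"
        unfolding Z_def kron_scale T(2) norm_sq_scale using Npos[of m] by (simp add: norm_divide power_divide)
      also have "\<dots> \<le> c * (1 + inverse (real (Suc m))) * x * norm_sq d n (kron d n V (Z m))"
        using x by (intro mult_right_mono norm_sq_nonneg) simp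
      finally have "c * x * exp (2 * log_character d n p V) \<le>
          c * x * ((1 + inverse (real (Suc m))) * norm_sq d n (kron d n V (Z m)))" by (simp only: mult_ac)
      then have "exp (2 * log_character d n p V) \<le> (1 + inverse (real (Suc m))) * norm_sq d n (kron d n V (Z m))"
        using \<open>0 < c\<close> x(1) by (simp only: mult_le_cancel_left_pos mult_pos_pos)
      then show ?thesis using pos by (simp only: pos_divide_le_eq mult.commute)
    qed
    have "(\<lambda>m. inverse (real (Suc (r m)))) \<longlonglongrightarrow> 0"
      using LIMSEQ_subseq_LIMSEQ[OF LIMSEQ_inverse_real_of_nat r(1)] unfolding o_def .
    then have "(\<lambda>m. exp (2 * log_character d n p V) / (1 + inverse (real (Suc (r m))))) \<longlonglongrightarrow>
        exp (2 * log_character d n p V) / (1 + 0)" by (intro tendsto_intros) auto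
    then have "exp (2 * log_character d n p V) / (1 + 0) \<le> norm_sq d n (kron d n V Y)"
      by (rule LIMSEQ_le[OF _ nlim]) (use step in blast)
    then show ?thesis by simp
  qed
  have "(\<forall>m. borel_coords d n (U (r m)) \<and> complex_of_real (1 / sqrt (N (r m))) \<noteq> 0) \<and>
      (\<forall>\<alpha>. (\<lambda>m. complex_of_real (1 / sqrt (N (r m))) * kron d n (U (r m)) X \<alpha>) \<longlonglongrightarrow> Y \<alpha>)"
    using U(1) Npos ZY unfolding Z_def by (auto simp: less_imp_neq[symmetric])
  then have "\<exists>U s. (\<forall>m. borel_coords d n (U m) \<and> s m \<noteq> 0) \<and>
      (\<forall>\<alpha>. (\<lambda>m. s m * kron d n (U m) X \<alpha>) \<longlonglongrightarrow> Y \<alpha>)"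
    by (intro exI[of _ "\<lambda>m. U (r m)"] exI[of _ "\<lambda>m. complex_of_real (1 / sqrt (N (r m)))"])
  moreover have "\<forall>i\<in>{1..d}. \<forall>a<n i. \<forall>b<n i. marginal_entry d n Y i a b = of_bool (a = b) * of_real (p i a)"
    using marginal_of_minimizer[OF Y1 min] by blast
  ultimately show ?thesis using \<open>Y \<in> Ten d n\<close> Y1 by blast
qed

section \<open>The Borel polytope as an intersection of weight hulls\<close>

lemma Borel_group_coords:
  assumes "R \<in> Borel_group d n"
  obtains U where "borel_coords d n U" "\<And>X. Borel_action d n R X = kron d n U X"
proof -
  define U where "U i a b = (if i = 0 then of_bool (a = b) else R i $$ (a, b))" for i a b
  have R: "R i \<in> carrier_mat (n i) (n i)" "upper_triangular (R i)" "invertible_mat (R i)" if "i \<in> {1..d}" for i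
    using assms that unfolding Borel_group_def upper_triangular_group_def by (auto simp: PiE_def Pi_def)
  have diag: "R i $$ (a, a) \<noteq> 0" if i: "i \<in> {1..d}" and a: "a < n i" for i a
  proof -
    obtain B where B: "inverts_mat (R i) B" "inverts_mat B (R i)"
      using R(3)[OF i] unfolding invertible_mat_def by blast
    have RB: "R i * B = 1\<^sub>m (n i)" using B(1) R(1)[OF i] unfolding inverts_mat_def by simp
    moreover have "B * R i = 1\<^sub>m (dim_row B)" using B(2) unfolding inverts_mat_def .
    ultimately have "B \<in> carrier_mat (n i) (n i)" using R(1)[OF i]
      by (metis carrier_matD(2) carrier_matI index_mult_mat(3) index_one_mat(3))
    then have "Determinant.det (R i) * Determinant.det B = 1"
      using RB det_mult[OF R(1)[OF i]] by (metis det_one)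
    then have "Determinant.det (R i) \<noteq> 0" by (metis mult_zero_left zero_neq_one)
    then have "prod_list (diag_mat (R i)) \<noteq> 0" unfolding det_upper_triangular[OF R(2,1)[OF i]] .
    moreover have "R i $$ (a, a) \<in> set (diag_mat (R i))" using R(1)[OF i] a unfolding diag_mat_def by auto
    ultimately show ?thesis by (metis prod_list_zero_iff)
  qed
  have "R i $$ (a, b) = 0" if "i \<in> {1..d}" "a < n i" "b < a" for i a b
    using R(1)[OF that(1)] R(2)[OF that(1)] that(2,3) by (auto dest: upper_triangularD)
  then have "borel_coords d n U"
    using diag unfolding borel_coords_def U_def by auto
  moreover have "Borel_action d n R X = kron d n U X" for X
  proof -
    have "Borel_action d n R X = kron d n (\<lambda>i a b. (R(0 := 1\<^sub>m (n 0))) i $$ (a, b)) X"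
      unfolding Borel_action_def kronecker_apply_def kron_def ..
    also have "\<dots> = kron d n U X" by (rule kron_cong) (auto simp: U_def)
    finally show ?thesis .
  qed
  ultimately show ?thesis using that by blast
qed

lemma borel_coords_group:
  assumes U: "borel_coords d n U"
  obtains R where "R \<in> Borel_group d n" "\<And>X. Borel_action d n R X = kron d n U X"
proof -
  define R where "R = restrict (\<lambda>i. Matrix.mat (n i) (n i) (\<lambda>(a, b). U i a b)) {1..d}"
  have "R i \<in> upper_triangular_group (n i)" if i: "i \<in> {1..d}" for i
  proof -
    have Ri: "R i = Matrix.mat (n i) (n i) (\<lambda>(a, b). U i a b)" using i unfolding R_def by simp
    have Ui: "\<forall>a<n i. U i a a \<noteq> 0 \<and> (\<forall>b<a. U i a b = 0)" using U i unfolding borel_coords_def by blast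
    from upper_triangular_inverse[OF Ui]
    obtain B where "\<forall>a<n i. B a a \<noteq> 0 \<and> (\<forall>b<a. B a b = 0)"
      and B: "\<forall>a<n i. \<forall>c<n i. (\<Sum>b<n i. U i a b * B b c) = of_bool (a = c)"
        "\<forall>a<n i. \<forall>c<n i. (\<Sum>b<n i. B a b * U i b c) = of_bool (a = c)" .
    let ?B = "Matrix.mat (n i) (n i) (\<lambda>(a, b). B a b)"
    have "R i * ?B = 1\<^sub>m (n i)" unfolding Ri
      by (rule eq_matI) (use B(1) in \<open>auto simp: scalar_prod_def lessThan_atLeast0\<close>)
    moreover have "?B * R i = 1\<^sub>m (n i)" unfolding Ri
      by (rule eq_matI) (use B(2) in \<open>auto simp: scalar_prod_def lessThan_atLeast0\<close>)
    ultimately have "invertible_mat (R i)"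
      unfolding invertible_mat_def inverts_mat_def by (auto simp: Ri intro!: exI[of _ ?B])
    moreover have "upper_triangular (R i)" unfolding Ri using Ui by auto
    ultimately show ?thesis unfolding upper_triangular_group_def by (simp add: Ri)
  qed
  then have "R \<in> Borel_group d n" unfolding Borel_group_def R_def by auto
  moreover have "Borel_action d n R X = kron d n U X" for X
  proof -
    have "Borel_action d n R X = kron d n (\<lambda>i a b. (R(0 := 1\<^sub>m (n 0))) i $$ (a, b)) X"
      unfolding Borel_action_def kronecker_apply_def kron_def ..
    also have "\<dots> = kron d n U X"
      by (rule kron_cong) (use U in \<open>auto simp: R_def borel_coords_def\<close>)
    finally show ?thesis .
  qed
  ultimately show ?thesis using that by blast
qed

lemma Borel_orbit_eq:
  "{proj_point (Borel_action d n R X) | R. R \<in> Borel_group d n} = {proj_point (kron d n U X) | U. borel_coords d n U}"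
proof (intro equalityI subsetI)
  fix P assume "P \<in> {proj_point (Borel_action d n R X) | R. R \<in> Borel_group d n}"
  then obtain R where R: "R \<in> Borel_group d n" "P = proj_point (Borel_action d n R X)" by blast
  obtain U where "borel_coords d n U" "\<And>X. Borel_action d n R X = kron d n U X"
    using Borel_group_coords[OF R(1)] by blast
  then show "P \<in> {proj_point (kron d n U X) | U. borel_coords d n U}" using R(2) by auto
next
  fix P assume "P \<in> {proj_point (kron d n U X) | U. borel_coords d n U}"
  then obtain U where U: "borel_coords d n U" "P = proj_point (kron d n U X)" by blast
  obtain R where R: "R \<in> Borel_group d n" "\<And>X. Borel_action d n R X = kron d n U X"
    using borel_coords_group[OF U(1)] by blast
  then have "P = proj_point (Borel_action d n R X)" using U(2) by simp
  then show "P \<in> {proj_point (Borel_action d n R X) | R. R \<in> Borel_group d n}" using R(1) by blast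
qed

lemma borel_coords_left_inverse:
  assumes "borel_coords d n U"
  shows "\<exists>V. borel_coords d n V \<and> (\<forall>X\<in>Ten d n. kron d n V (kron d n U X) = X)"
  by (rule borel_coords_inverse[OF assms]) blast

section \<open>Closures in projective space\<close>

lemma proj_point_eqD:
  assumes "proj_point Z = proj_point Z'"
  obtains c where "c \<noteq> 0" "Z = (\<lambda>\<alpha>. c * Z' \<alpha>)"
proof -
  have "Z \<in> proj_point Z" unfolding proj_point_def by (auto intro: exI[of _ 1])
  then show ?thesis using that assms unfolding proj_point_def by auto
qed

lemma proj_point_scale:
  assumes "c \<noteq> 0"
  shows "proj_point (\<lambda>\<alpha>. c * Z \<alpha>) = proj_point Z"
proof (intro equalityI subsetI)
  fix W assume "W \<in> proj_point (\<lambda>\<alpha>. c * Z \<alpha>)"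
  then obtain b where "b \<noteq> 0" "W = (\<lambda>\<alpha>. b * (c * Z \<alpha>))" unfolding proj_point_def by auto
  then show "W \<in> proj_point Z" unfolding proj_point_def using assms
    by (auto intro!: exI[of _ "b * c"] simp: mult.assoc)
next
  fix W assume "W \<in> proj_point Z"
  then obtain b where "b \<noteq> 0" "W = (\<lambda>\<alpha>. b * Z \<alpha>)" unfolding proj_point_def by auto
  then show "W \<in> proj_point (\<lambda>\<alpha>. c * Z \<alpha>)" unfolding proj_point_def using assms
    by (auto intro!: exI[of _ "b / c"])
qed

text \<open>The nonzero tensors of which some nonzero multiple is close to \<open>Y\<close> form an
  open set invariant under scaling. Its image is therefore an open neighbourhood of
  \<open>proj_point Y\<close> and meets the given set.\<close>

lemma proj_closure_approx:
  assumes Y: "Y \<in> Ten d n" "Y \<noteq> (\<lambda>_. 0)" and "0 < \<epsilon>"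
    and clos: "proj_point Y \<in> projective_space d n closure_of {proj_point Z | Z. Z \<in> Q}"
  shows "\<exists>Z\<in>Q. \<exists>s. \<forall>\<alpha>\<in>multi_indices d n. cmod (s * Z \<alpha> - Y \<alpha>) \<le> \<epsilon>"
proof -
  let ?V = "Ten d n - {\<lambda>_. 0}" and ?M = "multi_indices d n"
  define G where "G s = {Z. \<forall>\<alpha>\<in>?M. cmod (s * Z \<alpha> - Y \<alpha>) < \<epsilon>}" for s
  define W where "W = {Z\<in>?V. \<exists>s. s \<noteq> 0 \<and> Z \<in> G s}"
  have "open (G s)" for s
  proof -
    have "G s = (\<Inter>\<alpha>\<in>?M. {Z. cmod (s * Z \<alpha> - Y \<alpha>) < \<epsilon>})" unfolding G_def by auto
    moreover have "open {Z :: tensor. cmod (s * Z \<alpha> - Y \<alpha>) < \<epsilon>}" for \<alpha>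
      by (intro open_Collect_less continuous_intros continuous_on_product_coordinates)
    ultimately show ?thesis by (simp add: open_INT)
  qed
  then have "open (\<Union>s\<in>{s. s \<noteq> 0}. G s)" by (intro open_UN) auto
  moreover have "W = ?V \<inter> (\<Union>s\<in>{s. s \<noteq> 0}. G s)" unfolding W_def by auto
  ultimately have Wopen: "openin (top_of_set ?V) W" by (simp add: openin_open_Int)
  have sat: "Z \<in> W" if Z: "Z \<in> ?V" "proj_point Z \<in> proj_point ` W" for Z
  proof -
    obtain Z' where Z': "Z' \<in> W" "proj_point Z = proj_point Z'" using Z(2) by blast
    obtain c where c: "c \<noteq> 0" "Z = (\<lambda>\<alpha>. c * Z' \<alpha>)" using proj_point_eqD[OF Z'(2)] by blast
    obtain s where s: "s \<noteq> 0" "Z' \<in> G s" using Z'(1) unfolding W_def by blast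
    have "Z \<in> G (s / c)" using s(2) c unfolding G_def by simp
    moreover have "s / c \<noteq> 0" using s(1) c(1) by simp
    ultimately show ?thesis using Z(1) unfolding W_def by blast
  qed
  have "{Z\<in>?V. proj_point Z \<in> proj_point ` W} = W" using sat unfolding W_def by blast
  moreover have "proj_point ` W \<subseteq> proj_point ` ?V" unfolding W_def by blast
  ultimately have "openin (projective_space d n) (proj_point ` W)"
    unfolding openin_projective_space using Wopen by simp
  moreover have "proj_point Y \<in> proj_point ` W"
  proof (rule imageI)
    have "Y \<in> G 1" unfolding G_def using \<open>0 < \<epsilon>\<close> by simp
    then show "Y \<in> W" unfolding W_def using Y by (auto intro: exI[of _ 1])
  qed
  ultimately have "\<exists>P. P \<in> {proj_point Z | Z. Z \<in> Q} \<and> P \<in> proj_point ` W"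
    using clos unfolding in_closure_of by (elim conjE allE[of _ "proj_point ` W"]) simp
  then obtain P where P: "P \<in> {proj_point Z | Z. Z \<in> Q}" "P \<in> proj_point ` W" by blast
  then obtain Z Z' where Z: "Z \<in> Q" "Z' \<in> W" "proj_point Z = proj_point Z'" by auto
  obtain c where c: "c \<noteq> 0" "Z = (\<lambda>\<alpha>. c * Z' \<alpha>)" using proj_point_eqD[OF Z(3)] by blast
  obtain s where s: "s \<noteq> 0" "Z' \<in> G s" using Z(2) unfolding W_def by blast
  have "\<forall>\<alpha>\<in>?M. cmod ((s / c) * Z \<alpha> - Y \<alpha>) \<le> \<epsilon>" using s(2) c unfolding G_def by (auto intro: less_imp_le)
  then show ?thesis using Z(1) by blast
qed

text \<open>A neighbourhood of \<open>proj_point Y\<close> pulls back to an open set of tensors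
  containing \<open>Y\<close>. Coordinatewise convergence is convergence in the function topology,
  so some rescaled \<open>Z m\<close> enters this set, and rescaling does not move the projective
  point.\<close>

lemma proj_closure_limit:
  assumes Y: "Y \<in> Ten d n" "Y \<noteq> (\<lambda>_. 0)"
    and Z: "\<And>m. Z m \<in> Q" "Q \<subseteq> Ten d n - {\<lambda>_. 0}" "\<And>m. s m \<noteq> 0"
    and lim: "\<And>\<alpha>. (\<lambda>m. s m * Z m \<alpha>) \<longlonglongrightarrow> Y \<alpha>"
  shows "proj_point Y \<in> projective_space d n closure_of {proj_point Z | Z. Z \<in> Q}"
  unfolding in_closure_of
proof (intro conjI allI impI)
  let ?V = "Ten d n - {\<lambda>_. 0}"
  show "proj_point Y \<in> topspace (projective_space d n)" using Y unfolding topspace_projective_space by blast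
  fix G assume G: "proj_point Y \<in> G \<and> openin (projective_space d n) G"
  then have "openin (top_of_set ?V) {X\<in>?V. proj_point X \<in> G}" unfolding openin_projective_space by blast
  then obtain T where T: "open T" "{X\<in>?V. proj_point X \<in> G} = ?V \<inter> T" unfolding openin_open by blast
  have "Y \<in> T" using T(2) Y G by blast
  have "((\<lambda>m \<alpha>. s m * Z m \<alpha>) \<longlongrightarrow> Y) sequentially"
  proof -
    have "limitin (product_topology (\<lambda>_. euclidean) UNIV) (\<lambda>m \<alpha>. s m * Z m \<alpha>) Y sequentially"
      unfolding limitin_componentwise using lim by simp
    then show ?thesis by (simp add: euclidean_product_topology)
  qed
  then have "\<forall>\<^sub>F m in sequentially. (\<lambda>\<alpha>. s m * Z m \<alpha>) \<in> T" using T(1) \<open>Y \<in> T\<close> by (rule topological_tendstoD)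
  then obtain m where m: "(\<lambda>\<alpha>. s m * Z m \<alpha>) \<in> T" unfolding eventually_sequentially by blast
  have "Z m \<in> ?V" using Z by blast
  then have "(\<lambda>\<alpha>. s m * Z m \<alpha>) \<in> ?V" using Z(3)[of m] unfolding Ten_def by (auto simp: fun_eq_iff)
  then have "proj_point (\<lambda>\<alpha>. s m * Z m \<alpha>) \<in> G" using T(2) m by blast
  then have "proj_point (Z m) \<in> G" unfolding proj_point_scale[OF Z(3)] .
  then show "\<exists>y. y \<in> {proj_point Z | Z. Z \<in> Q} \<and> y \<in> G" using Z(1) by blast
qed

lemma marginal_eq_reversed_diag_iff:
  "marginal d n Y i = reversed_diag (component n p i) \<longleftrightarrow>
    (\<forall>a<n i. \<forall>b<n i. marginal_entry d n Y i a b = of_bool (a = b) * of_real (Poly_Mapping.lookup p (i, n i - 1 - a)))"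
proof -
  have 1: "marginal d n Y i = Matrix.mat (n i) (n i) (\<lambda>(a, b). marginal_entry d n Y i a b)"
    unfolding marginal_def partial_trace_def marginal_entry_def ..
  have 2: "reversed_diag (component n p i) = Matrix.mat (n i) (n i)
      (\<lambda>(a, b). of_bool (a = b) * of_real (Poly_Mapping.lookup p (i, n i - 1 - a)))"
    unfolding reversed_diag_def component_def mat_diag_def by (rule eq_matI) auto
  show ?thesis unfolding 1 2 by (auto simp: mat_eq_iff)
qed

text \<open>The hull condition holds at every \<open>U\<close> because \<open>U X\<close> has the
  same orbit as \<open>X\<close>: a limit point of the orbit of \<open>X\<close> constrains the
  support of each tensor in that orbit.\<close>

theorem Borel_polytope_eq:
  assumes X: "X \<in> Ten d n" "X \<noteq> (\<lambda>_. 0)"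
  shows "Borel_polytope d n X = {p \<in> P_plus_tuple d n. \<forall>U. borel_coords d n U \<longrightarrow>
    in_weight_hull d n (\<lambda>i a. Poly_Mapping.lookup p (i, n i - 1 - a)) (supp d n (kron d n U X))}"
proof -
  let ?orb = "{kron d n U X | U. borel_coords d n U}"
  have orbit: "{proj_point (Borel_action d n R X) | R. R \<in> Borel_group d n} = {proj_point Z | Z. Z \<in> ?orb}"
    unfolding Borel_orbit_eq by blast
  have Q: "?orb \<subseteq> Ten d n - {\<lambda>_. 0}"
  proof
    fix Z assume "Z \<in> ?orb"
    then obtain U where U: "borel_coords d n U" "Z = kron d n U X" by blast
    obtain V where "\<forall>X\<in>Ten d n. kron d n V (kron d n U X) = X"
      using borel_coords_left_inverse[OF U(1)] by blast
    then have "kron d n V Z = X" using X U(2) by simp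
    moreover have "kron d n V (\<lambda>_. 0) = (\<lambda>_. 0)" unfolding kron_def by auto
    ultimately have "Z \<noteq> (\<lambda>_. 0)" using X(2) by auto
    then show "Z \<in> Ten d n - {\<lambda>_. 0}" using U(2) by simp
  qed
  have "p \<in> Borel_polytope d n X \<longleftrightarrow> (\<forall>U. borel_coords d n U \<longrightarrow>
    in_weight_hull d n (\<lambda>i a. Poly_Mapping.lookup p (i, n i - 1 - a)) (supp d n (kron d n U X)))"
    if p: "p \<in> P_plus_tuple d n" for p
  proof -
    \<comment> \<open>The reversed spectra, increasing in \<open>a\<close>, in the order in which
      they stand on the diagonals of the marginals.\<close>
    define p' where "p' i a = Poly_Mapping.lookup p (i, n i - 1 - a)" for i a
    have P: "component n p i \<in> P_plus (n i)" if "i \<in> {1..d}" for i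
      using p that unfolding P_plus_tuple_def by blast
    have mono: "p' i a \<le> p' i b" if "i \<in> {1..d}" "a \<le> b" "b < n i" for i a b
    proof -
      have "n i - 1 - b \<le> n i - 1 - a \<and> n i - 1 - a < n i" using that by simp
      then show ?thesis using P[OF that(1)] unfolding P_plus_def component_def p'_def by auto
    qed
    have p01: "0 \<le> p' i a \<and> p' i a \<le> 1" if "i \<in> {1..d}" "a < n i" for i a
    proof -
      have nonneg: "0 \<le> Poly_Mapping.lookup p (i, j)" if "j < n i" for j
        using P[OF \<open>i \<in> {1..d}\<close>] that unfolding P_plus_def component_def by auto
      have "(\<Sum>j<n i. Poly_Mapping.lookup p (i, j)) = 1"
        using P[OF \<open>i \<in> {1..d}\<close>] unfolding P_plus_def component_def by simp
      moreover have "Poly_Mapping.lookup p (i, n i - 1 - a) \<le> (\<Sum>j<n i. Poly_Mapping.lookup p (i, j))"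
        using nonneg that by (intro member_le_sum[of "n i - 1 - a" "{..<n i}" "\<lambda>j. Poly_Mapping.lookup p (i, j)"]) auto
      ultimately show ?thesis using nonneg[of "n i - 1 - a"] that unfolding p'_def by simp
    qed
    show ?thesis unfolding p'_def[symmetric, abs_def]
    proof
      assume "p \<in> Borel_polytope d n X"
      then obtain Y where Y: "Y \<in> Ten d n" "tensor_norm d n Y = 1"
        and clos: "proj_point Y \<in> projective_space d n closure_of {proj_point Z | Z. Z \<in> ?orb}"
        and marg: "\<forall>i\<in>{1..d}. marginal d n Y i = reversed_diag (component n p i)"
        unfolding Borel_polytope_def orbit by auto
      have Y1: "norm_sq d n Y = 1" using Y(2) unfolding tensor_norm_eq_1_iff .
      then have "Y \<noteq> (\<lambda>_. 0)" by (auto simp: norm_sq_def)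
      note approx = proj_closure_approx[OF Y(1) this _ clos]
      show "\<forall>U. borel_coords d n U \<longrightarrow> in_weight_hull d n p' (supp d n (kron d n U X))"
      proof (intro allI impI)
        fix U assume U: "borel_coords d n U"
        obtain V where V: "borel_coords d n V" "\<forall>X\<in>Ten d n. kron d n V (kron d n U X) = X"
          using borel_coords_left_inverse[OF U] by blast
        show "in_weight_hull d n p' (supp d n (kron d n U X))"
        proof (rule in_weight_hull_of_approx[OF Y1])
          show "marginal_entry d n Y i a b = of_bool (a = b) * of_real (p' i a)"
            if "i \<in> {1..d}" "a < n i" "b < n i" for i a b
            using marg that unfolding marginal_eq_reversed_diag_iff p'_def by blast
          show "p' i a \<le> p' i b" if "i \<in> {1..d}" "a \<le> b" "b < n i" for i a b by (rule mono[OF that])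
          fix \<epsilon> :: real assume "0 < \<epsilon>"
          from approx[OF this] obtain T s where T: "borel_coords d n T"
            "\<forall>\<alpha>\<in>multi_indices d n. cmod (s * kron d n T X \<alpha> - Y \<alpha>) \<le> \<epsilon>" by auto
          obtain T' where T': "borel_coords d n T'" "\<And>X. kron d n T (kron d n V X) = kron d n T' X"
            "\<And>i a. i \<in> {1..d} \<Longrightarrow> a < n i \<Longrightarrow> T' i a a = T i a a * V i a a"
            using borel_coords_mult[OF T(1) V(1)] by blast
          \<comment> \<open>Moves the base point of the orbit from \<open>X\<close> to
            \<open>U X\<close>: \<open>T'\<close> is the product of \<open>T\<close> with the
            inverse \<open>V\<close> of \<open>U\<close>.\<close>
          have "kron d n T' (kron d n U X) = kron d n T X" using T'(2)[of "kron d n U X"] V(2) X(1) by simp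
          then show "\<exists>T s. borel_coords d n T \<and>
              (\<forall>\<alpha>\<in>multi_indices d n. cmod (s * kron d n T (kron d n U X) \<alpha> - Y \<alpha>) \<le> \<epsilon>)"
            using T(2) T'(1) by (intro exI[of _ T'] exI[of _ s]) simp
        qed
      qed
    next
      assume hull: "\<forall>U. borel_coords d n U \<longrightarrow> in_weight_hull d n p' (supp d n (kron d n U X))"
      have "\<exists>\<delta>>0. \<forall>U. borel_coords d n U \<longrightarrow>
          \<delta> * exp (2 * log_character d n p' U) \<le> norm_sq d n (kron d n U X)"
      proof (rule norm_sq_lower_bound)
        show "p' i a \<le> p' i b" if "i \<in> {1..d}" "a \<le> b" "b < n i" for i a b by (rule mono[OF that])
        show "0 \<le> p' i a \<and> p' i a \<le> 1" if "i \<in> {1..d}" "a < n i" for i a by (rule p01[OF that])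
        show "in_weight_hull d n p' (supp d n (kron d n U X))" if "borel_coords d n U" for U
          using hull that by simp
      qed
      then obtain \<delta> where "0 < \<delta>" and \<delta>: "\<And>U. borel_coords d n U \<Longrightarrow>
          \<delta> * exp (2 * log_character d n p' U) \<le> norm_sq d n (kron d n U X)" by blast
      obtain Y U s where Y: "Y \<in> Ten d n" "norm_sq d n Y = 1"
        and marg: "\<forall>i\<in>{1..d}. \<forall>a<n i. \<forall>b<n i. marginal_entry d n Y i a b = of_bool (a = b) * of_real (p' i a)"
        and U: "\<forall>m. borel_coords d n (U m) \<and> s m \<noteq> 0"
        and lim: "\<forall>\<alpha>. (\<lambda>m. s m * kron d n (U m) X \<alpha>) \<longlonglongrightarrow> Y \<alpha>"
        using exists_moment_limit[of \<delta> d n p' X] \<open>0 < \<delta>\<close> \<delta> by blast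
      have "Y \<noteq> (\<lambda>_. 0)" using Y(2) by (auto simp: norm_sq_def)
      have "proj_point Y \<in> projective_space d n closure_of {proj_point Z | Z. Z \<in> ?orb}"
        by (rule proj_closure_limit[where Z = "\<lambda>m. kron d n (U m) X" and s = s, OF Y(1) \<open>Y \<noteq> (\<lambda>_. 0)\<close> _ Q])
           (use U lim in blast)+
      moreover have "\<forall>i\<in>{1..d}. marginal d n Y i = reversed_diag (component n p i)"
        using marg unfolding marginal_eq_reversed_diag_iff p'_def by blast
      ultimately show "p \<in> Borel_polytope d n X"
        unfolding Borel_polytope_def orbit using p Y tensor_norm_eq_1_iff[of d n Y] by blast
    qed
  qed
  then show ?thesis unfolding Borel_polytope_def by blast
qed

section \<open>The Borel polytope as a polytope\<close>

text \<open>The coordinate \<open>y (S, \<alpha>)\<close> is the coefficient of \<alpha> in the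
  convex combination belonging to the support \<open>S\<close>; each support has its own block,
  since its combination is chosen independently.\<close>

definition hull_marginal :: "((nat \<Rightarrow> nat) set \<times> (nat \<Rightarrow> nat) \<Rightarrow> real) \<Rightarrow> (nat \<Rightarrow> nat) set \<Rightarrow> nat \<Rightarrow> nat \<Rightarrow> real" where
  "hull_marginal y S i j = (\<Sum>\<alpha>\<in>S. y (S, \<alpha>) * weight_vec \<alpha> (i, j))"

definition block_indicator :: "(nat \<Rightarrow> nat) set \<Rightarrow> ((nat \<Rightarrow> nat) \<Rightarrow> bool) \<Rightarrow> (nat \<Rightarrow> nat) set \<times> (nat \<Rightarrow> nat) \<Rightarrow> real" where
  "block_indicator S Q v = of_bool (fst v = S \<and> Q (snd v))"

text \<open>A point of the polyhedron consists of one probability distribution on each \<open>S \<in> \<S>\<close>, all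
  with the same marginals, which are moreover increasing.\<close>

definition hull_constraints :: "nat \<Rightarrow> (nat \<Rightarrow> nat) \<Rightarrow> (nat \<Rightarrow> nat) set set \<Rightarrow> (nat \<Rightarrow> nat) set \<Rightarrow>
    (((nat \<Rightarrow> nat) set \<times> (nat \<Rightarrow> nat) \<Rightarrow> real) \<times> real) set" where
  "hull_constraints d n \<S> S0 =
    (\<lambda>v. (\<lambda>w. of_bool (w = v), 0)) ` (SIGMA S:\<S>. S) \<union>
    (\<lambda>S. (block_indicator S (\<lambda>_. True), - 1)) ` \<S> \<union>
    (\<lambda>S. (\<lambda>v. - block_indicator S (\<lambda>_. True) v, 1)) ` \<S> \<union>
    (\<lambda>(S, i, j). (\<lambda>v. block_indicator S (\<lambda>\<alpha>. \<alpha> i = j) v - block_indicator S0 (\<lambda>\<alpha>. \<alpha> i = j) v, 0)) `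
      (\<S> \<times> (SIGMA i:{1..d}. {..<n i})) \<union>
    (\<lambda>(S, i, j). (\<lambda>v. block_indicator S0 (\<lambda>\<alpha>. \<alpha> i = j) v - block_indicator S (\<lambda>\<alpha>. \<alpha> i = j) v, 0)) `
      (\<S> \<times> (SIGMA i:{1..d}. {..<n i})) \<union>
    (\<lambda>(i, k, j). (\<lambda>v. block_indicator S0 (\<lambda>\<alpha>. \<alpha> i = k) v - block_indicator S0 (\<lambda>\<alpha>. \<alpha> i = j) v, 0)) `
      (SIGMA i:{1..d}. SIGMA k:{..<n i}. {..k})"

lemma ball_image_triple:
  "(\<forall>k\<in>(\<lambda>(x, y, z). F x y z) ` (SIGMA x:A. SIGMA y:B x. C x y). P k) \<longleftrightarrow>
    (\<forall>x\<in>A. \<forall>y\<in>B x. \<forall>z\<in>C x y. P (F x y z))"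
  by auto

lemma sum_block_indicator:
  assumes "finite \<S>" "\<forall>S\<in>\<S>. finite S" "S \<in> \<S>"
  shows "(\<Sum>v\<in>(SIGMA S:\<S>. S). block_indicator S Q v * y v) = (\<Sum>\<alpha>\<in>S. y (S, \<alpha>) * of_bool (Q \<alpha>))"
proof -
  have "(\<Sum>v\<in>(SIGMA S:\<S>. S). block_indicator S Q v * y v) =
      (\<Sum>(T, \<alpha>)\<in>(SIGMA S:\<S>. S). of_bool (T = S \<and> Q \<alpha>) * y (T, \<alpha>))"
    unfolding block_indicator_def by (intro sum.cong refl) auto
  also have "\<dots> = (\<Sum>T\<in>\<S>. \<Sum>\<alpha>\<in>T. of_bool (T = S \<and> Q \<alpha>) * y (T, \<alpha>))"
    by (rule sum.Sigma[symmetric]) (use assms in auto)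
  also have "\<dots> = (\<Sum>T\<in>\<S>. if T = S then \<Sum>\<alpha>\<in>S. y (S, \<alpha>) * of_bool (Q \<alpha>) else 0)"
    by (intro sum.cong refl) (auto intro!: sum.cong simp: mult.commute)
  also have "\<dots> = (\<Sum>\<alpha>\<in>S. y (S, \<alpha>) * of_bool (Q \<alpha>))" using assms by simp
  finally show ?thesis .
qed

text \<open>Total mass 1 and equality of marginals are recovered from pairs of opposite
  inequalities.\<close>

lemma polyhedral_hull_constraints_iff:
  assumes fin: "finite \<S>" "\<forall>S\<in>\<S>. finite S" and S0: "S0 \<in> \<S>"
  shows "y \<in> polyhedral (SIGMA S:\<S>. S) (hull_constraints d n \<S> S0) \<longleftrightarrow>
    (\<forall>v. v \<notin> (SIGMA S:\<S>. S) \<longrightarrow> y v = 0) \<and> (\<forall>S\<in>\<S>. \<forall>\<alpha>\<in>S. 0 \<le> y (S, \<alpha>)) \<and>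
    (\<forall>S\<in>\<S>. (\<Sum>\<alpha>\<in>S. y (S, \<alpha>)) = 1) \<and>
    (\<forall>S\<in>\<S>. \<forall>i\<in>{1..d}. \<forall>j<n i. hull_marginal y S i j = hull_marginal y S0 i j) \<and>
    (\<forall>i\<in>{1..d}. \<forall>k<n i. \<forall>j\<le>k. hull_marginal y S0 i j \<le> hull_marginal y S0 i k)"
proof -
  let ?J = "SIGMA S:\<S>. S"
  have finJ: "finite ?J" using fin by (intro finite_SigmaI) auto
  have single: "(\<Sum>v\<in>?J. of_bool (v = w) * y v) = y w" if "w \<in> ?J" for w
  proof -
    have "(\<Sum>v\<in>?J. of_bool (v = w) * y v) = (\<Sum>v\<in>?J. if v = w then y w else 0)" by (intro sum.cong) auto
    then show ?thesis using finJ that by simp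
  qed
  have tot: "(\<Sum>v\<in>?J. block_indicator S (\<lambda>_. True) v * y v) = (\<Sum>\<alpha>\<in>S. y (S, \<alpha>))" if "S \<in> \<S>" for S
    using sum_block_indicator[OF fin that] by simp
  have mg: "(\<Sum>v\<in>?J. block_indicator S (\<lambda>\<alpha>. \<alpha> i = j) v * y v) = hull_marginal y S i j" if "S \<in> \<S>" for S i j
    unfolding sum_block_indicator[OF fin that] hull_marginal_def weight_vec_def by simp
  have diff: "(\<Sum>v\<in>?J. (f v - g v) * y v) = (\<Sum>v\<in>?J. f v * y v) - (\<Sum>v\<in>?J. g v * y v)" for f g
    by (simp add: left_diff_distrib sum_subtractf)
  have neg: "(\<Sum>v\<in>?J. - f v * y v) = - (\<Sum>v\<in>?J. f v * y v)" for f by (simp add: sum_negf)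
  let ?ok = "\<lambda>k. 0 \<le> (\<Sum>v\<in>?J. fst k v * y v) + snd k"
  have split: "(\<forall>k\<in>hull_constraints d n \<S> S0. ?ok k) \<longleftrightarrow>
      (\<forall>v\<in>?J. 0 \<le> y v) \<and>
      (\<forall>S\<in>\<S>. 0 \<le> (\<Sum>\<alpha>\<in>S. y (S, \<alpha>)) - 1) \<and>
      (\<forall>S\<in>\<S>. 0 \<le> - (\<Sum>\<alpha>\<in>S. y (S, \<alpha>)) + 1) \<and>
      (\<forall>S\<in>\<S>. \<forall>i\<in>{1..d}. \<forall>j\<in>{..<n i}. 0 \<le> hull_marginal y S i j - hull_marginal y S0 i j) \<and>
      (\<forall>S\<in>\<S>. \<forall>i\<in>{1..d}. \<forall>j\<in>{..<n i}. 0 \<le> hull_marginal y S0 i j - hull_marginal y S i j) \<and>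
      (\<forall>i\<in>{1..d}. \<forall>k\<in>{..<n i}. \<forall>j\<in>{..k}. 0 \<le> hull_marginal y S0 i k - hull_marginal y S0 i j)"
  proof -
    have "(\<forall>k\<in>(\<lambda>v. (\<lambda>w. of_bool (w = v), 0)) ` ?J. ?ok k) \<longleftrightarrow> (\<forall>v\<in>?J. 0 \<le> y v)"
      unfolding ball_simps fst_conv snd_conv by (intro ball_cong refl) (simp add: single)
    moreover have "(\<forall>k\<in>(\<lambda>S. (block_indicator S (\<lambda>_. True), - 1)) ` \<S>. ?ok k) \<longleftrightarrow>
        (\<forall>S\<in>\<S>. 0 \<le> (\<Sum>\<alpha>\<in>S. y (S, \<alpha>)) - 1)"
      unfolding ball_simps fst_conv snd_conv by (intro ball_cong refl) (simp add: tot)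
    moreover have "(\<forall>k\<in>(\<lambda>S. (\<lambda>v. - block_indicator S (\<lambda>_. True) v, 1)) ` \<S>. ?ok k) \<longleftrightarrow>
        (\<forall>S\<in>\<S>. 0 \<le> - (\<Sum>\<alpha>\<in>S. y (S, \<alpha>)) + 1)"
      unfolding ball_simps fst_conv snd_conv by (intro ball_cong refl) (simp only: tot neg)
    moreover have "(\<forall>k\<in>(\<lambda>(S, i, j). (\<lambda>v. block_indicator S (\<lambda>\<alpha>. \<alpha> i = j) v - block_indicator S0 (\<lambda>\<alpha>. \<alpha> i = j) v, 0)) `
        (\<S> \<times> (SIGMA i:{1..d}. {..<n i})). ?ok k) \<longleftrightarrow>
        (\<forall>S\<in>\<S>. \<forall>i\<in>{1..d}. \<forall>j\<in>{..<n i}. 0 \<le> hull_marginal y S i j - hull_marginal y S0 i j)"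
      unfolding ball_image_triple fst_conv snd_conv diff
      by (intro ball_cong refl) (simp add: mg S0)
    moreover have "(\<forall>k\<in>(\<lambda>(S, i, j). (\<lambda>v. block_indicator S0 (\<lambda>\<alpha>. \<alpha> i = j) v - block_indicator S (\<lambda>\<alpha>. \<alpha> i = j) v, 0)) `
        (\<S> \<times> (SIGMA i:{1..d}. {..<n i})). ?ok k) \<longleftrightarrow>
        (\<forall>S\<in>\<S>. \<forall>i\<in>{1..d}. \<forall>j\<in>{..<n i}. 0 \<le> hull_marginal y S0 i j - hull_marginal y S i j)"
      unfolding ball_image_triple fst_conv snd_conv diff
      by (intro ball_cong refl) (simp add: mg S0)
    moreover have "(\<forall>k\<in>(\<lambda>(i, k, j). (\<lambda>v. block_indicator S0 (\<lambda>\<alpha>. \<alpha> i = k) v - block_indicator S0 (\<lambda>\<alpha>. \<alpha> i = j) v, 0)) `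
        (SIGMA i:{1..d}. SIGMA k:{..<n i}. {..k}). ?ok k) \<longleftrightarrow>
        (\<forall>i\<in>{1..d}. \<forall>k\<in>{..<n i}. \<forall>j\<in>{..k}. 0 \<le> hull_marginal y S0 i k - hull_marginal y S0 i j)"
      unfolding ball_image_triple fst_conv snd_conv diff
      by (intro ball_cong refl) (simp add: mg S0)
    ultimately show ?thesis unfolding hull_constraints_def ball_Un by (simp only: conj_assoc)
  qed
  have eq0: "0 \<le> a - b \<longleftrightarrow> b \<le> a" "0 \<le> - a + b \<longleftrightarrow> a \<le> b" for a b :: real by auto
  show ?thesis unfolding polyhedral_def mem_Collect_eq split eq0
    by (simp add: ball_conj_distrib[symmetric] order_eq_iff[where 'a = real]) (auto simp: order_eq_iff[where 'a = real])
qed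

lemma finite_hull_constraints:
  assumes "finite \<S>" "\<forall>S\<in>\<S>. finite S"
  shows "finite (hull_constraints d n \<S> S0)"
  unfolding hull_constraints_def
  by (intro finite_UnI finite_imageI finite_SigmaI finite_cartesian_product) (use assms in auto)

lemma rational_hull_constraints:
  assumes "k \<in> hull_constraints d n \<S> S0"
  shows "snd k \<in> \<rat>" "fst k v \<in> \<rat>"
  using assms unfolding hull_constraints_def block_indicator_def
  by (auto simp: of_bool_def)

text \<open>Reads the spectra off the block of \<open>S0\<close>; on the polyhedron all blocks have
  the same marginals. The index is reversed, which restores the decreasing order.\<close>

definition marginal_spectra :: "nat \<Rightarrow> (nat \<Rightarrow> nat) \<Rightarrow> (nat \<Rightarrow> nat) set \<Rightarrow>
    ((nat \<Rightarrow> nat) set \<times> (nat \<Rightarrow> nat) \<Rightarrow> real) \<Rightarrow> spectra" where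
  "marginal_spectra d n S0 y = Abs_poly_mapping (\<lambda>(i, k).
     if i \<in> {1..d} \<and> k < n i then hull_marginal y S0 i (n i - 1 - k) else 0)"

lemma lookup_marginal_spectra:
  "Poly_Mapping.lookup (marginal_spectra d n S0 y) (i, k) =
    (if i \<in> {1..d} \<and> k < n i then hull_marginal y S0 i (n i - 1 - k) else 0)"
proof -
  have "finite {t. (case t of (i, k) \<Rightarrow>
      if i \<in> {1..d} \<and> k < n i then hull_marginal y S0 i (n i - 1 - k) else 0) \<noteq> 0}"
    by (rule finite_subset[of _ "SIGMA i:{1..d}. {..<n i}"]) (auto split: if_splits)
  then show ?thesis unfolding marginal_spectra_def by simp
qed

lemma lookup_scaleR_poly_mapping:
  "Poly_Mapping.lookup (r *\<^sub>R x) i = r *\<^sub>R Poly_Mapping.lookup x i" for x :: "'a \<Rightarrow>\<^sub>0 real"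
proof -
  have "finite {i. r *\<^sub>R Poly_Mapping.lookup x i \<noteq> 0}"
    by (rule finite_subset[OF _ finite_keys[of x]]) (auto simp: in_keys_iff)
  then show ?thesis unfolding scaleR_poly_mapping_def by simp
qed

lemma marginal_spectra_affine:
  "marginal_spectra d n S0 (\<lambda>v. (1 - s) * x v + s * y v) =
    (1 - s) *\<^sub>R marginal_spectra d n S0 x + s *\<^sub>R marginal_spectra d n S0 y"
proof (rule poly_mapping_eqI)
  fix t :: "nat \<times> nat"
  obtain i k where t: "t = (i, k)" by (cases t)
  have "hull_marginal (\<lambda>v. (1 - s) * x v + s * y v) S0 i j =
      (1 - s) * hull_marginal x S0 i j + s * hull_marginal y S0 i j" for j
    unfolding hull_marginal_def sum_distrib_left sum.distrib[symmetric]
    by (intro sum.cong refl) (simp only: distrib_right mult.assoc)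
  then show "Poly_Mapping.lookup (marginal_spectra d n S0 (\<lambda>v. (1 - s) * x v + s * y v)) t =
      Poly_Mapping.lookup ((1 - s) *\<^sub>R marginal_spectra d n S0 x + s *\<^sub>R marginal_spectra d n S0 y) t"
    unfolding t lookup_add lookup_scaleR_poly_mapping lookup_marginal_spectra by simp
qed

text \<open>The blocks of a point of the polyhedron are the convex coefficients required by the hull
  conditions; conversely, coefficients chosen for every support assemble into such a point, because
  all of them represent the same \<open>p\<close>.\<close>

lemma marginal_spectra_polyhedral:
  assumes fin: "finite \<S>" and sub: "\<And>S. S \<in> \<S> \<Longrightarrow> S \<subseteq> multi_indices d n" and S0: "S0 \<in> \<S>"
  shows "marginal_spectra d n S0 ` polyhedral (SIGMA S:\<S>. S) (hull_constraints d n \<S> S0) =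
    {p \<in> P_plus_tuple d n. \<forall>S\<in>\<S>. in_weight_hull d n (\<lambda>i a. Poly_Mapping.lookup p (i, n i - 1 - a)) S}"
    (is "?\<pi> ` ?F = ?P")
proof (intro equalityI subsetI)
  have finS: "\<forall>S\<in>\<S>. finite S" using sub finite_subset[OF _ finite_multi_indices[of d n]] by blast
  note mem = polyhedral_hull_constraints_iff[OF fin finS S0, where d = d and n = n]
  {
    fix p assume "p \<in> ?\<pi> ` ?F"
    then obtain y where y: "y \<in> ?F" "p = ?\<pi> y" by blast
    have nonneg: "0 \<le> y (S, \<alpha>)" if "S \<in> \<S>" "\<alpha> \<in> S" for S \<alpha> using y(1) that unfolding mem by blast
    have one: "(\<Sum>\<alpha>\<in>S. y (S, \<alpha>)) = 1" if "S \<in> \<S>" for S using y(1) that unfolding mem by blast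
    have eq: "hull_marginal y S i j = hull_marginal y S0 i j" if "S \<in> \<S>" "i \<in> {1..d}" "j < n i" for S i j
      using y(1) that unfolding mem by blast
    have mono: "hull_marginal y S0 i j \<le> hull_marginal y S0 i k" if "i \<in> {1..d}" "j \<le> k" "k < n i" for i j k
      using y(1) that unfolding mem by blast
    have lk: "Poly_Mapping.lookup p (i, k) = hull_marginal y S0 i (n i - 1 - k)" if "i \<in> {1..d}" "k < n i" for i k
      unfolding y(2) lookup_marginal_spectra using that by simp
    have "Poly_Mapping.keys p \<subseteq> (SIGMA i:{1..d}. {0..<n i})"
      unfolding y(2) by (auto simp: in_keys_iff lookup_marginal_spectra split: if_splits)
    moreover have "component n p i \<in> P_plus (n i)" if i: "i \<in> {1..d}" for i
    proof -
      have dec: "Poly_Mapping.lookup p (i, k) \<le> Poly_Mapping.lookup p (i, j)" if "j \<le> k" "k < n i" for j k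
        using that lk[OF i] mono[OF i, of "n i - 1 - k" "n i - 1 - j"] by simp
      have "0 \<le> Poly_Mapping.lookup p (i, j)" if "j < n i" for j
        unfolding lk[OF i that] hull_marginal_def weight_vec_def using nonneg[OF S0] by (intro sum_nonneg) auto
      \<comment> \<open>Every multi-index has exactly one \<open>i\<close>-th entry below
        \<open>n i\<close>, so a marginal inherits the total mass of its block.\<close>
      moreover have "(\<Sum>j<n i. Poly_Mapping.lookup p (i, j)) = 1"
      proof -
        have "(\<Sum>j<n i. Poly_Mapping.lookup p (i, j)) = (\<Sum>j<n i. hull_marginal y S0 i (n i - Suc j))"
          by (intro sum.cong refl) (simp add: lk[OF i])
        also have "\<dots> = (\<Sum>j<n i. hull_marginal y S0 i j)" by (rule sum.nat_diff_reindex)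
        also have "\<dots> = (\<Sum>\<alpha>\<in>S0. \<Sum>j<n i. y (S0, \<alpha>) * weight_vec \<alpha> (i, j))"
          unfolding hull_marginal_def by (rule sum.swap)
        also have "\<dots> = (\<Sum>\<alpha>\<in>S0. y (S0, \<alpha>))"
        proof (intro sum.cong refl)
          fix \<alpha> assume "\<alpha> \<in> S0"
          then have "\<alpha> i < n i" using sub[OF S0] multi_indices_less[of \<alpha> d n i] i by auto
          have "(\<Sum>j<n i. y (S0, \<alpha>) * weight_vec \<alpha> (i, j)) = (\<Sum>j<n i. if j = \<alpha> i then y (S0, \<alpha>) else 0)"
            by (intro sum.cong refl) (auto simp: weight_vec_def)
          then show "(\<Sum>j<n i. y (S0, \<alpha>) * weight_vec \<alpha> (i, j)) = y (S0, \<alpha>)" using \<open>\<alpha> i < n i\<close> by simp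
        qed
        finally show ?thesis using one[OF S0] by simp
      qed
      ultimately show ?thesis using dec unfolding P_plus_def component_def by auto
    qed
    ultimately have "p \<in> P_plus_tuple d n" unfolding P_plus_tuple_def by blast
    moreover have "in_weight_hull d n (\<lambda>i a. Poly_Mapping.lookup p (i, n i - 1 - a)) S" if S: "S \<in> \<S>" for S
      unfolding in_weight_hull_def
    proof (intro exI[of _ "\<lambda>\<alpha>. y (S, \<alpha>)"] conjI ballI)
      show "0 \<le> y (S, \<alpha>)" if "\<alpha> \<in> S" for \<alpha> by (rule nonneg[OF S that])
      show "(\<Sum>\<alpha>\<in>S. y (S, \<alpha>)) = 1" by (rule one[OF S])
      fix t assume "t \<in> (SIGMA i:{1..d}. {..<n i})"
      then obtain i j where t: "t = (i, j)" "i \<in> {1..d}" "j < n i" by auto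
      then have "n i - 1 - (n i - 1 - j) = j" "n i - 1 - j < n i" by auto
      then show "(\<Sum>\<alpha>\<in>S. y (S, \<alpha>) * weight_vec \<alpha> t) =
          (case t of (i, a) \<Rightarrow> Poly_Mapping.lookup p (i, n i - 1 - a))"
        using eq[OF S t(2,3)] lk[OF t(2), of "n i - 1 - j"] unfolding t(1) hull_marginal_def[symmetric] by simp
    qed
    ultimately show "p \<in> ?P" by blast
  }
  {
    fix p assume p: "p \<in> ?P"
    then have "\<forall>S\<in>\<S>. \<exists>q. (\<forall>\<alpha>\<in>S. 0 \<le> q \<alpha>) \<and> sum q S = 1 \<and> (\<forall>t\<in>(SIGMA i:{1..d}. {..<n i}).
        (\<Sum>\<alpha>\<in>S. q \<alpha> * weight_vec \<alpha> t) = (case t of (i, a) \<Rightarrow> Poly_Mapping.lookup p (i, n i - 1 - a)))"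
      unfolding in_weight_hull_def by blast
    then obtain q where q: "\<forall>S\<in>\<S>. (\<forall>\<alpha>\<in>S. 0 \<le> q S \<alpha>) \<and> sum (q S) S = 1 \<and> (\<forall>t\<in>(SIGMA i:{1..d}. {..<n i}).
        (\<Sum>\<alpha>\<in>S. q S \<alpha> * weight_vec \<alpha> t) = (case t of (i, a) \<Rightarrow> Poly_Mapping.lookup p (i, n i - 1 - a)))"
      unfolding bchoice_iff by blast
    \<comment> \<open>The value 0 off the blocks is demanded by \<open>polyhedral\<close>.\<close>
    define y where "y v = (if v \<in> (SIGMA S:\<S>. S) then q (fst v) (snd v) else 0)" for v
    have yq: "y (S, \<alpha>) = q S \<alpha>" if "S \<in> \<S>" "\<alpha> \<in> S" for S \<alpha> using that unfolding y_def by simp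
    have mg: "hull_marginal y S i j = Poly_Mapping.lookup p (i, n i - 1 - j)"
      if "S \<in> \<S>" "i \<in> {1..d}" "j < n i" for S i j
    proof -
      have "hull_marginal y S i j = (\<Sum>\<alpha>\<in>S. q S \<alpha> * weight_vec \<alpha> (i, j))"
        unfolding hull_marginal_def by (intro sum.cong refl) (simp add: yq that(1))
      moreover have "(i, j) \<in> (SIGMA i:{1..d}. {..<n i})" using that by simp
      ultimately show ?thesis using q that(1) by fastforce
    qed
    have P: "component n p i \<in> P_plus (n i)" if "i \<in> {1..d}" for i
      using p that unfolding P_plus_tuple_def by blast
    have "y \<in> ?F" unfolding mem
    proof (intro conjI ballI allI impI)
      show "y v = 0" if "v \<notin> (SIGMA S:\<S>. S)" for v using that unfolding y_def by simp
      show "0 \<le> y (S, \<alpha>)" if "S \<in> \<S>" "\<alpha> \<in> S" for S \<alpha> using q that by (simp add: yq)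
      show "(\<Sum>\<alpha>\<in>S. y (S, \<alpha>)) = 1" if "S \<in> \<S>" for S using q that by (simp add: yq)
      show "hull_marginal y S i j = hull_marginal y S0 i j" if "S \<in> \<S>" "i \<in> {1..d}" "j < n i" for S i j
        using mg[OF that] mg[OF S0 that(2,3)] by simp
      show "hull_marginal y S0 i j \<le> hull_marginal y S0 i k" if i: "i \<in> {1..d}" and "k < n i" "j \<le> k" for i j k
      proof -
        have "n i - 1 - k \<le> n i - 1 - j \<and> n i - 1 - j < n i" using that by simp
        then show ?thesis using P[OF i] mg[OF S0 i] that unfolding P_plus_def component_def by auto
      qed
    qed
    moreover have "?\<pi> y = p"
    proof (rule poly_mapping_eqI)
      fix t :: "nat \<times> nat"
      obtain i k where t: "t = (i, k)" by (cases t)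
      show "Poly_Mapping.lookup (?\<pi> y) t = Poly_Mapping.lookup p t"
      proof (cases "i \<in> {1..d} \<and> k < n i")
        case True
        then have "n i - 1 - (n i - 1 - k) = k" "n i - 1 - k < n i" by auto
        then show ?thesis unfolding t lookup_marginal_spectra using True mg[OF S0, of i "n i - 1 - k"] by simp
      next
        case False
        moreover have "Poly_Mapping.keys p \<subseteq> (SIGMA i:{1..d}. {0..<n i})"
          using p unfolding P_plus_tuple_def by blast
        ultimately have "(i, k) \<notin> Poly_Mapping.keys p" by auto
        then show ?thesis unfolding t lookup_marginal_spectra using False by (auto simp: in_keys_iff)
      qed
    qed
    ultimately show "p \<in> ?\<pi> ` ?F" by blast
  }
qed

theorem theoremA1:
  fixes d :: nat and n :: "nat \<Rightarrow> nat" and X :: tensor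
  assumes "X \<in> Ten d n" and "X \<noteq> (\<lambda>_. 0)"
  shows "polytope (Borel_polytope d n X) \<and>
    (\<forall>v. v extreme_point_of Borel_polytope d n X \<longrightarrow>
      (\<forall>i j. Poly_Mapping.lookup v (i, j) \<in> \<rat>))"
proof -
  define \<S> where "\<S> = {supp d n (kron d n U X) | U. borel_coords d n U}"
  have sub: "S \<subseteq> multi_indices d n" if "S \<in> \<S>" for S using that unfolding \<S>_def supp_def by auto
  have fin: "finite \<S>"
    by (rule finite_subset[of _ "Pow (multi_indices d n)"]) (use sub in auto)
  have finS: "\<forall>S\<in>\<S>. finite S" using sub finite_subset[OF _ finite_multi_indices[of d n]] by blast
  have "borel_coords d n (\<lambda>i a b. of_bool (a = b))" unfolding borel_coords_def by auto
  then obtain S0 where S0: "S0 \<in> \<S>" unfolding \<S>_def by blast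
  let ?J = "SIGMA S:\<S>. S" and ?CS = "hull_constraints d n \<S> S0" and ?\<pi> = "marginal_spectra d n S0"
  have "Borel_polytope d n X = {p \<in> P_plus_tuple d n. \<forall>S\<in>\<S>.
      in_weight_hull d n (\<lambda>i a. Poly_Mapping.lookup p (i, n i - 1 - a)) S}"
    unfolding Borel_polytope_eq[OF assms] \<S>_def by blast
  also have "\<dots> = ?\<pi> ` polyhedral ?J ?CS" by (rule marginal_spectra_polyhedral[OF fin sub S0, symmetric])
  finally have eq: "Borel_polytope d n X = ?\<pi> ` polyhedral ?J ?CS" .
  have finJ: "finite ?J" using fin finS by (intro finite_SigmaI) auto
  \<comment> \<open>The coordinates of each block are probabilities.\<close>
  have bounded: "\<forall>y\<in>polyhedral ?J ?CS. \<forall>v\<in>?J. \<bar>y v\<bar> \<le> 1"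
  proof (intro ballI)
    fix y v assume y: "y \<in> polyhedral ?J ?CS" and "v \<in> ?J"
    then obtain S \<alpha> where v: "v = (S, \<alpha>)" "S \<in> \<S>" "\<alpha> \<in> S" by auto
    note y' = y[unfolded polyhedral_hull_constraints_iff[OF fin finS S0]]
    have nonneg: "0 \<le> y (S, \<beta>)" if "\<beta> \<in> S" for \<beta> using y' v(2) that by blast
    have "(\<Sum>\<beta>\<in>S. y (S, \<beta>)) = 1" using y' v(2) by blast
    moreover have "y (S, \<alpha>) \<le> (\<Sum>\<beta>\<in>S. y (S, \<beta>))"
      using nonneg bspec[OF finS v(2)] v(3) by (intro member_le_sum[of \<alpha> S "\<lambda>\<beta>. y (S, \<beta>)"]) auto
    ultimately show "\<bar>y v\<bar> \<le> 1" using nonneg[OF v(3)] unfolding v(1) by simp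
  qed
  have "\<exists>V. finite V \<and> V \<subseteq> polyhedral ?J ?CS \<and> (\<forall>y\<in>V. \<forall>v. y v \<in> \<rat>) \<and>
      ?\<pi> ` polyhedral ?J ?CS = convex hull (?\<pi> ` V)"
  proof (rule bounded_rational_polyhedral_image[where J = ?J and CS = ?CS and B = 1 and \<pi> = ?\<pi>])
    show "finite ?J" by (rule finJ)
    show "finite ?CS" by (rule finite_hull_constraints[OF fin finS])
    show "snd k \<in> \<rat>" if "k \<in> ?CS" for k by (rule rational_hull_constraints(1)[OF that])
    show "fst k v \<in> \<rat>" if "k \<in> ?CS" for k v by (rule rational_hull_constraints(2)[OF that])
    show "\<forall>y\<in>polyhedral ?J ?CS. \<forall>v\<in>?J. \<bar>y v\<bar> \<le> 1" by (rule bounded)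
    show "?\<pi> (\<lambda>v. (1 - s) * x v + s * y v) = (1 - s) *\<^sub>R ?\<pi> x + s *\<^sub>R ?\<pi> y" for x y s
      by (rule marginal_spectra_affine)
  qed blast
  then obtain V where V: "finite V" "V \<subseteq> polyhedral ?J ?CS" "\<forall>y\<in>V. \<forall>v. y v \<in> \<rat>"
    "?\<pi> ` polyhedral ?J ?CS = convex hull (?\<pi> ` V)" by blast
  have hull: "Borel_polytope d n X = convex hull (?\<pi> ` V)" unfolding eq V(4) ..
  have "Poly_Mapping.lookup v (i, j) \<in> \<rat>" if v: "v extreme_point_of Borel_polytope d n X" for v i j
  proof -
    \<comment> \<open>An extreme point of a convex hull belongs to the generating set, so it is the
      image of a rational vertex, and marginals of rational distributions are rational.\<close>
    obtain y where y: "y \<in> V" "v = ?\<pi> y" using extreme_point_of_convex_hull v unfolding hull by blast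
    have "hull_marginal y S0 i k \<in> \<rat>" for k
      unfolding hull_marginal_def weight_vec_def using V(3) y(1) by (intro Rats_sum Rats_mult) (auto simp: of_bool_def)
    then show ?thesis unfolding y(2) lookup_marginal_spectra by simp
  qed
  then show ?thesis unfolding polytope_def using hull V(1) by blast
qed

end
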